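(* Let $U:\mathbb{R}^n\times\mathbb{R}^n\to\mathbb{R}$ be smooth and let $\rho:(0,\infty)\times\mathbb{R}^n\times\mathbb{R}^n\to[0,\infty)$ be a smooth non-negative solution of \[ \partial_t\rho=\Delta_v\rho-\langle\nabla_vU,\nabla_v\rho\rangle-\langle v,\nabla_x\rho\rangle \] satisfying, for some constants $c_0,k_0,\kappa\ge0$, \[ |\nabla\rho|\le c_0e^{-\frac12U}(|x|+|v|),\qquad \nabla^2\rho\ge-k_0e^{\kappa(|x|^2+|v|^2)}I,\qquad \nabla^2U\le k_0e^{\kappa(|x|^2+|v|^2)}I. \] Let $h=-\frac12\langle v,\nabla_xU\rangle+\frac12\Delta_vU-\frac14|\nabla_vU|^2$ and assume $\nabla^2h\ge-K$ for some constant symmetric non-negative definite $2n\times2n$ matrix $K$. Then for all $t>0$ and all $(x,v)$, \[ \nabla^2\log\rho-\tfrac12\nabla^2U\ \ge\ N(t), \] where $N$ is a solution of the matrix Riccati equation $\dot N=NC+C^TN+NDN-K$ satisfying $\lim_{t\to0}N(t)^{-1}=0$ (as provided by Lemma 3.1), with $C=\begin{pmatrix}O&-I\\O&O\end{pmatrix}$, $D=\begin{pmatrix}O&O\\O&2I\end{pmatrix}$.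
   Context: Coordinates on $\mathbb{R}^n\times\mathbb{R}^n$ are $(x,v)$; $\Delta_v=\sum_i\partial_{v_i}^2$; $\nabla_x,\nabla_v$ are partial gradients, $\nabla,\nabla^2$ the full gradient and Hessian in $(x,v)$, written as $2\times2$ block matrices of $n\times n$ blocks ordered $(x,v)$; $I,O$ are $n\times n$ identity and zero matrices (and $I$ also the $2n\times2n$ identity where appropriate); matrix inequalities are in the sense of quadratic forms. Lemma 3.1: for symmetric non-negative definite $K$ there exists a solution $N(t)$, $t>0$, of $\dot N=NC+C^TN+NDN-K$ with $\lim_{t\to0}N^{-1}=0$, $N\le0$, $\dot N\ge0$. *)

theory Defs
  imports "HOL-Analysis.Analysis"
begin

text \<open>Phase space R^n x R^n is modelled as real^('n + 'n): index Inl i is the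
  coordinate x_i, index Inr i is the coordinate v_i (block order (x,v)).\<close>

definition xpart :: "real^('n::finite + 'n) \<Rightarrow> real^'n" where
  "xpart z = (\<chi> i. z $ Inl i)"

definition vpart :: "real^('n::finite + 'n) \<Rightarrow> real^'n" where
  "vpart z = (\<chi> i. z $ Inr i)"

definition partial :: "'a::euclidean_space \<Rightarrow> ('a \<Rightarrow> real) \<Rightarrow> 'a \<Rightarrow> real" where
  "partial b f = (\<lambda>z. frechet_derivative f (at z) b)"

definition smooth_on :: "'a::euclidean_space set \<Rightarrow> ('a \<Rightarrow> real) \<Rightarrow> bool" where
  "smooth_on S f \<longleftrightarrow>
     (\<forall>bs. set bs \<subseteq> Basis \<longrightarrow> (\<forall>z\<in>S. foldr partial bs f differentiable (at z)))"

definition grad :: "(real^'m::finite \<Rightarrow> real) \<Rightarrow> real^'m \<Rightarrow> real^'m" where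
  "grad f z = (\<chi> i. partial (axis i 1) f z)"

definition hess :: "(real^'m::finite \<Rightarrow> real) \<Rightarrow> real^'m \<Rightarrow> real^'m^'m" where
  "hess f z = (\<chi> i j. partial (axis i 1) (partial (axis j 1) f) z)"

definition lap_v :: "(real^('n::finite + 'n) \<Rightarrow> real) \<Rightarrow> real^('n + 'n) \<Rightarrow> real" where
  "lap_v f z = (\<Sum>i\<in>UNIV. hess f z $ Inr i $ Inr i)"

definition grad_x :: "(real^('n::finite + 'n) \<Rightarrow> real) \<Rightarrow> real^('n + 'n) \<Rightarrow> real^'n" where
  "grad_x f z = (\<chi> i. grad f z $ Inl i)"

definition grad_v :: "(real^('n::finite + 'n) \<Rightarrow> real) \<Rightarrow> real^('n + 'n) \<Rightarrow> real^'n" where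
  "grad_v f z = (\<chi> i. grad f z $ Inr i)"

definition mat_le :: "real^'m::finite^'m \<Rightarrow> real^'m^'m \<Rightarrow> bool" where
  "mat_le A B \<longleftrightarrow> (\<forall>\<xi>. \<xi> \<bullet> (A *v \<xi>) \<le> \<xi> \<bullet> (B *v \<xi>))"

definition Cmat :: "real^('n::finite + 'n)^('n + 'n)" where
  "Cmat = (\<chi> a b. case (a, b) of (Inl i, Inr j) \<Rightarrow> (if i = j then -1 else 0) | _ \<Rightarrow> 0)"

definition Dmat :: "real^('n::finite + 'n)^('n + 'n)" where
  "Dmat = (\<chi> a b. case (a, b) of (Inr i, Inr j) \<Rightarrow> (if i = j then 2 else 0) | _ \<Rightarrow> 0)"

end

theory Submission
  imports Defs
begin

text \<open>
  The function \<open>u = (rho + \<delta>) exp (- U / 2)\<close> solves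
  \<open>u\<^sub>t = \<Delta>\<^sub>v u - v \<bullet> \<nabla>\<^sub>x u + h u\<close>, because constants solve the equation for \<open>rho\<close>.
  Let \<open>\<eta>\<close> be a path in phase space with \<open>\<eta>\<^sub>x' = \<eta>\<^sub>v\<close> and \<open>\<eta> = 0\<close> at some time \<open>s > 0\<close>, and let \<open>A\<close> be its
  action, with density \<open>\<eta> \<bullet> K \<eta> / 2 + |\<eta>\<^sub>v'|\<^sup>2 / 4\<close>. By semiconvexity of \<open>h\<close> and completion of the
  square, \<open>exp A\<close> times the geometric mean of \<open>u (t, z + \<eta> t)\<close> and \<open>u (t, z - \<eta> t)\<close> is a supersolution
  that equals \<open>u\<close> at time \<open>s\<close>. By comparison it dominates \<open>u\<close>, which is a midpoint convexity inequality
  for \<open>ln u\<close> with defect \<open>A\<close>. For the extremal path \<open>A = - \<eta> \<bullet> N \<eta> / 2\<close>, and the second-order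
  expansion gives the Hessian bound; finally \<open>\<delta> \<rightarrow> 0\<close>.

  The comparison needs \<open>u\<close> and \<open>h\<close> to grow at most like the exponential of a quadratic and like a quadratic,
  respectively. Both follow from the stationary solution \<open>g = exp (- U / 2)\<close>: testing its logarithmic equation
  with a radial bump bounds the mean of \<open>h\<close>, hence \<open>h\<close> itself; and comparing \<open>g\<close> with a Kolmogorov kernel
  issued from a tiny ball around a point, on which the Hessian bound on \<open>U\<close> keeps \<open>g\<close> large, bounds
  \<open>g\<close> at that point by \<open>g 0\<close>.
\<close>

section \<open>Second-order calculus along lines\<close>

text \<open>Nothing is known about \<open>rho\<close> at time 0, so paths are released at time
  \<open>t - T\<close> with \<open>T < t\<close>, and \<open>T\<close> tends to \<open>t\<close>
  only at the end, by continuity of \<open>N\<close>. The shift \<open>\<delta>\<close> is there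
  because \<open>rho\<close> may vanish, which would spoil the logarithms at the displaced points.
  Midpoint inequalities keep the comparison at the level of \<open>u\<close>: as the competitor is
  positive, a bound on \<open>u\<close> from above is all that is asked for at infinity, whereas a
  maximum principle for the Hessian of \<open>ln u\<close> would have to control higher derivatives
  there. The gradient bound controls \<open>rho\<close> only relative to
  \<open>exp (- U / 2)\<close>, and semiconvexity bounds \<open>h\<close> only from below; this is
  what makes the stationary solution worth studying. The Hessian bound on \<open>U\<close> is so
  weak that the ball on which \<open>g\<close> stays large has a radius of order
  \<open>exp (- const |z|^2)\<close>. Spreading from such a ball costs the kernel only a power of
  the radius, hence only a quadratic term in the logarithm, which is the growth that the comparison
  tolerates.\<close>

lemma partial_line:
  fixes f :: "'a::euclidean_space \<Rightarrow> real"
  assumes "f differentiable (at (z + s *\<^sub>R e))"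
  shows "((\<lambda>s. f (z + s *\<^sub>R e)) has_real_derivative partial e f (z + s *\<^sub>R e)) (at s)"
proof -
  have f: "(f has_derivative frechet_derivative f (at (z + s *\<^sub>R e))) (at (z + s *\<^sub>R e))"
    using assms frechet_derivative_works by blast
  have g: "((\<lambda>s. z + s *\<^sub>R e) has_derivative (\<lambda>h. h *\<^sub>R e)) (at s)"
    by (auto intro!: derivative_eq_intros)
  have l: "linear (frechet_derivative f (at (z + s *\<^sub>R e)))"
    using f has_derivative_linear by blast
  have "((\<lambda>s. f (z + s *\<^sub>R e)) has_derivative (\<lambda>h. frechet_derivative f (at (z + s *\<^sub>R e)) (h *\<^sub>R e))) (at s)"
    using has_derivative_compose[OF g f] .
  also have "(\<lambda>h. frechet_derivative f (at (z + s *\<^sub>R e)) (h *\<^sub>R e)) = (*) (partial e f (z + s *\<^sub>R e))"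
    using linear_cmul[OF l] by (auto simp: partial_def fun_eq_iff)
  finally show ?thesis unfolding has_field_derivative_def .
qed

lemma partial_decomp:
  fixes f :: "real^'m::finite \<Rightarrow> real"
  assumes "f differentiable (at z)"
  shows "partial \<xi> f z = (\<Sum>i\<in>UNIV. \<xi> $ i * partial (axis i 1) f z)"
proof -
  have l: "linear (frechet_derivative f (at z))"
    using assms frechet_derivative_works has_derivative_linear by blast
  have "partial \<xi> f z = frechet_derivative f (at z) (\<Sum>i\<in>UNIV. \<xi> $ i *\<^sub>R axis i 1)"
    using basis_expansion[of \<xi>] by (simp add: partial_def scalar_mult_eq_scaleR)
  also have "\<dots> = (\<Sum>i\<in>UNIV. \<xi> $ i * partial (axis i 1) f z)"
    by (simp add: partial_def linear_sum[OF l] linear_cmul[OF l])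
  finally show ?thesis .
qed

lemma partial_uminus:
  assumes "f differentiable (at z)"
  shows "partial (- \<xi>) f z = - partial \<xi> f z"
  using assms frechet_derivative_works has_derivative_linear linear_neg unfolding partial_def by blast

lemma partial_works:
  assumes "f differentiable (at z)"
  shows "(f has_derivative (\<lambda>b. partial b f z)) (at z)"
  using assms unfolding partial_def frechet_derivative_works .

lemma partial_eqI:
  assumes "(f has_derivative f') (at z)"
  shows "partial b f z = f' b"
  using frechet_derivative_at[OF assms] by (simp add: partial_def)

lemma partial_add:
  assumes "f differentiable (at z)" "g differentiable (at z)"
  shows "partial b (\<lambda>z. f z + g z) z = partial b f z + partial b g z"
  by (rule partial_eqI[OF has_derivative_add[OF partial_works[OF assms(1)] partial_works[OF assms(2)]]])

lemma partial_mult: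
  assumes "f differentiable (at z)" "g differentiable (at z)"
  shows "partial b (\<lambda>z. f z * g z) z = f z * partial b g z + partial b f z * g z"
  by (rule partial_eqI[OF has_derivative_mult[OF partial_works[OF assms(1)] partial_works[OF assms(2)]]])

text \<open>Second-order regularity in the form in which \<open>hess\<close> is built. It is closed
  under sums and products, so it passes from \<open>U\<close> and its partials to the potential
  formed from them.\<close>

definition twice_diff :: "(real^'m::finite \<Rightarrow> real) \<Rightarrow> bool" where
  "twice_diff f \<longleftrightarrow> (\<forall>z. f differentiable (at z)) \<and> (\<forall>i z. partial (axis i 1) f differentiable (at z))"

lemma twice_diff_const: "twice_diff (\<lambda>z :: real^'m::finite. c)"
proof -
  have "partial b (\<lambda>z. c) = (\<lambda>z. 0)" for b :: "real^'m::finite"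
    by (rule ext) (rule partial_eqI[OF has_derivative_const])
  then show ?thesis unfolding twice_diff_def by simp
qed

lemma twice_diff_nth: "twice_diff (\<lambda>z :: real^'m::finite. z $ i)"
proof -
  have d: "((\<lambda>z. z $ i) has_derivative (\<lambda>h. h $ i)) (at z)" for z :: "real^'m::finite"
    using bounded_linear_imp_has_derivative[OF bounded_linear_vec_nth] .
  have "partial b (\<lambda>z. z $ i) = (\<lambda>z. b $ i)" for b :: "real^'m::finite"
    using partial_eqI[OF d] by auto
  then show ?thesis unfolding twice_diff_def using differentiableI[OF d] by simp
qed

lemma twice_diff_add:
  assumes "twice_diff f" "twice_diff g" shows "twice_diff (\<lambda>z. f z + g z)"
proof -
  have "partial (axis i 1) (\<lambda>z. f z + g z) = (\<lambda>z. partial (axis i 1) f z + partial (axis i 1) g z)" for i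
    using assms unfolding twice_diff_def by (intro ext partial_add) blast+
  then show ?thesis using assms by (auto simp: twice_diff_def)
qed

lemma twice_diff_mult:
  assumes "twice_diff f" "twice_diff g" shows "twice_diff (\<lambda>z. f z * g z)"
proof -
  have "partial (axis i 1) (\<lambda>z. f z * g z) = (\<lambda>z. f z * partial (axis i 1) g z + partial (axis i 1) f z * g z)" for i
    using assms unfolding twice_diff_def by (intro ext partial_mult) blast+
  then show ?thesis using assms by (auto simp: twice_diff_def)
qed

lemma twice_diff_sum:
  assumes "finite A" "\<And>i. i \<in> A \<Longrightarrow> twice_diff (f i)" shows "twice_diff (\<lambda>z. \<Sum>i\<in>A. f i z)"
  using assms by (induction A rule: finite_induct) (auto simp: twice_diff_const intro!: twice_diff_add)

lemma twice_diff_line2: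
  assumes "twice_diff f"
  shows "((\<lambda>s. partial \<xi> f (z + s *\<^sub>R \<xi>)) has_real_derivative
      \<xi> \<bullet> (hess f (z + s *\<^sub>R \<xi>) *v \<xi>)) (at s)"
proof -
  have f: "\<And>z. f differentiable (at z)" "\<And>i z. partial (axis i 1) f differentiable (at z)"
    using assms by (auto simp: twice_diff_def)
  have "((\<lambda>s. \<Sum>j\<in>UNIV. \<xi> $ j * partial (axis j 1) f (z + s *\<^sub>R \<xi>)) has_real_derivative
     (\<Sum>j\<in>UNIV. \<xi> $ j * partial \<xi> (partial (axis j 1) f) (z + s *\<^sub>R \<xi>))) (at s)"
    by (intro DERIV_sum DERIV_cmult partial_line f)
  also have "(\<Sum>j\<in>UNIV. \<xi> $ j * partial \<xi> (partial (axis j 1) f) (z + s *\<^sub>R \<xi>)) =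
     (\<Sum>j\<in>UNIV. \<Sum>i\<in>UNIV. \<xi> $ j * \<xi> $ i * partial (axis i 1) (partial (axis j 1) f) (z + s *\<^sub>R \<xi>))"
    by (simp add: partial_decomp[OF f(2), of \<xi>] sum_distrib_left mult.assoc)
  also have "\<dots> = \<xi> \<bullet> (hess f (z + s *\<^sub>R \<xi>) *v \<xi>)"
    unfolding inner_vec_def matrix_vector_mult_def hess_def sum_distrib_left
    by (subst sum.swap) (simp add: sum_distrib_left mult_ac)
  finally show ?thesis by (simp add: partial_decomp[OF f(1), of \<xi>])
qed

text \<open>Two monotonicity arguments replace the integral remainder, so a pointwise lower bound on
  the second derivative is enough.\<close>

lemma taylor2_lower:
  fixes f :: "real \<Rightarrow> real"
  assumes f: "\<And>s. 0 \<le> s \<Longrightarrow> s \<le> 1 \<Longrightarrow> (f has_real_derivative f' s) (at s)"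
    and f': "\<And>s. 0 \<le> s \<Longrightarrow> s \<le> 1 \<Longrightarrow> (f' has_real_derivative f'' s) (at s)"
    and m: "\<And>s. 0 \<le> s \<Longrightarrow> s \<le> 1 \<Longrightarrow> m \<le> f'' s"
  shows "f 1 \<ge> f 0 + f' 0 + m / 2"
proof -
  have 1: "f' s \<ge> f' 0 + m * s" if "0 \<le> s" "s \<le> 1" for s
  proof -
    have "f' 0 - m * 0 \<le> f' s - m * s"
    proof (rule DERIV_nonneg_imp_nondecreasing[OF that(1), of "\<lambda>s. f' s - m * s"])
      fix x assume x: "0 \<le> x" "x \<le> s"
      have "((\<lambda>s. f' s - m * s) has_real_derivative f'' x - m) (at x)"
        using f'[of x] x that by (auto intro!: derivative_eq_intros)
      then show "\<exists>y. ((\<lambda>s. f' s - m * s) has_real_derivative y) (at x) \<and> 0 \<le> y"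
        using m[of x] x that by (intro exI[of _ "f'' x - m"]) auto
    qed
    then show ?thesis by simp
  qed
  have "f 0 - f' 0 * 0 - m * 0\<^sup>2 / 2 \<le> f 1 - f' 0 * 1 - m * 1\<^sup>2 / 2"
  proof (rule DERIV_nonneg_imp_nondecreasing[of 0 1 "\<lambda>s. f s - f' 0 * s - m * s\<^sup>2 / 2"])
    fix x :: real assume x: "0 \<le> x" "x \<le> 1"
    have "((\<lambda>s. f s - f' 0 * s - m * s\<^sup>2 / 2) has_real_derivative f' x - f' 0 - m * x) (at x)"
      using f[OF x] by (auto intro!: derivative_eq_intros)
    then show "\<exists>y. ((\<lambda>s. f s - f' 0 * s - m * s\<^sup>2 / 2) has_real_derivative y) (at x) \<and> 0 \<le> y"
      using 1[OF x] by (intro exI[of _ "f' x - f' 0 - m * x"]) auto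
  qed simp
  then show ?thesis by simp
qed

lemma twice_diff_taylor_lower:
  assumes "twice_diff f"
    and "\<And>s. 0 \<le> s \<Longrightarrow> s \<le> 1 \<Longrightarrow> m \<le> y \<bullet> (hess f (z + s *\<^sub>R y) *v y)"
  shows "f (z + y) \<ge> f z + partial y f z + m / 2"
  using taylor2_lower[of "\<lambda>s. f (z + s *\<^sub>R y)" "\<lambda>s. partial y f (z + s *\<^sub>R y)"
      "\<lambda>s. y \<bullet> (hess f (z + s *\<^sub>R y) *v y)" m] assms
  by (auto simp: twice_diff_line2 partial_line twice_diff_def)

lemma smooth_on_partial:
  assumes "smooth_on S f" "b \<in> Basis" shows "smooth_on S (partial b f)"
  unfolding smooth_on_def
proof (intro allI impI)
  fix bs :: "'a list" assume "set bs \<subseteq> Basis"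
  then have "set (bs @ [b]) \<subseteq> Basis" using assms(2) by simp
  then show "\<forall>z\<in>S. foldr partial bs (partial b f) differentiable at z"
    using assms(1)[unfolded smooth_on_def, rule_format, of "bs @ [b]"] by simp
qed

lemma smooth_on_differentiable:
  assumes "smooth_on S f" "z \<in> S" shows "f differentiable (at z)"
  using assms(1)[unfolded smooth_on_def, rule_format, of "[]"] assms(2) by simp

lemma axis_in_Basis: "axis i 1 \<in> (Basis :: (real^'m::finite) set)"
  by simp

lemma smooth_on_twice_diff:
  assumes "smooth_on UNIV f" shows "twice_diff f"
  unfolding twice_diff_def
  using smooth_on_differentiable[OF assms] smooth_on_differentiable[OF smooth_on_partial[OF assms axis_in_Basis]]
  by simp

section \<open>A mean upper bound for the potential\<close>

lemma integral_affine_compact_support: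
  fixes f :: "'a::euclidean_space \<Rightarrow> real"
  assumes f: "continuous_on UNIV f" and supp: "\<And>z. norm z > R \<Longrightarrow> f z = 0" and m: "m \<noteq> 0"
  shows "((\<lambda>z. f (m *\<^sub>R z + c)) has_integral (integral UNIV f / \<bar>m\<bar> ^ DIM('a))) UNIV"
proof -
  obtain a where a: "cball (0::'a) R \<subseteq> cbox (- a) a"
    using bounded_subset_cbox_symmetric[OF bounded_cball] by blast
  have z0: "f z = 0" if "z \<notin> cbox (-a) a" for z
    using supp[of z] a that by (meson linorder_not_le mem_cball_0 subsetD)
  have i: "(f has_integral integral (cbox (-a) a) f) (cbox (-a) a)"
    using integrable_continuous[OF continuous_on_subset[OF f]] by blast
  have "(f has_integral integral (cbox (-a) a) f) UNIV"
    by (rule has_integral_on_superset[OF i]) (use z0 in auto)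
  then have I: "integral UNIV f = integral (cbox (-a) a) f"
    by blast
  show ?thesis
  proof (rule has_integral_on_superset[where S="(\<lambda>x. (1 / m) *\<^sub>R x + - ((1 / m) *\<^sub>R c)) ` cbox (- a) a"])
    show "((\<lambda>z. f (m *\<^sub>R z + c)) has_integral integral UNIV f / \<bar>m\<bar> ^ DIM('a))
       ((\<lambda>x. (1 / m) *\<^sub>R x + - ((1 / m) *\<^sub>R c)) ` cbox (- a) a)"
      using has_integral_affinity[OF i m, of c] by (simp add: I)
    fix x assume x: "x \<notin> (\<lambda>x. (1 / m) *\<^sub>R x + - ((1 / m) *\<^sub>R c)) ` cbox (- a) a"
    have "x = (1 / m) *\<^sub>R (m *\<^sub>R x + c) + - ((1 / m) *\<^sub>R c)"
      using m by (simp add: algebra_simps)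
    with x have "m *\<^sub>R x + c \<notin> cbox (-a) a" by blast
    then show "f (m *\<^sub>R x + c) = 0" by (rule z0)
  qed simp
qed

lemma integrable_compact_support:
  fixes f :: "'a::euclidean_space \<Rightarrow> real"
  assumes "continuous_on UNIV f" "\<And>z. norm z > R \<Longrightarrow> f z = 0"
  shows "f integrable_on UNIV"
  using integral_affine_compact_support[OF assms, where m=1 and c=0] by (auto simp: integrable_on_def)

text \<open>The integral of \<open>f (z + s e)\<close> does not depend on \<open>s\<close>;
  differentiating under the integral sign at \<open>s = 0\<close> gives the claim. Applied to
  products, this is the integration by parts used below.\<close>

lemma integral_line_derivative_zero:
  fixes f :: "'a::euclidean_space \<Rightarrow> real"
  assumes f: "continuous_on UNIV f" and f': "continuous_on UNIV f'"
    and supp: "\<And>z. norm z > R \<Longrightarrow> f z = 0" "\<And>z. norm z > R \<Longrightarrow> f' z = 0"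
    and d: "\<And>z. ((\<lambda>s. f (z + s *\<^sub>R e)) has_real_derivative f' z) (at 0)"
  shows "integral UNIV f' = 0"
proof -
  \<comment> \<open>Large enough that every translate with \<open>\<bar>s\<bar> < 1\<close> vanishes
    beyond it, so that one fixed box serves all parameters of the differentiation.\<close>
  define R' where "R' = max R 0 + norm e"
  obtain a where a: "cball (0::'a) R' \<subseteq> cbox (- a) a"
    using bounded_subset_cbox_symmetric[OF bounded_cball] by blast
  have out: "norm z > R'" if "z \<notin> cbox (-a) a" for z
    using a that by (meson linorder_not_le mem_cball_0 subsetD)
  have RR: "R \<le> R'" by (simp add: R'_def add_increasing2)
  have sh: "norm (z + s *\<^sub>R e) > R" if "norm z > R'" "s \<in> {-1<..<1}" for z s
  proof -
    have "norm z \<le> norm (z + s *\<^sub>R e) + norm (s *\<^sub>R e)"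
      using norm_triangle_ineq4[of "z + s *\<^sub>R e" "s *\<^sub>R e"] by simp
    moreover have "norm (s *\<^sub>R e) \<le> norm e"
      using that by (auto intro!: mult_left_le_one_le)
    ultimately show ?thesis using that unfolding R'_def by linarith
  qed
  have c: "integral (cbox (-a) a) (\<lambda>t. f (t + s *\<^sub>R e)) = integral UNIV f" if "s \<in> {-1<..<1}" for s
  proof -
    have "((\<lambda>t. f (t + s *\<^sub>R e)) has_integral integral UNIV f) UNIV"
      using integral_affine_compact_support[OF f supp(1), where m=1 and c="s *\<^sub>R e"] by simp
    moreover have "((\<lambda>t. f (t + s *\<^sub>R e)) has_integral integral (cbox (-a) a) (\<lambda>t. f (t + s *\<^sub>R e))) UNIV"
    proof (rule has_integral_on_superset[where S="cbox (-a) a"])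
      show "((\<lambda>t. f (t + s *\<^sub>R e)) has_integral integral (cbox (-a) a) (\<lambda>t. f (t + s *\<^sub>R e))) (cbox (-a) a)"
        by (intro integrable_integral integrable_continuous continuous_on_compose2[OF f] continuous_intros) auto
      show "f (t + s *\<^sub>R e) = 0" if "t \<notin> cbox (-a) a" for t
        by (rule supp(1), rule sh[OF out[OF that] \<open>s \<in> {-1<..<1}\<close>])
    qed simp
    ultimately show ?thesis using has_integral_unique by blast
  qed
  have "((\<lambda>s. integral (cbox (-a) a) (\<lambda>t. f (t + s *\<^sub>R e))) has_vector_derivative
      integral (cbox (-a) a) (\<lambda>t. f' (t + 0 *\<^sub>R e))) (at 0 within {-1<..<1::real})"
  proof (rule leibniz_rule_vector_derivative)
    fix s t
    have "((\<lambda>s. f (t + s *\<^sub>R e)) has_real_derivative f' (t + s *\<^sub>R e)) (at s)"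
      using DERIV_shift[of "\<lambda>s. f (t + s *\<^sub>R e)" "f' (t + s *\<^sub>R e)" 0 s] d[of "t + s *\<^sub>R e"]
      by (simp add: algebra_simps)
    then show "((\<lambda>s. f (t + s *\<^sub>R e)) has_vector_derivative f' (t + s *\<^sub>R e)) (at s within {-1<..<1})"
      using has_real_derivative_iff_has_vector_derivative has_vector_derivative_at_within by blast
  next
    fix s show "(\<lambda>t. f (t + s *\<^sub>R e)) integrable_on cbox (- a) a"
      by (intro integrable_continuous continuous_on_compose2[OF f] continuous_intros) auto
  next
    show "continuous_on ({-1<..<1} \<times> cbox (- a) a) (\<lambda>(s, t). f' (t + s *\<^sub>R e))"
      unfolding split_beta by (intro continuous_on_compose2[OF f'] continuous_intros) auto
  qed auto
  then have "((\<lambda>s. integral (cbox (-a) a) (\<lambda>t. f (t + s *\<^sub>R e))) has_vector_derivative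
      integral (cbox (-a) a) f') (at 0)"
    by (subst (asm) at_within_open) auto
  moreover have "((\<lambda>s. integral (cbox (-a) a) (\<lambda>t. f (t + s *\<^sub>R e))) has_vector_derivative 0) (at 0)"
    by (rule has_vector_derivative_transform_within_open[of "\<lambda>_. integral UNIV f" _ _ "{-1<..<1}"])
       (use c in auto)
  ultimately have "integral (cbox (-a) a) f' = 0"
    using vector_derivative_unique_at by blast
  moreover have "(f' has_integral integral (cbox (-a) a) f') UNIV"
  proof (rule has_integral_on_superset[where S="cbox (-a) a"])
    show "(f' has_integral integral (cbox (-a) a) f') (cbox (-a) a)"
      by (intro integrable_integral integrable_continuous continuous_on_subset[OF f']) simp
    show "f' t = 0" if "t \<notin> cbox (-a) a" for t
      by (rule supp(2)) (use out[OF that] RR in linarith)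
  qed simp
  ultimately show ?thesis by auto
qed

text \<open>The square makes the truncated paraboloid once continuously differentiable. It also
  keeps \<open>|grad bump|^2 / bump = 16 |z|^2\<close> bounded on the support, which is what
  completing the square against the bump requires.\<close>

definition bump :: "real \<Rightarrow> 'a::euclidean_space \<Rightarrow> real" where
  "bump R z = (max 0 (R\<^sup>2 - (norm z)\<^sup>2))\<^sup>2"

lemma DERIV_max0_square: "((\<lambda>y. (max 0 y)\<^sup>2) has_real_derivative 2 * max 0 y) (at y)"
proof -
  consider "y > 0" | "y < 0" | "y = 0" by linarith
  then show ?thesis
  proof cases
    case 1
    have "((\<lambda>y. y\<^sup>2) has_real_derivative 2 * y) (at y)"
      by (auto intro!: derivative_eq_intros)
    then show ?thesis
      using 1 has_field_derivative_transform_within_open[of "\<lambda>y. y\<^sup>2" "2*y" y "{0<..}" "\<lambda>y. (max 0 y)\<^sup>2"]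
      by (auto simp: max_def)
  next
    case 2
    then show ?thesis
      using has_field_derivative_transform_within_open[of "\<lambda>y. 0" 0 y "{..<0}" "\<lambda>y. (max 0 y)\<^sup>2"]
      by (auto simp: max_def)
  next
    case 3
    have "((\<lambda>h. (max 0 h)\<^sup>2 / h) \<longlongrightarrow> 0) (at (0::real))"
    proof (rule Lim_null_comparison)
      show "\<forall>\<^sub>F h in at 0. norm ((max 0 h)\<^sup>2 / h) \<le> \<bar>h\<bar>" for h :: real
        by (rule always_eventually) (auto simp: max_def power2_eq_square)
      show "((\<lambda>h. \<bar>h\<bar>) \<longlongrightarrow> 0) (at (0::real))"
        by (rule tendsto_eq_intros | simp)+
    qed
    then show ?thesis using 3 by (simp add: DERIV_def)
  qed
qed

lemma bump_line:
  "((\<lambda>s. bump R (z + s *\<^sub>R e)) has_real_derivative (- 4 * (z \<bullet> e) * max 0 (R\<^sup>2 - (norm z)\<^sup>2))) (at 0)"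
proof -
  have e: "(norm (z + s *\<^sub>R e))\<^sup>2 = (norm z)\<^sup>2 + 2 * s * (z \<bullet> e) + s\<^sup>2 * (norm e)\<^sup>2" for s
    unfolding power2_norm_eq_inner by (simp add: algebra_simps inner_commute power2_eq_square)
  have "((\<lambda>s. R\<^sup>2 - (norm (z + s *\<^sub>R e))\<^sup>2) has_real_derivative - 2 * (z \<bullet> e)) (at 0)"
    unfolding e by (auto intro!: derivative_eq_intros)
  from DERIV_chain'[OF this DERIV_max0_square] show ?thesis
    by (simp add: bump_def mult_ac)
qed

lemma continuous_on_bump: "continuous_on S (bump R)"
  unfolding bump_def by (intro continuous_intros)

lemma bump_nonneg: "bump R z \<ge> 0" by (simp add: bump_def)

lemma bump_supp: "norm z > R \<Longrightarrow> R \<ge> 0 \<Longrightarrow> bump R z = 0"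
  by (auto simp: bump_def max_def intro: power_mono)

lemma bump_scale: "bump R z = R ^ 4 * bump 1 (z /\<^sub>R R)" if "R > 0"
proof -
  have "max 0 (R\<^sup>2 - (norm z)\<^sup>2) = R\<^sup>2 * max 0 (1 - (norm (z /\<^sub>R R))\<^sup>2)"
    using that by (simp add: max_def power_mult_distrib field_simps) 
  then show ?thesis by (simp add: bump_def power_mult_distrib)
qed

text \<open>The exponent is the dimension, from the change of variables, plus 4, the degree of
  homogeneity of the bump.\<close>

lemma integral_bump: "integral UNIV (bump R :: 'a::euclidean_space \<Rightarrow> real) = R ^ (DIM('a) + 4) * integral UNIV (bump 1 :: 'a \<Rightarrow> real)"
  if R: "R > 0"
proof -
  have "((\<lambda>z::'a. bump 1 (inverse R *\<^sub>R z + 0)) has_integral (integral UNIV (bump 1 :: 'a \<Rightarrow> real) / \<bar>inverse R\<bar> ^ DIM('a))) UNIV"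
    by (rule integral_affine_compact_support[of _ 1]) (use R in \<open>auto simp: bump_supp continuous_on_bump\<close>)
  from has_integral_mult_right[OF this, of "R^4"]
  have "((bump R :: 'a \<Rightarrow> real) has_integral (R ^ (DIM('a) + 4) * integral UNIV (bump 1 :: 'a \<Rightarrow> real))) UNIV"
    using R bump_scale[OF R, where ?'a = 'a, symmetric] by (simp add: field_simps power_add)
  then show ?thesis by (rule integral_unique)
qed

lemma integral_bump_pos: "integral UNIV (bump 1 :: 'a::euclidean_space \<Rightarrow> real) > 0"
proof -
  obtain a b where ab: "cbox a b \<subseteq> ball (0::'a) (1/2)" "(0::'a) \<in> box a b"
    using open_contains_cbox[of "ball (0::'a) (1/2)" 0] by (metis open_ball centre_in_ball half_gt_zero zero_less_one)
  have "0 < measure lborel (cbox a b)"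
    using ab(2) content_pos_lt_eq[of a b] by (auto simp: box_def intro: less_trans)
  also have "measure lborel (cbox a b) = integral (cbox a b) (\<lambda>x. 1)"
    by simp
  also have "\<dots> \<le> integral (cbox a b) (\<lambda>z. 4 * bump 1 z)"
  proof (rule integral_le)
    fix x assume "x \<in> cbox a b"
    then have "norm x \<le> 1/2" using ab(1) by (auto simp: subset_iff less_imp_le)
    then have "(norm x)\<^sup>2 \<le> (1/2)\<^sup>2" by (intro power_mono) auto
    then have half: "1/2 \<le> max 0 (1\<^sup>2 - (norm x)\<^sup>2)" by (simp add: power2_eq_square)
    have "(1/2)\<^sup>2 \<le> bump 1 x" unfolding bump_def by (rule power_mono[OF half]) simp
    then show "1 \<le> 4 * bump 1 x" by (simp add: power2_eq_square)
  qed (auto intro!: integrable_continuous continuous_intros continuous_on_bump)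
  also have "\<dots> = 4 * integral (cbox a b) (bump 1)" by simp
  also have "\<dots> \<le> 4 * integral UNIV (bump 1 :: 'a \<Rightarrow> real)"
    by (intro mult_left_mono integral_subset_le)
      (auto intro!: integrable_continuous continuous_on_bump bump_nonneg integrable_compact_support[of _ 1] simp: bump_supp)
  finally show ?thesis by simp
qed


section \<open>From the stationary equation to a quadratic upper bound on the potential\<close>

lemma sum_UNIV_sum_type:
  fixes f :: "'a::finite + 'b::finite \<Rightarrow> 'c::comm_monoid_add"
  shows "(\<Sum>a\<in>UNIV. f a) = (\<Sum>i\<in>UNIV. f (Inl i)) + (\<Sum>i\<in>UNIV. f (Inr i))"
  using sum.Plus[of UNIV UNIV f] by (simp add: o_def)

lemma norm_square_sum_type:
  fixes z :: "real^('a::finite + 'b::finite)"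
  shows "(norm z)\<^sup>2 = (\<Sum>i\<in>UNIV. (z $ Inl i)\<^sup>2) + (\<Sum>i\<in>UNIV. (z $ Inr i)\<^sup>2)"
  unfolding power2_norm_eq_inner inner_vec_def sum_UNIV_sum_type by (simp add: power2_eq_square)

text \<open>Since the bump is radial, its derivatives along \<open>v \<bullet> \<nabla>\<^sub>x\<close> and \<open>x \<bullet> \<nabla>\<^sub>v\<close> agree. The transport term
  thus becomes, up to divergences, a velocity gradient of \<open>w\<close>, which the square of the velocity gradient absorbs.\<close>

lemma integral_potential_bump_le:
  fixes h w :: "real^('n::finite + 'n) \<Rightarrow> real"
  assumes d1: "\<And>i z. ((\<lambda>s. w (z + s *\<^sub>R axis (Inr i) 1)) has_real_derivative wv i z) (at 0)"
    and d2: "\<And>i z. ((\<lambda>s. wv i (z + s *\<^sub>R axis (Inr i) 1)) has_real_derivative wvv i z) (at 0)"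
    and dx: "\<And>i z. ((\<lambda>s. w (z + s *\<^sub>R axis (Inl i) 1)) has_real_derivative wx i z) (at 0)"
    and cont: "continuous_on UNIV w" "\<And>i. continuous_on UNIV (wv i)" "\<And>i. continuous_on UNIV (wvv i)"
       "\<And>i. continuous_on UNIV (wx i)"
    and eq: "\<And>z. (\<Sum>i\<in>UNIV. wvv i z + (wv i z)\<^sup>2) - (\<Sum>i\<in>UNIV. z $ Inr i * wx i z) + h z = 0"
    and R: "R > 0"
  shows "continuous_on UNIV h"
    and "integral UNIV (\<lambda>z. h z * bump R z) \<le> (8 * R\<^sup>2 + R ^ 6 / 2) / (9 * R ^ 4) * integral UNIV (bump (2 * R) :: real^('n + 'n) \<Rightarrow> real)"
proof -
  define m where "m z = max 0 (R\<^sup>2 - (norm z)\<^sup>2)" for z :: "real^('n + 'n)"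
  have bm: "bump R z = (m z)\<^sup>2" for z by (simp add: bump_def m_def)
  have m0: "m z = 0" if "norm z > R" for z
    using bump_supp[OF that] R by (simp add: bm)
  have cm: "continuous_on UNIV m" unfolding m_def by (intro continuous_intros)
  have heq: "h = (\<lambda>z. (\<Sum>i\<in>UNIV. z $ Inr i * wx i z) - (\<Sum>i\<in>UNIV. wvv i z + (wv i z)\<^sup>2))"
    using eq by (auto simp: fun_eq_iff algebra_simps)
  show ch: "continuous_on UNIV h" unfolding heq by (intro continuous_intros cont)
  have lb: "((\<lambda>s. bump R (z + s *\<^sub>R axis j 1)) has_real_derivative - 4 * z $ j * m z) (at 0)" for z j
    using bump_line[of R z "axis j 1"] by (simp add: m_def inner_axis)
  have ln: "((\<lambda>s. (z + s *\<^sub>R axis j 1) $ k) has_real_derivative (if k = j then 1 else 0)) (at 0)" for z :: "real^('n + 'n)" and j k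
    by (auto simp: axis_def intro!: derivative_eq_intros)
  \<comment> \<open>Three divergences: \<open>f1 i\<close> is the \<open>v_i\<close> derivative of
    \<open>bump R * wv i\<close>, \<open>f2 i\<close> the \<open>v_i\<close> derivative of
    \<open>x_i * w * bump R\<close>, and \<open>f3 i\<close> the \<open>x_i\<close> derivative of
    \<open>v_i * w * bump R\<close>. The terms with the undifferentiated \<open>w\<close> agree in
    \<open>f2\<close> and \<open>f3\<close> and cancel in the difference.\<close>
  define f1 where "f1 i z = bump R z * wvv i z - 4 * z $ Inr i * m z * wv i z" for i z
  define f2 where "f2 i z = z $ Inl i * (wv i z * bump R z - 4 * z $ Inr i * m z * w z)" for i z
  define f3 where "f3 i z = z $ Inr i * (wx i z * bump R z - 4 * z $ Inl i * m z * w z)" for i z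
  have cf: "continuous_on UNIV (f1 i)" "continuous_on UNIV (f2 i)" "continuous_on UNIV (f3 i)" for i
    unfolding f1_def f2_def f3_def by (intro continuous_intros cont cm continuous_on_bump)+
  have sf: "f1 i z = 0" "f2 i z = 0" "f3 i z = 0" if "norm z > R" for i z
    using m0[OF that] by (simp_all add: f1_def f2_def f3_def bm)
  have I1: "integral UNIV (f1 i) = 0" for i
  proof (rule integral_line_derivative_zero[where f = "\<lambda>z. bump R z * wv i z" and R = R and e = "axis (Inr i) 1"])
    show "((\<lambda>s. bump R (z + s *\<^sub>R axis (Inr i) 1) * wv i (z + s *\<^sub>R axis (Inr i) 1)) has_real_derivative f1 i z) (at 0)" for z
      using DERIV_mult[OF lb[of z "Inr i"] d2[of i z]] by (simp add: f1_def algebra_simps)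
  qed (auto intro!: cf sf continuous_intros cont cm simp: bm m0)
  have I2: "integral UNIV (f2 i) = 0" for i
  proof (rule integral_line_derivative_zero[where f = "\<lambda>z. z $ Inl i * (w z * bump R z)" and R = R and e = "axis (Inr i) 1"])
    show "((\<lambda>s. (z + s *\<^sub>R axis (Inr i) 1) $ Inl i * (w (z + s *\<^sub>R axis (Inr i) 1) * bump R (z + s *\<^sub>R axis (Inr i) 1))) has_real_derivative f2 i z) (at 0)" for z
      using DERIV_mult[OF ln[of z "Inr i" "Inl i"] DERIV_mult[OF d1[of z i] lb[of z "Inr i"]]] by (simp add: f2_def algebra_simps)
  qed (auto intro!: cf sf continuous_intros cont cm simp: bm m0)
  have I3: "integral UNIV (f3 i) = 0" for i
  proof (rule integral_line_derivative_zero[where f = "\<lambda>z. z $ Inr i * (w z * bump R z)" and R = R and e = "axis (Inl i) 1"])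
    show "((\<lambda>s. (z + s *\<^sub>R axis (Inl i) 1) $ Inr i * (w (z + s *\<^sub>R axis (Inl i) 1) * bump R (z + s *\<^sub>R axis (Inl i) 1))) has_real_derivative f3 i z) (at 0)" for z
      using DERIV_mult[OF ln[of z "Inl i" "Inr i"] DERIV_mult[OF dx[of z i] lb[of z "Inl i"]]] by (simp add: f3_def algebra_simps)
  qed (auto intro!: cf sf continuous_intros cont cm simp: bm m0)
  have if_: "f1 i integrable_on UNIV" "f2 i integrable_on UNIV" "f3 i integrable_on UNIV" for i
    by (rule integrable_compact_support[OF cf(1) sf(1)] integrable_compact_support[OF cf(2) sf(2)] integrable_compact_support[OF cf(3) sf(3)], assumption)+
  \<comment> \<open>On the ball of radius \<open>R\<close> the remainder is at most
    \<open>R^6 / 2 + 8 R^2\<close>, while \<open>bump (2 * R)\<close> is at least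
    \<open>(3 R^2)^2 = 9 R^4\<close>; \<open>c\<close> is the quotient. Dominating by a multiple of
    a bump keeps the final integral explicit.\<close>
  define c where "c = (8 * R\<^sup>2 + R ^ 6 / 2) / (9 * R ^ 4)"
  have c0: "c \<ge> 0" using R by (simp add: c_def)
  have pw: "h z * bump R z \<le> (\<Sum>i\<in>UNIV. f3 i z - f1 i z - f2 i z) + c * bump (2 * R) z" for z
  proof (cases "norm z > R")
    case True
    then show ?thesis using bump_nonneg[of "2*R" z] c0 by (simp add: sf bm m0)
  next
    case False
    then have nz: "(norm z)\<^sup>2 \<le> R\<^sup>2" by (intro power_mono) auto
    have m1: "m z \<ge> 0" "m z \<le> R\<^sup>2" by (auto simp: m_def)
    \<comment> \<open>Since the bump is \<open>(m z)^2\<close> and its gradient carries one factor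
      \<open>m z\<close>, what remains is a concave quadratic polynomial in
      \<open>m z * wv i z\<close>, bounded without any knowledge of \<open>wv\<close>.\<close>
    have "h z * bump R z - (\<Sum>i\<in>UNIV. f3 i z - f1 i z - f2 i z) =
      (\<Sum>i\<in>UNIV. (z $ Inl i * m z - 4 * z $ Inr i) * (m z * wv i z) - (m z * wv i z)\<^sup>2)"
      unfolding heq bm f1_def f2_def f3_def left_diff_distrib sum_distrib_right sum_subtractf[symmetric]
      by (intro sum.cong refl) (simp add: algebra_simps power2_eq_square)
    also have "\<dots> \<le> (\<Sum>i\<in>UNIV. (z $ Inl i)\<^sup>2 * R ^ 4 / 2 + 8 * (z $ Inr i)\<^sup>2)"
    proof (intro sum_mono)
      fix i
      let ?a = "m z * wv i z" and ?b = "z $ Inl i * m z" and ?v = "4 * z $ Inr i"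
      have "(?b - ?v) * ?a - ?a\<^sup>2 = (?b - ?v)\<^sup>2 / 4 - ((?b - ?v) / 2 - ?a)\<^sup>2"
        by (simp add: power2_eq_square field_simps)
      also have "\<dots> \<le> (?b - ?v)\<^sup>2 / 4" by simp
      also have "\<dots> \<le> ?b\<^sup>2 / 2 + ?v\<^sup>2 / 2"
        using zero_le_power2[of "?b + ?v"] unfolding power2_eq_square by (simp add: algebra_simps)
      also have "?b\<^sup>2 \<le> (z $ Inl i)\<^sup>2 * R ^ 4"
        using power_mono[OF m1(2) m1(1), of 2] by (simp add: power_mult_distrib mult_left_mono power_mult[symmetric])
      finally show "(?b - ?v) * ?a - ?a\<^sup>2 \<le> (z $ Inl i)\<^sup>2 * R ^ 4 / 2 + 8 * (z $ Inr i)\<^sup>2"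
        by (simp add: power_mult_distrib)
    qed
    also have "\<dots> = (\<Sum>i\<in>UNIV. (z $ Inl i)\<^sup>2) * (R ^ 4 / 2) + (\<Sum>i\<in>UNIV. (z $ Inr i)\<^sup>2) * 8"
      unfolding sum.distrib sum_distrib_right by (simp add: mult.commute)
    also have "\<dots> \<le> R\<^sup>2 * (R ^ 4 / 2) + R\<^sup>2 * 8"
    proof -
      have "(norm z)\<^sup>2 = (\<Sum>i\<in>UNIV. (z $ Inl i)\<^sup>2) + (\<Sum>i\<in>UNIV. (z $ Inr i)\<^sup>2)"
        by (rule norm_square_sum_type)
      moreover have "(\<Sum>i\<in>UNIV. (z $ Inl i)\<^sup>2) \<ge> 0" "(\<Sum>i\<in>UNIV. (z $ Inr i)\<^sup>2) \<ge> 0"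
        by (auto intro: sum_nonneg)
      ultimately have "(\<Sum>i\<in>UNIV. (z $ Inl i)\<^sup>2) \<le> R\<^sup>2" "(\<Sum>i\<in>UNIV. (z $ Inr i)\<^sup>2) \<le> R\<^sup>2"
        using nz by linarith+
      then show ?thesis by (intro add_mono mult_right_mono) auto
    qed
    also have "\<dots> = c * (9 * R ^ 4)" using R by (simp add: c_def power_def)
    also have "\<dots> \<le> c * bump (2 * R) z"
    proof (rule mult_left_mono[OF _ c0])
      have "3 * R\<^sup>2 \<le> max 0 ((2 * R)\<^sup>2 - (norm z)\<^sup>2)" using nz by (simp add: power_mult_distrib)
      from power_mono[OF this, of 2] show "9 * R ^ 4 \<le> bump (2 * R) z"
        by (simp add: bump_def power_mult_distrib power_mult[symmetric])
    qed
    finally show ?thesis by simp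
  qed
  have ih: "(\<lambda>z. h z * bump R z) integrable_on UNIV"
    by (rule integrable_compact_support[of _ R]) (auto intro!: continuous_intros ch cm simp: bm m0)
  have ib: "(bump (2 * R) :: real^('n + 'n) \<Rightarrow> real) integrable_on UNIV"
    by (rule integrable_compact_support[of _ "2 * R"]) (use R in \<open>auto intro!: continuous_on_bump simp: bump_supp\<close>)
  have "integral UNIV (\<lambda>z. h z * bump R z) \<le> integral UNIV (\<lambda>z. (\<Sum>i\<in>UNIV. f3 i z - f1 i z - f2 i z) + c * bump (2 * R) z)"
    by (intro integral_le ih pw integrable_add integrable_sum integrable_diff if_ integrable_on_mult_right ib) auto
  also have "\<dots> = c * integral UNIV (bump (2 * R) :: real^('n + 'n) \<Rightarrow> real)"
  proof (rule integral_unique)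
    have i0: "(f1 i has_integral 0) UNIV" "(f2 i has_integral 0) UNIV" "(f3 i has_integral 0) UNIV" for i
      using integrable_integral[OF if_(1)[of i]] integrable_integral[OF if_(2)[of i]]
        integrable_integral[OF if_(3)[of i]] I1[of i] I2[of i] I3[of i] by auto
    have "((\<lambda>z. \<Sum>i\<in>UNIV. f3 i z - f1 i z - f2 i z) has_integral (\<Sum>i\<in>(UNIV :: 'n set). 0 - 0 - 0)) UNIV"
      by (intro has_integral_sum has_integral_diff i0) simp
    from has_integral_add[OF this has_integral_mult_right[OF integrable_integral[OF ib], of c]]
    show "((\<lambda>z. (\<Sum>i\<in>UNIV. f3 i z - f1 i z - f2 i z) + c * bump (2 * R) z) has_integral
        c * integral UNIV (bump (2 * R) :: real^('n + 'n) \<Rightarrow> real)) UNIV" by simp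
  qed
  finally show "integral UNIV (\<lambda>z. h z * bump R z) \<le> (8 * R\<^sup>2 + R ^ 6 / 2) / (9 * R ^ 4) * integral UNIV (bump (2 * R) :: real^('n + 'n) \<Rightarrow> real)"
    by (simp add: c_def)
qed

text \<open>The stationary equation tested with a bump bounds the potential in the mean;
  semiconvexity turns the mean bound into a pointwise one.\<close>

lemma semiconvex_potential_quadratic_upper:
  fixes h w :: "real^('n::finite + 'n) \<Rightarrow> real"
  assumes d1: "\<And>i z. ((\<lambda>s. w (z + s *\<^sub>R axis (Inr i) 1)) has_real_derivative wv i z) (at 0)"
    and d2: "\<And>i z. ((\<lambda>s. wv i (z + s *\<^sub>R axis (Inr i) 1)) has_real_derivative wvv i z) (at 0)"
    and dx: "\<And>i z. ((\<lambda>s. w (z + s *\<^sub>R axis (Inl i) 1)) has_real_derivative wx i z) (at 0)"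
    and cont: "continuous_on UNIV w" "\<And>i. continuous_on UNIV (wv i)" "\<And>i. continuous_on UNIV (wvv i)"
       "\<And>i. continuous_on UNIV (wx i)"
    and eq: "\<And>z. (\<Sum>i\<in>UNIV. wvv i z + (wv i z)\<^sup>2) - (\<Sum>i\<in>UNIV. z $ Inr i * wx i z) + h z = 0"
    and low: "\<And>z. h z \<ge> - C * (1 + (norm z)\<^sup>2)" and C: "C \<ge> 0"
    and mid: "\<And>z y. 2 * h z \<le> h (z + y) + h (z - y) + 2 * k * (norm y)\<^sup>2" and k: "k \<ge> 0"
  shows "\<exists>C'\<ge>0. \<forall>p. h p \<le> C' * (1 + (norm p)\<^sup>2)"
proof -
  define d where "d = DIM(real^('n + 'n)) + 4"
  define J where "J = integral UNIV (bump 1 :: real^('n + 'n) \<Rightarrow> real)"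
  have J: "J > 0" unfolding J_def by (rule integral_bump_pos)
  have intb: "integral UNIV (bump r :: real^('n + 'n) \<Rightarrow> real) = r ^ d * J" if "r > 0" for r
    using integral_bump[OF that, where ?'a="real^('n + 'n)"] by (simp add: d_def J_def)
  have ch: "continuous_on UNIV h"
    by (rule integral_potential_bump_le(1)[OF d1 d2 dx cont eq zero_less_one])
  \<comment> \<open>The summands pay for the mean bound on the ball of radius \<open>3 * R\<close>,
    for exchanging the small bump for the large one, and for the semiconvexity defect at distance
    \<open>R\<close>. The powers of 6 and 3 are ratios of bump integrals, and 10 comes from
    \<open>1 + 9 R^2 \<le> 10 R^2\<close>.\<close>
  define A where "A = 6 ^ d + C * 10 * 3 ^ d + k"
  have A0: "A \<ge> 0" using C k by (simp add: A_def)
  have main: "h p \<le> A * R\<^sup>2" if R: "R \<ge> 1" and p: "norm p \<le> R" for p R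
  proof -
    have R0: "R > 0" using R by simp
    let ?n = "\<lambda>z. bump R (z - p)" and ?m = "bump (3 * R) :: real^('n + 'n) \<Rightarrow> real"
    have cn: "continuous_on UNIV ?n"
      by (rule continuous_on_compose2[OF continuous_on_bump[of UNIV]]) (auto intro!: continuous_intros)
    have sn: "?n z = 0" if "norm z > 2 * R" for z
    proof (rule bump_supp)
      show "norm (z - p) > R" using norm_triangle_ineq2[of z p] p that by linarith
    qed (use R0 in simp)
    have nm: "?n z \<le> ?m z" for z
    proof (cases "norm (z - p) \<le> R")
      case True
      have "norm z \<le> 2 * R" using norm_triangle_ineq2[of z p] p True by linarith
      then have "(norm z)\<^sup>2 \<le> (2 * R)\<^sup>2" by (intro power_mono) auto
      moreover have "(norm (z - p))\<^sup>2 \<ge> 0" by simp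
      moreover have "R\<^sup>2 \<ge> 0" by simp
      moreover have "(2 * R)\<^sup>2 = 4 * R\<^sup>2" "(3 * R)\<^sup>2 = 9 * R\<^sup>2" by (simp_all add: power_mult_distrib)
      ultimately have "R\<^sup>2 - (norm (z - p))\<^sup>2 \<le> (3 * R)\<^sup>2 - (norm z)\<^sup>2"
        by linarith
      then show ?thesis unfolding bump_def by (intro power_mono) auto
    next
      case False
      then have "?n z = 0" using bump_supp[of R "z - p"] R0 by simp
      then show ?thesis using bump_nonneg[of "3*R" z] by simp
    qed
    have In: "(?n has_integral (R ^ d * J)) UNIV"
      using integral_affine_compact_support[OF continuous_on_bump[of UNIV R], of R 1 "- p"] R0
      by (simp add: intb bump_supp)
    have chn: "continuous_on UNIV (\<lambda>z. h z * ?n z)" by (intro continuous_intros ch cn)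
    have Ihn: "((\<lambda>z. h z * ?n z) has_integral integral UNIV (\<lambda>z. h z * ?n z)) UNIV"
      by (intro integrable_integral integrable_compact_support[OF chn, of "2 * R"]) (simp add: sn)
    \<comment> \<open>Reflection in \<open>p\<close> preserves the translated bump, so both ends of
      the midpoint inequality have the same weighted integral.\<close>
    have "((\<lambda>z. h (2 *\<^sub>R p - z) * ?n (2 *\<^sub>R p - z)) has_integral integral UNIV (\<lambda>z. h z * ?n z)) UNIV"
      using integral_affine_compact_support[OF chn, of "2 * R" "-1" "2 *\<^sub>R p"] by (simp add: sn)
    moreover have sym: "?n (2 *\<^sub>R p - z) = ?n z" for z
    proof -
      have "2 *\<^sub>R p - z - p = - (z - p)" by (simp add: scaleR_2)
      then show ?thesis by (simp only: bump_def norm_minus_cancel)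
    qed
    ultimately have Ihr: "((\<lambda>z. h (2 *\<^sub>R p - z) * ?n z) has_integral integral UNIV (\<lambda>z. h z * ?n z)) UNIV"
      by (simp only: sym)
    have "2 * (h p - k * R\<^sup>2) * (R ^ d * J) \<le> integral UNIV (\<lambda>z. h z * ?n z) + integral UNIV (\<lambda>z. h z * ?n z)"
    proof (rule has_integral_le[OF has_integral_mult_right[OF In] has_integral_add[OF Ihn Ihr]])
      fix z
      show "2 * (h p - k * R\<^sup>2) * ?n z \<le> h z * ?n z + h (2 *\<^sub>R p - z) * ?n z"
      proof (cases "norm (z - p) \<le> R")
        case True
        have "2 * h p \<le> h z + h (2 *\<^sub>R p - z) + 2 * k * (norm (z - p))\<^sup>2"
          using mid[of p "z - p"] by (simp add: scaleR_2 algebra_simps)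
        moreover have "k * (norm (z - p))\<^sup>2 \<le> k * R\<^sup>2"
          using True k by (intro mult_left_mono power_mono) auto
        ultimately have "2 * (h p - k * R\<^sup>2) \<le> h z + h (2 *\<^sub>R p - z)" by simp
        from mult_right_mono[OF this bump_nonneg[of R "z - p"]] show ?thesis by (simp add: algebra_simps)
      next
        case False
        then have "?n z = 0" using bump_supp[of R "z - p"] R0 by simp
        then show ?thesis by simp
      qed
    qed
    then have 1: "(h p - k * R\<^sup>2) * (R ^ d * J) \<le> integral UNIV (\<lambda>z. h z * ?n z)" by (simp add: algebra_simps)
    have chm: "continuous_on UNIV (\<lambda>z. h z * ?m z)" by (intro continuous_intros ch continuous_on_bump)
    have Ihm: "((\<lambda>z. h z * ?m z) has_integral integral UNIV (\<lambda>z. h z * ?m z)) UNIV"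
      by (intro integrable_integral integrable_compact_support[OF chm, of "3 * R"]) (use R0 in \<open>simp add: bump_supp\<close>)
    have Im: "(?m has_integral ((3 * R) ^ d * J)) UNIV"
    proof -
      have "integral UNIV ?m = (3 * R) ^ d * J" using R0 by (intro intb) simp
      moreover have "?m z = 0" if "norm z > 3 * R" for z using that R0 by (intro bump_supp) auto
      ultimately show ?thesis
        using integral_affine_compact_support[OF continuous_on_bump[of "UNIV :: (real^('n + 'n)) set" "3 * R"], of "3 * R" 1 0] by simp
    qed
    \<comment> \<open>Enlarging the weight is monotone only for a nonnegative integrand; adding
      \<open>C * (1 + 9 R^2)\<close> makes \<open>h\<close> nonnegative on the ball of radius
      \<open>3 * R\<close>, by the quadratic lower bound.\<close>
    have 2: "integral UNIV (\<lambda>z. h z * ?n z) \<le> integral UNIV (\<lambda>z. h z * ?m z) + C * (1 + 9 * R\<^sup>2) * ((3 * R) ^ d * J)"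
    proof (rule has_integral_le[OF Ihn has_integral_add[OF Ihm has_integral_mult_right[OF Im]]])
      fix z
      show "h z * ?n z \<le> h z * ?m z + C * (1 + 9 * R\<^sup>2) * ?m z"
      proof (cases "norm z \<le> 3 * R")
        case True
        then have "(norm z)\<^sup>2 \<le> (3 * R)\<^sup>2" by (intro power_mono) auto
        then have "C * (1 + (norm z)\<^sup>2) \<le> C * (1 + 9 * R\<^sup>2)"
          using C by (intro mult_left_mono) (auto simp: power_mult_distrib)
        then have hl: "h z + C * (1 + 9 * R\<^sup>2) \<ge> 0" using low[of z] by simp
        have "h z * ?n z \<le> (h z + C * (1 + 9 * R\<^sup>2)) * ?n z"
          using C bump_nonneg[of R "z - p"] by (simp add: distrib_right)
        also have "\<dots> \<le> (h z + C * (1 + 9 * R\<^sup>2)) * ?m z"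
          by (rule mult_left_mono[OF nm hl])
        finally show ?thesis by (simp add: distrib_right)
      next
        case False
        then have "?m z = 0" using bump_supp[of "3 * R" z] R0 by simp
        then show ?thesis using nm[of z] bump_nonneg[of R "z - p"] by simp
      qed
    qed
    have 3: "integral UNIV (\<lambda>z. h z * ?m z) \<le> R\<^sup>2 * ((6 * R) ^ d * J)"
    proof -
      have "integral UNIV (\<lambda>z. h z * ?m z) \<le> (8 * (3 * R)\<^sup>2 + (3 * R) ^ 6 / 2) / (9 * (3 * R) ^ 4) * ((6 * R) ^ d * J)"
        using integral_potential_bump_le(2)[OF d1 d2 dx cont eq, of "3 * R"] R0 intb[of "6 * R"] by simp
      also have "\<dots> \<le> R\<^sup>2 * ((6 * R) ^ d * J)"
      proof (rule mult_right_mono)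
        have "R ^ 2 \<le> R ^ 6" using R by (intro power_increasing) auto
        moreover have e: "(3 * R)\<^sup>2 = 9 * R\<^sup>2" "(3 * R) ^ 6 = 729 * R ^ 6"
          by (simp_all add: power_mult_distrib)
        moreover have "R ^ 6 \<ge> 0" using R0 by simp
        ultimately have "8 * (3 * R)\<^sup>2 + (3 * R) ^ 6 / 2 \<le> 72 * R ^ 6 + 365 * R ^ 6"
          unfolding e by linarith
        also have "\<dots> \<le> R\<^sup>2 * (9 * (3 * R) ^ 4)"
        proof -
          have "R\<^sup>2 * (9 * (3 * R) ^ 4) = 729 * (R ^ 2 * R ^ 4)" by (simp add: power_mult_distrib)
          also have "R ^ 2 * R ^ 4 = R ^ 6" by (simp flip: power_add)
          finally have x: "R\<^sup>2 * (9 * (3 * R) ^ 4) = 729 * R ^ 6" .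
          show ?thesis unfolding x using R0 by simp
        qed
        finally show "(8 * (3 * R)\<^sup>2 + (3 * R) ^ 6 / 2) / (9 * (3 * R) ^ 4) \<le> R\<^sup>2"
          using R0 by (simp add: divide_le_eq)
      qed (use R0 J in simp)
      finally show ?thesis .
    qed
    have "(h p - k * R\<^sup>2) * (R ^ d * J) \<le> (R\<^sup>2 * 6 ^ d + C * (1 + 9 * R\<^sup>2) * 3 ^ d) * (R ^ d * J)"
      using 1 2 3 by (simp add: power_mult_distrib algebra_simps)
    then have "h p - k * R\<^sup>2 \<le> R\<^sup>2 * 6 ^ d + C * (1 + 9 * R\<^sup>2) * 3 ^ d"
      by (rule mult_right_le_imp_le) (use R0 J in simp)
    also have "C * (1 + 9 * R\<^sup>2) * 3 ^ d \<le> C * (10 * R\<^sup>2) * 3 ^ d"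
      using C R by (intro mult_right_mono mult_left_mono) (auto simp: one_le_power)
    finally show ?thesis by (simp add: A_def algebra_simps)
  qed
  show ?thesis
  proof (intro exI[of _ "2 * A"] conjI allI)
    fix p :: "real^('n + 'n)"
    have "(1 + norm p)\<^sup>2 \<le> 2 * (1 + (norm p)\<^sup>2)"
      using zero_le_power2[of "1 - norm p"] unfolding power2_eq_square by (simp add: algebra_simps)
    from mult_left_mono[OF this A0] main[of "1 + norm p" p]
    show "h p \<le> 2 * A * (1 + (norm p)\<^sup>2)" by (simp add: algebra_simps)
  qed (use A0 in simp)
qed

section \<open>Jets and the maximum principle\<close>

text \<open>The first derivative is asked for along the whole line so that it can be differentiated
  again; the second one is recorded only at the base point, where the second-derivative test uses
  it.\<close>

definition has_d2 :: "('a::real_normed_vector \<Rightarrow> real) \<Rightarrow> 'a \<Rightarrow> 'a \<Rightarrow> real \<Rightarrow> real \<Rightarrow> bool" where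
  "has_d2 f z e p q \<longleftrightarrow> (\<exists>f'. (\<forall>s. ((\<lambda>s. f (z + s *\<^sub>R e)) has_real_derivative f' s) (at s)) \<and>
     f' 0 = p \<and> (f' has_real_derivative q) (at 0))"

lemma has_d2_D1: "has_d2 f z e p q \<Longrightarrow> ((\<lambda>s. f (z + s *\<^sub>R e)) has_real_derivative p) (at 0)"
  unfolding has_d2_def by metis

lemma has_d2_local_min:
  assumes f: "has_d2 f z e p q" and d: "d > 0" and min: "\<And>s. \<bar>s\<bar> < d \<Longrightarrow> f z \<le> f (z + s *\<^sub>R e)"
  shows "p = 0" "q \<ge> 0"
proof -
  obtain f' where f': "\<And>s. ((\<lambda>s. f (z + s *\<^sub>R e)) has_real_derivative f' s) (at s)" "f' 0 = p"
      "(f' has_real_derivative q) (at 0)"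
    using f unfolding has_d2_def by blast
  show p: "p = 0"
    by (rule DERIV_local_min[OF f'(1)[of 0, unfolded f'(2)] d]) (use min in auto)
  show "q \<ge> 0"
  proof (rule ccontr)
    assume "\<not> q \<ge> 0"
    then obtain r where r: "r > 0" "\<And>h. 0 < h \<Longrightarrow> h < r \<Longrightarrow> f' h < 0"
      using DERIV_neg_dec_right[OF f'(3)] f'(2) p by auto
    define h where "h = min r d / 2"
    have h: "0 < h" "h < r" "h < d" using r d by (auto simp: h_def)
    obtain x where x: "0 < x" "x < h" "f (z + h *\<^sub>R e) - f (z + 0 *\<^sub>R e) = (h - 0) * f' x"
      using MVT2[OF h(1), of "\<lambda>s. f (z + s *\<^sub>R e)" f'] f'(1) by auto
    have "f' x < 0" using x h r by auto
    then have "h * f' x < 0" using h by (simp add: mult_pos_neg)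
    then show False using x min[of h] h by auto
  qed
qed

lemma has_d2_add: "has_d2 f z e p q \<Longrightarrow> has_d2 g z e p' q' \<Longrightarrow> has_d2 (\<lambda>z. f z + g z) z e (p + p') (q + q')"
  unfolding has_d2_def
  by (elim exE, rename_tac f' g', rule_tac x="\<lambda>s. f' s + g' s" in exI) (auto intro!: derivative_intros)

lemma has_d2_cmult: "has_d2 f z e p q \<Longrightarrow> has_d2 (\<lambda>z. c * f z) z e (c * p) (c * q)"
  unfolding has_d2_def
  by (elim exE, rename_tac f', rule_tac x="\<lambda>s. c * f' s" in exI) (auto intro!: DERIV_cmult)

lemma has_d2_const: "has_d2 (\<lambda>z. c) z e 0 0"
  unfolding has_d2_def by (rule exI[of _ "\<lambda>s. 0"]) auto

lemma has_d2_diff: "has_d2 f z e p q \<Longrightarrow> has_d2 g z e p' q' \<Longrightarrow> has_d2 (\<lambda>z. f z - g z) z e (p - p') (q - q')"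
  using has_d2_add[of f z e p q "\<lambda>z. - 1 * g z" "-1 * p'" "-1 * q'"] has_d2_cmult[of g z e p' q' "-1"] by simp

lemma has_d2_shift: "has_d2 f (z + c) e p q \<Longrightarrow> has_d2 (\<lambda>z. f (z + c)) z e p q"
  unfolding has_d2_def by (simp add: algebra_simps)

lemma has_d2_exp:
  assumes "has_d2 f z e p q"
  shows "has_d2 (\<lambda>z. exp (f z)) z e (exp (f z) * p) (exp (f z) * (q + p\<^sup>2))"
proof -
  obtain f' where f': "\<And>s. ((\<lambda>s. f (z + s *\<^sub>R e)) has_real_derivative f' s) (at s)" "f' 0 = p"
      "(f' has_real_derivative q) (at 0)"
    using assms unfolding has_d2_def by blast
  have "((\<lambda>s. exp (f (z + s *\<^sub>R e)) * f' s) has_real_derivative exp (f z) * (q + p\<^sup>2)) (at 0)"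
    using DERIV_mult[OF DERIV_fun_exp[OF f'(1)[of 0]] f'(3)] f'(2)
    by (simp add: algebra_simps power2_eq_square)
  then show ?thesis unfolding has_d2_def
    using f' by (intro exI[of _ "\<lambda>s. exp (f (z + s *\<^sub>R e)) * f' s"]) (auto intro!: DERIV_fun_exp)
qed

text \<open>The linear field of free transport, \<open>(x, v)\<close> to \<open>(v, 0)\<close>. It
  is nilpotent, so its flow is \<open>z + t drift z\<close>.\<close>

definition drift :: "real^('n::finite + 'n) \<Rightarrow> real^('n + 'n)" where
  "drift z = (\<chi> a. case a of Inl i \<Rightarrow> z $ Inr i | Inr i \<Rightarrow> 0)"

lemma drift_nth [simp]: "drift z $ Inl i = z $ Inr i" "drift z $ Inr i = 0"
  by (simp_all add: drift_def)

text \<open>The operator of the equation only sees the derivative along the characteristics of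
  the transport part and the pure second derivatives in the velocities.\<close>

definition has_jet :: "(real \<Rightarrow> real^('n::finite + 'n) \<Rightarrow> real) \<Rightarrow> real \<Rightarrow> real^('n + 'n) \<Rightarrow>
    real \<Rightarrow> ('n \<Rightarrow> real) \<Rightarrow> ('n \<Rightarrow> real) \<Rightarrow> bool" where
  "has_jet f t z y p q \<longleftrightarrow>
     ((\<lambda>s. f (t + s) (z + s *\<^sub>R drift z)) has_real_derivative y) (at 0) \<and>
     (\<forall>i. has_d2 (f t) z (axis (Inr i) 1) (p i) (q i))"

lemma has_jet_add:
  "has_jet f t z y p q \<Longrightarrow> has_jet g t z y' p' q' \<Longrightarrow>
    has_jet (\<lambda>t z. f t z + g t z) t z (y + y') (\<lambda>i. p i + p' i) (\<lambda>i. q i + q' i)"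
  unfolding has_jet_def by (auto intro!: has_d2_add DERIV_add)

lemma has_jet_diff:
  "has_jet f t z y p q \<Longrightarrow> has_jet g t z y' p' q' \<Longrightarrow>
    has_jet (\<lambda>t z. f t z - g t z) t z (y - y') (\<lambda>i. p i - p' i) (\<lambda>i. q i - q' i)"
  unfolding has_jet_def by (auto intro!: has_d2_diff DERIV_diff)

lemma has_jet_cmult:
  "has_jet f t z y p q \<Longrightarrow> has_jet (\<lambda>t z. c * f t z) t z (c * y) (\<lambda>i. c * p i) (\<lambda>i. c * q i)"
  unfolding has_jet_def by (auto intro!: has_d2_cmult DERIV_cmult)

lemma has_jet_const: "has_jet (\<lambda>t z. c) t z 0 (\<lambda>i. 0) (\<lambda>i. 0)"
  unfolding has_jet_def by (auto intro!: has_d2_const)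

lemma has_jet_exp:
  assumes "has_jet f t z y p q"
  shows "has_jet (\<lambda>t z. exp (f t z)) t z (exp (f t z) * y) (\<lambda>i. exp (f t z) * p i)
    (\<lambda>i. exp (f t z) * (q i + (p i)\<^sup>2))"
  using assms DERIV_fun_exp[of "\<lambda>s. f (t + s) (z + s *\<^sub>R drift z)" y 0]
  unfolding has_jet_def by (auto intro!: has_d2_exp)

text \<open>At a negative minimum of \<open>exp (- l t) S\<close> the velocity second derivatives
  are nonnegative, so the assumption on jets makes this weighted function strictly increasing along
  \<open>(1, drift z)\<close>. A step backwards in that direction stays in the domain, even from the
  final time, and reaches a smaller value. The rate \<open>l\<close> absorbs a zeroth-order
  coefficient without a sign.\<close>

lemma maximum_principle:
  fixes S :: "real \<Rightarrow> real^('n::finite + 'n) \<Rightarrow> real"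
  assumes cont: "continuous_on ({t0..t1} \<times> cball 0 R) (\<lambda>(t, z). S t z)"
    and init: "\<And>z. norm z \<le> R \<Longrightarrow> S t0 z \<ge> 0"
    and bdry: "\<And>t z. t0 \<le> t \<Longrightarrow> t \<le> t1 \<Longrightarrow> norm z = R \<Longrightarrow> S t z \<ge> 0"
    and inter: "\<And>t z. t0 < t \<Longrightarrow> t \<le> t1 \<Longrightarrow> norm z < R \<Longrightarrow> S t z < 0 \<Longrightarrow>
       \<exists>y p q. has_jet S t z y p q \<and> ((\<forall>i. q i \<ge> 0) \<longrightarrow> y > l * S t z)"
    and tz: "t0 \<le> t" "t \<le> t1" "norm z \<le> R"
  shows "S t z \<ge> 0"
proof (rule ccontr)
  assume neg: "\<not> S t z \<ge> 0"
  let ?D = "{t0..t1} \<times> cball (0 :: real^('n + 'n)) R"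
  let ?G = "\<lambda>(t, z). exp (- l * t) * S t z"
  have "continuous_on ?D ?G"
    using cont unfolding split_beta by (intro continuous_intros) auto
  moreover have "compact ?D" by (intro compact_Times compact_Icc compact_cball)
  moreover have "(t, z) \<in> ?D" using tz by simp
  ultimately obtain m where m: "m \<in> ?D" "\<And>x. x \<in> ?D \<Longrightarrow> ?G m \<le> ?G x"
    using continuous_attains_inf[of ?D ?G] by blast
  obtain t' z' where m': "m = (t', z')" by (cases m)
  have in': "t0 \<le> t'" "t' \<le> t1" "norm z' \<le> R" using m(1) by (auto simp: m')
  have le: "exp (- l * t') * S t' z' \<le> exp (- l * s) * S s x" if "t0 \<le> s" "s \<le> t1" "norm x \<le> R" for s x
    using m(2)[of "(s, x)"] that by (simp add: m')
  have "exp (- l * t) * S t z < 0" using neg by (simp add: mult_pos_neg)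
  then have "exp (- l * t') * S t' z' < 0" using le[OF tz] by linarith
  then have n': "S t' z' < 0" by (simp add: mult_less_0_iff)
  have t'0: "t0 < t'" using init[of z'] in' n' by (cases "t' = t0") auto
  have z'R: "norm z' < R" using bdry[OF in'(1,2), of z'] in'(3) n' by (cases "norm z' = R") auto
  obtain y p q where j: "has_jet S t' z' y p q" and yq: "(\<forall>i. q i \<ge> 0) \<longrightarrow> y > l * S t' z'"
    using inter[OF t'0 in'(2) z'R n'] by blast
  have near: "\<exists>d>0. \<forall>s. \<bar>s\<bar> < d \<longrightarrow> norm (z' + s *\<^sub>R e) \<le> R" for e
  proof -
    define d where "d = (R - norm z') / (norm e + 1)"
    have "norm (z' + s *\<^sub>R e) \<le> R" if "\<bar>s\<bar> < d" for s
    proof -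
      have "norm (z' + s *\<^sub>R e) \<le> norm z' + \<bar>s\<bar> * norm e"
        using norm_triangle_ineq[of z' "s *\<^sub>R e"] by simp
      also have "\<bar>s\<bar> * norm e \<le> d * (norm e + 1)"
        using that by (intro mult_mono) auto
      also have "\<dots> = R - norm z'" unfolding d_def using norm_ge_zero[of e] by (simp add: add_nonneg_eq_0_iff)
      finally show ?thesis by simp
    qed
    moreover have "d > 0" using z'R by (simp add: d_def add_nonneg_pos)
    ultimately show ?thesis by blast
  qed
  have "q i \<ge> 0" for i
  proof -
    obtain d where d: "d > 0" "\<And>s. \<bar>s\<bar> < d \<Longrightarrow> norm (z' + s *\<^sub>R axis (Inr i) 1) \<le> R"
      using near by blast
    show ?thesis
    proof (rule has_d2_local_min(2)[OF _ d(1)])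
      show "has_d2 (S t') z' (axis (Inr i) 1) (p i) (q i)" using j by (simp add: has_jet_def)
      show "S t' z' \<le> S t' (z' + s *\<^sub>R axis (Inr i) 1)" if "\<bar>s\<bar> < d" for s
        using le[OF in'(1,2) d(2)[OF that]] by simp
    qed
  qed
  with yq have y: "y > l * S t' z'" by blast
  let ?g = "\<lambda>s. exp (- l * (t' + s)) * S (t' + s) (z' + s *\<^sub>R drift z')"
  have "(?g has_real_derivative (exp (- l * (t' + 0)) * (- l) * S (t' + 0) (z' + 0 *\<^sub>R drift z') + y * exp (- l * (t' + 0)))) (at 0)"
    using j unfolding has_jet_def by (intro DERIV_mult) (auto intro!: derivative_eq_intros)
  then have "(?g has_real_derivative exp (- l * t') * (y - l * S t' z')) (at 0)"
    by (simp add: algebra_simps)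
  moreover have "exp (- l * t') * (y - l * S t' z') > 0" using y by simp
  ultimately obtain r where r: "r > 0" "\<And>h. 0 < h \<Longrightarrow> h < r \<Longrightarrow> ?g (0 - h) < ?g 0"
    using DERIV_pos_inc_left by blast
  obtain d where d: "d > 0" "\<And>s. \<bar>s\<bar> < d \<Longrightarrow> norm (z' + s *\<^sub>R drift z') \<le> R"
    using near by blast
  define h where "h = min (min r d) (t' - t0) / 2"
  have h: "0 < h" "h < r" "h < d" "h \<le> t' - t0" using r d t'0 by (auto simp: h_def)
  have "?g 0 \<le> ?g (0 - h)"
    using le[of "t' - h" "z' + (- h) *\<^sub>R drift z'"] d(2)[of "- h"] h in' by simp
  with r(2)[of h] h show False by linarith
qed

section \<open>The Kolmogorov kernel and the growth of the weight\<close>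

lemma drift_diff: "drift (a - b) = drift a - drift b"
  and drift_add: "drift (a + b) = drift a + drift b"
  and drift_scaleR: "drift (c *\<^sub>R a) = c *\<^sub>R drift a"
  and drift_drift: "drift (drift a) = 0"
  by (auto simp: drift_def vec_eq_iff split: sum.splits)

lemma norm_drift_le: "norm (drift z) \<le> norm z"
proof (rule power2_le_imp_le)
  show "(norm (drift z))\<^sup>2 \<le> (norm z)\<^sup>2"
    by (simp add: norm_square_sum_type sum_nonneg)
qed simp

text \<open>The exponent of the Kolmogorov kernel, the fundamental solution of the equation without potential.\<close>

definition kolmogorov :: "real \<Rightarrow> real^('n::finite + 'n) \<Rightarrow> real" where
  "kolmogorov s z = - (\<Sum>i\<in>UNIV. (z $ Inr i)\<^sup>2 / s - 3 * z $ Inl i * z $ Inr i / s\<^sup>2 + 3 * (z $ Inl i)\<^sup>2 / s ^ 3)"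

text \<open>With one eighth of both pure terms split off, the quadratic form is still positive
  because \<open>23 / 8 > 18 / 7\<close>. The condition \<open>s \<le> 1\<close> then trades the
  stronger decay \<open>x^2 / s^3\<close> in position for the isotropic
  \<open>x^2 / s\<close>.\<close>

lemma kolmogorov_upper:
  assumes "0 < s" "s \<le> 1"
  shows "kolmogorov s z \<le> - (norm z)\<^sup>2 / (8 * s)"
proof -
  have "(x\<^sup>2 + v\<^sup>2) / (8 * s) \<le> v\<^sup>2 / s - 3 * x * v / s\<^sup>2 + 3 * x\<^sup>2 / s ^ 3" for x v :: real
  proof -
    have "x\<^sup>2 / s \<le> x\<^sup>2 / s ^ 3"
      using assms by (intro divide_left_mono) (auto simp: power_decreasing[of 1 3 s, simplified])
    moreover have "0 \<le> (v / 2 - x / s)\<^sup>2 / s" "0 \<le> (v - 2 * x / s)\<^sup>2 / s" "0 \<le> v\<^sup>2 / s" "0 \<le> x\<^sup>2 / s"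
      using assms by auto
    moreover have "v\<^sup>2 / s - 3 * x * v / s\<^sup>2 + 3 * x\<^sup>2 / s ^ 3 - (1 / 8) * v\<^sup>2 / s - (1 / 8) * x\<^sup>2 / s ^ 3
       = (7 / 8) * ((v - (12 / 7) * x / s)\<^sup>2 / s) + (23 / 8 - 18 / 7) * x\<^sup>2 / s ^ 3"
      using assms by (simp add: power2_eq_square power3_eq_cube field_simps)
    moreover have "0 \<le> (v - (12 / 7) * x / s)\<^sup>2 / s" "0 \<le> x\<^sup>2 / s ^ 3" using assms by auto
    moreover have "(x\<^sup>2 + v\<^sup>2) / (8 * s) = (1 / 8) * (x\<^sup>2 / s) + (1 / 8) * (v\<^sup>2 / s)"
      using assms by (simp add: field_simps)
    ultimately show ?thesis by simp
  qed
  then have "(\<Sum>i\<in>UNIV. ((z $ Inl i)\<^sup>2 + (z $ Inr i)\<^sup>2) / (8 * s)) \<le> - kolmogorov s z"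
    unfolding kolmogorov_def minus_minus by (intro sum_mono)
  also have "(\<Sum>i\<in>UNIV. ((z $ Inl i)\<^sup>2 + (z $ Inr i)\<^sup>2) / (8 * s)) = (norm z)\<^sup>2 / (8 * s)"
    by (simp add: norm_square_sum_type sum.distrib flip: sum_divide_distrib)
  finally show ?thesis by simp
qed

lemma kolmogorov_lower:
  assumes "0 < s" "s \<le> 1"
  shows "- 5 * (norm z)\<^sup>2 / s ^ 3 \<le> kolmogorov s z"
proof -
  have "v\<^sup>2 / s - 3 * x * v / s\<^sup>2 + 3 * x\<^sup>2 / s ^ 3 \<le> 5 * (x\<^sup>2 + v\<^sup>2) / s ^ 3" for x v :: real
  proof -
    have "v\<^sup>2 / s \<le> v\<^sup>2 / s ^ 3"
      using assms by (intro divide_left_mono) (auto simp: power_decreasing[of 1 3 s, simplified])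
    moreover have "0 \<le> (v + x / s)\<^sup>2 / s" "0 \<le> x\<^sup>2 / s ^ 3" "0 \<le> v\<^sup>2 / s"
      using assms by auto
    moreover have "v\<^sup>2 / s - 3 * x * v / s\<^sup>2 + 3 * x\<^sup>2 / s ^ 3
       = (5 / 2) * (v\<^sup>2 / s) + (9 / 2) * (x\<^sup>2 / s ^ 3) - (3 / 2) * ((v + x / s)\<^sup>2 / s)"
      using assms by (simp add: power2_eq_square power3_eq_cube field_simps)
    moreover have "5 * (x\<^sup>2 + v\<^sup>2) / s ^ 3 = 5 * (x\<^sup>2 / s ^ 3) + 5 * (v\<^sup>2 / s ^ 3)"
      using assms by (simp add: field_simps)
    ultimately show ?thesis by linarith
  qed
  then have "- kolmogorov s z \<le> (\<Sum>i\<in>UNIV. 5 * ((z $ Inl i)\<^sup>2 + (z $ Inr i)\<^sup>2) / s ^ 3)"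
    unfolding kolmogorov_def minus_minus by (intro sum_mono)
  also have "\<dots> = 5 * (norm z)\<^sup>2 / s ^ 3"
    by (simp add: norm_square_sum_type sum.distrib flip: sum_divide_distrib sum_distrib_left)
  finally show ?thesis by simp
qed

text \<open>The derivative along the characteristic exceeds what the logarithmic equation asks for
  by \<open>2 / s\<close> per velocity coordinate. This is compensated by the normalising factor, a
  power of \<open>s\<close> with exponent minus twice the number of velocity coordinates, which the
  barrier supplies as a logarithm.\<close>

lemma kolmogorov_jet:
  fixes z :: "real^('n::finite + 'n)"
  assumes s: "s > 0"
  defines "p \<equiv> \<lambda>i. 3 * z $ Inl i / s\<^sup>2 - 2 * z $ Inr i / s"
  shows "has_jet kolmogorov s z (\<Sum>i\<in>UNIV. (p i)\<^sup>2) p (\<lambda>i. - 2 / s)"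
  unfolding has_jet_def
proof (intro conjI allI)
  have *: "((\<lambda>h. (v + h * 0)\<^sup>2 / (s + h) - 3 * (x + h * v) * (v + h * 0) / (s + h)\<^sup>2 + 3 * (x + h * v)\<^sup>2 / (s + h) ^ 3)
     has_real_derivative - (3 * x / s\<^sup>2 - 2 * v / s)\<^sup>2) (at 0)" for x v :: real
    using s by (auto intro!: derivative_eq_intros simp: power2_eq_square power3_eq_cube field_simps) (simp add: eval_nat_numeral algebra_simps)?
  have "((\<lambda>h. - (\<Sum>i\<in>UNIV. (z $ Inr i + h * 0)\<^sup>2 / (s + h) - 3 * (z $ Inl i + h * z $ Inr i) * (z $ Inr i + h * 0) / (s + h)\<^sup>2 + 3 * (z $ Inl i + h * z $ Inr i)\<^sup>2 / (s + h) ^ 3))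
     has_real_derivative - (\<Sum>i\<in>UNIV. - (3 * z $ Inl i / s\<^sup>2 - 2 * z $ Inr i / s)\<^sup>2)) (at 0)"
    by (intro DERIV_minus DERIV_sum *)
  then show "((\<lambda>h. kolmogorov (s + h) (z + h *\<^sub>R drift z)) has_real_derivative (\<Sum>i\<in>UNIV. (p i)\<^sup>2)) (at 0)"
    by (simp add: kolmogorov_def p_def sum_negf)
next
  fix i
  have e: "kolmogorov s (z + h *\<^sub>R axis (Inr i) 1) = kolmogorov s z + h * p i - h\<^sup>2 / s" for h
  proof -
    have "(\<Sum>j\<in>UNIV. ((z + h *\<^sub>R axis (Inr i) 1) $ Inr j)\<^sup>2 / s - 3 * (z + h *\<^sub>R axis (Inr i) 1) $ Inl j * (z + h *\<^sub>R axis (Inr i) 1) $ Inr j / s\<^sup>2 + 3 * ((z + h *\<^sub>R axis (Inr i) 1) $ Inl j)\<^sup>2 / s ^ 3)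
      = (\<Sum>j\<in>UNIV. ((z $ Inr j)\<^sup>2 / s - 3 * z $ Inl j * z $ Inr j / s\<^sup>2 + 3 * (z $ Inl j)\<^sup>2 / s ^ 3)
         + (if j = i then h\<^sup>2 / s - h * p i else 0))"
      using s by (intro sum.cong refl) (auto simp: axis_def p_def power2_eq_square field_simps)
    then show ?thesis by (simp add: kolmogorov_def sum.distrib)
  qed
  show "has_d2 (kolmogorov s) z (axis (Inr i) 1) (p i) (- 2 / s)"
    unfolding has_d2_def e
    by (rule exI[of _ "\<lambda>h. p i - 2 * h / s"]) (use s in \<open>auto intro!: derivative_eq_intros\<close>)
qed

lemma continuous_on_kolmogorov:
  assumes "continuous_on S f" "continuous_on S g" "\<And>x. x \<in> S \<Longrightarrow> f x > 0"
  shows "continuous_on S (\<lambda>x. kolmogorov (f x) (g x))"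
  unfolding kolmogorov_def using assms(3) by (intro continuous_intros assms) (auto simp: less_imp_neq[symmetric])

text \<open>Resolves the circular choice of the exponent \<open>a\<close> in the next lemma: a
  kernel of initial age \<open>exp (- a Q)\<close> loses a multiple of \<open>a Q\<close> in the
  logarithm, and this loss must itself be beaten by an exponential in \<open>a\<close>.\<close>

lemma exists_exp_dominates_affine:
  fixes P R b :: real
  shows "\<exists>x\<ge>b. exp x \<ge> P + R * x"
proof -
  define x where "x = max 1 (max b (2 * (\<bar>P\<bar> + \<bar>R\<bar>)))"
  have x: "x \<ge> 1" "x \<ge> b" "x \<ge> 2 * (\<bar>P\<bar> + \<bar>R\<bar>)" by (auto simp: x_def)
  have "P + R * x \<le> \<bar>P\<bar> * x + \<bar>R\<bar> * x"
    using x(1) by (intro add_mono mult_right_mono) (auto intro: order_trans[OF abs_ge_self] mult_left_mono[of 1 x "\<bar>P\<bar>", simplified])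
  also have "\<dots> = (\<bar>P\<bar> + \<bar>R\<bar>) * x" by (simp add: algebra_simps)
  also have "\<dots> \<le> (x / 2) * x" using x by (intro mult_right_mono) auto
  also have "\<dots> \<le> exp x" using exp_lower_Taylor_quadratic[of x] x by (simp add: power2_eq_square)
  finally show ?thesis using x(2) by blast
qed

text \<open>The value at \<open>z0\<close> is propagated to the origin, where \<open>w\<close> is
  one fixed number. A lower bound on \<open>h\<close> becomes a damping rate of the kernel. The
  constant in \<open>semi\<close> may grow like the exponential of a quadratic because it enters the
  result only through the logarithm of the initial age.\<close>

lemma stationary_solution_upper:
  fixes w h :: "real^('n::finite + 'n) \<Rightarrow> real" and G :: "real^('n + 'n) \<Rightarrow> real^('n + 'n)"
  assumes jet: "\<And>t z. has_jet (\<lambda>t. w) t z ((\<Sum>i\<in>UNIV. q i z + (p i z)\<^sup>2) + h z) (\<lambda>i. p i z) (\<lambda>i. q i z)"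
    and cw: "continuous_on UNIV w"
    and low: "\<And>z. h z \<ge> - C * (1 + (norm z)\<^sup>2)" and C: "C > 0"
    and semi: "\<And>z u. norm u \<le> 1 \<Longrightarrow> w (z + u) \<ge> w z + G z \<bullet> u - k * exp (\<kappa> * (1 + (norm z)\<^sup>2)) * (norm u)\<^sup>2"
    and k: "k > 0" and \<kappa>: "\<kappa> \<ge> 0"
  shows "\<exists>C'\<ge>0. \<forall>z. w z \<le> C' * (1 + (norm z)\<^sup>2)"
proof -
  define n where "n = real CARD('n)"
  have n0: "n > 0" by (simp add: n_def)
  txt \<open>The damping rate \<open>\<Lambda>\<close> below has to dominate \<open>- h\<close> where the barrier exceeds \<open>\<epsilon>\<close>, a region whose
    size depends on \<open>\<Lambda>\<close>; smallness of \<open>\<tau>\<close> closes this loop.\<close>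
  obtain \<tau> :: real where \<tau>: "0 < \<tau>" "\<tau> \<le> 1 / 2" "64 * C * \<tau>\<^sup>2 \<le> 1"
  proof
    define \<tau> where "\<tau> = 1 / (2 + 64 * C)"
    show "0 < \<tau>" using C by (simp add: \<tau>_def)
    show t2: "\<tau> \<le> 1 / 2" using C by (simp add: \<tau>_def field_simps)
    have "64 * C * \<tau> \<le> 1" using C by (simp add: \<tau>_def field_simps)
    then have "64 * C * \<tau> * \<tau> \<le> 1 * 1" using t2 \<open>0 < \<tau>\<close> C by (intro mult_mono) auto
    then show "64 * C * \<tau>\<^sup>2 \<le> 1" by (simp add: power2_eq_square)
  qed
  \<comment> \<open>Free of \<open>a\<close> and chosen so that the total logarithmic loss
    \<open>X + \<Lambda> * \<tau>\<close> is at most \<open>(c1 + 4 * n * a) * Q\<close>, as shown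
    in \<open>XL\<close>.\<close>
  define c1 where "c1 = 2 + 80 / \<tau> ^ 3 + 34 * C"
  have c1: "c1 > 0" unfolding c1_def using \<tau> C by (auto intro!: add_pos_pos)
  obtain x where x: "x \<ge> 0" "exp x \<ge> (32 * (c1 + 4 * n * (\<kappa> + 1)) * (k + 1) + 1 / \<tau>) + 32 * 4 * n * (k + 1) * x"
    using exists_exp_dominates_affine by blast
  define a where "a = \<kappa> + 1 + x"
  have a: "a \<ge> 1" "exp (a - \<kappa> - 1) \<ge> 32 * (c1 + 4 * n * a) * (k + 1)"
    using x \<kappa> \<tau> by (auto simp: a_def algebra_simps) (smt (verit) divide_pos_pos)
  have a\<tau>: "exp (- a) \<le> \<tau>"
  proof -
    have "1 / \<tau> \<le> exp x"
      using x n0 c1 k \<kappa> by (smt (verit, best) mult_nonneg_nonneg)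
    also have "\<dots> \<le> exp a" using \<kappa> by (simp add: a_def)
    finally show ?thesis using \<tau> by (simp add: exp_minus field_simps)
  qed
  have main: "w z0 \<le> w 0 + 1 + (c1 + 4 * n * a) * (1 + (norm z0)\<^sup>2)" for z0
  proof -
    define Q where "Q = 1 + (norm z0)\<^sup>2"
    have Q: "Q \<ge> 1" by (simp add: Q_def)
    \<comment> \<open>At this radius the quadratic error term of \<open>semi\<close> at
      \<open>z0\<close> is at most 1.\<close>
    define r where "r = exp (- \<kappa> * Q / 2) / sqrt (k + 1)"
    have r2: "r\<^sup>2 = exp (- \<kappa> * Q) / (k + 1)"
      using k exp_double[of "- \<kappa> * Q / 2"] by (simp add: r_def power_divide)
    have r: "0 < r" "r \<le> 1"
    proof -
      have "exp (- \<kappa> * Q / 2) \<le> 1" "1 \<le> sqrt (k + 1)" using \<kappa> k Q by simp_all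
      then have "exp (- \<kappa> * Q / 2) \<le> 1 * sqrt (k + 1)" by linarith
      then show "r \<le> 1" unfolding r_def using k by (subst divide_le_eq) simp
      show "0 < r" unfolding r_def using k by simp
    qed
    define \<sigma> where "\<sigma> = exp (- a * Q)"
    have aQ: "a * Q \<ge> a" using a Q by simp
    have \<sigma>: "0 < \<sigma>" "\<sigma> \<le> \<tau>" using a\<tau> aQ by (auto simp: \<sigma>_def intro: order_trans[of _ "exp (-a)"])
    \<comment> \<open>Loss of the undamped kernel between its start and the origin at time
      \<open>\<tau>\<close>: \<open>2 * n * (a * Q)\<close> bounds the spreading from age
      \<open>\<sigma>\<close> to age \<open>\<tau> + \<sigma>\<close>, and
      \<open>40 * Q / \<tau> ^ 3\<close> bounds the Gaussian factor. The extra 1 leaves room above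
      the floor \<open>\<epsilon>\<close>.\<close>
    define X where "X = 1 + 2 * n * (a * Q) + 40 * Q / \<tau> ^ 3"
    \<comment> \<open>On the region found in \<open>Wbig\<close>, \<open>C * (1 + |z|^2)\<close> is
      then at most \<open>\<Lambda> / 2\<close> plus
      \<open>32 * C * \<tau>\<^sup>2 * \<Lambda>\<close>, and the latter is again at most
      \<open>\<Lambda> / 2\<close>.\<close>
    define \<Lambda> where "\<Lambda> = 2 * C * (17 * Q + 32 * \<tau> * X)"
    have X: "X \<ge> 1" unfolding X_def using n0 a Q \<tau> by simp
    have \<Lambda>0: "\<Lambda> > 0" unfolding \<Lambda>_def using C Q X \<tau> by (intro mult_pos_pos add_pos_pos) auto
    have XL: "X + \<Lambda> * \<tau> \<le> (c1 + 4 * n * a) * Q"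
    proof -
      have "\<Lambda> * \<tau> = 34 * C * \<tau> * Q + (64 * C * \<tau>\<^sup>2) * X"
        by (simp add: \<Lambda>_def power2_eq_square algebra_simps)
      also have "\<dots> \<le> 34 * C * 1 * Q + 1 * X"
        using \<tau> C X Q by (intro add_mono mult_right_mono mult_left_mono) auto
      finally have "X + \<Lambda> * \<tau> \<le> 2 * X + 34 * C * Q" by simp
      also have "\<dots> \<le> 2 * Q + 4 * n * a * Q + 80 / \<tau> ^ 3 * Q + 34 * C * Q"
        using Q by (simp add: X_def)
      finally show ?thesis by (simp add: c1_def algebra_simps)
    qed
    \<comment> \<open>The kernel starts so narrow that it is below the floor outside the ball of
      radius \<open>r / 2\<close>. As \<open>r^2\<close> is of order
      \<open>exp (- \<kappa> * Q)\<close>, this forces \<open>a\<close> above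
      \<open>\<kappa>\<close>, with enough surplus to beat the affine loss in
      \<open>a\<close>.\<close>
    have small: "32 * \<sigma> * (X + \<Lambda> * \<tau>) \<le> r\<^sup>2"
    proof -
      have "32 * (X + \<Lambda> * \<tau>) * (k + 1) \<le> 32 * ((c1 + 4 * n * a) * Q) * (k + 1)"
        using XL k by simp
      also have "\<dots> = (32 * (c1 + 4 * n * a) * (k + 1)) * Q" by simp
      also have "\<dots> \<le> exp (a - \<kappa> - 1) * exp Q"
      proof (intro mult_mono)
        show "Q \<le> exp Q" using exp_ge_add_one_self[of Q] by linarith
      qed (use a Q in auto)
      also have "\<dots> \<le> exp ((a - \<kappa> - 1) * Q) * exp Q"
      proof -
        have "(a - \<kappa> - 1) * 1 \<le> (a - \<kappa> - 1) * Q"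
          using Q x by (intro mult_left_mono) (auto simp: a_def)
        then show ?thesis by simp
      qed
      also have "\<dots> = exp (- \<kappa> * Q) / \<sigma>"
        by (simp add: \<sigma>_def exp_minus field_simps flip: exp_add) 
      finally show ?thesis using k \<sigma> by (simp add: r2 field_simps)
    qed
    \<comment> \<open>Moving the centre half a radius along \<open>G z0\<close> makes the linear
      term of \<open>semi\<close> nonnegative on the whole ball around \<open>z1\<close>, so the
      size of the gradient never enters.\<close>
    define z1 where "z1 = z0 + (r / 2) *\<^sub>R sgn (G z0)"
    define \<gamma> where "\<gamma> t = z1 + t *\<^sub>R drift z1" for t
    have sg: "norm (sgn (G z0)) \<le> 1" by (simp add: norm_sgn)
    have z1: "(norm z1)\<^sup>2 \<le> 2 * Q"
    proof -
      have "norm z1 \<le> norm z0 + 1"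
        using norm_triangle_ineq[of z0 "(r / 2) *\<^sub>R sgn (G z0)"] sg r mult_mono[of "r/2" 1 "norm (sgn (G z0))" 1]
        unfolding z1_def by simp
      then have "(norm z1)\<^sup>2 \<le> (norm z0 + 1)\<^sup>2" by (intro power_mono) auto
      also have "\<dots> \<le> 2 * Q" using zero_le_power2[of "norm z0 - 1"]
        unfolding Q_def power2_eq_square by (simp add: algebra_simps)
      finally show ?thesis .
    qed
    have \<gamma>: "(norm (\<gamma> t))\<^sup>2 \<le> 8 * Q" if "0 \<le> t" "t \<le> 1" for t
    proof -
      have "norm (\<gamma> t) \<le> norm z1 + norm (t *\<^sub>R drift z1)" unfolding \<gamma>_def by (rule norm_triangle_ineq)
      also have "norm (t *\<^sub>R drift z1) \<le> 1 * norm z1"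
        unfolding norm_scaleR using that norm_drift_le[of z1] by (intro mult_mono) auto
      finally have "norm (\<gamma> t) \<le> 2 * norm z1" by simp
      then have "(norm (\<gamma> t))\<^sup>2 \<le> (2 * norm z1)\<^sup>2" by (intro power_mono) auto
      then show ?thesis using z1 by (simp add: power_mult_distrib)
    qed
    have ball: "w z \<ge> w z0 - 1" if "norm (z - z1) \<le> r / 2" for z
    proof -
      define u where "u = z - z0"
      have u: "u = (r / 2) *\<^sub>R sgn (G z0) + (z - z1)" by (simp add: u_def z1_def)
      have "norm u \<le> r / 2 * 1 + r / 2"
        unfolding u using r sg that
        by (intro order_trans[OF norm_triangle_ineq] add_mono) (auto simp: mult_left_le)
      then have nu: "norm u \<le> r" by simp
      have "G z0 \<bullet> u \<ge> 0"
      proof -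
        have "\<bar>G z0 \<bullet> (z - z1)\<bar> \<le> norm (G z0) * (r / 2)"
          using Cauchy_Schwarz_ineq2[of "G z0" "z - z1"] that
          by (meson mult_left_mono norm_ge_zero order_trans)
        moreover have "G z0 \<bullet> sgn (G z0) = norm (G z0)"
          by (cases "G z0 = 0") (simp_all add: sgn_div_norm dot_square_norm power2_eq_square)
        ultimately show ?thesis unfolding u by (simp add: inner_add_right mult.commute)
      qed
      moreover have "k * exp (\<kappa> * Q) * (norm u)\<^sup>2 \<le> 1"
      proof -
        have "k * exp (\<kappa> * Q) * (norm u)\<^sup>2 \<le> (k + 1) * exp (\<kappa> * Q) * r\<^sup>2"
          using nu k by (intro mult_mono power_mono) auto
        also have "\<dots> = 1" using k by (simp add: r2 exp_minus)
        finally show ?thesis .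
      qed
      ultimately show ?thesis using semi[of u z0] nu r by (simp add: u_def Q_def)
    qed
    \<comment> \<open>A kernel of age \<open>t + \<sigma>\<close>, damped at rate
      \<open>\<Lambda>\<close> and normalised to peak at \<open>w z0 - 1\<close> initially. Its
      centre follows the free trajectory \<open>\<gamma>\<close>, so that
      \<open>z - \<gamma> t\<close> is itself carried by \<open>drift\<close>.\<close>
    define W where "W t z = (w z0 - 1 - \<Lambda> * t - 2 * n * ln ((t + \<sigma>) / \<sigma>)) + kolmogorov (t + \<sigma>) (z - \<gamma> t)" for t z
    \<comment> \<open>A floor for the barrier: \<open>w\<close> has no lower bound at hand, so
      positivity of \<open>S\<close> on a large sphere comes from
      \<open>exp (W t z) \<le> \<epsilon>\<close> there. It sits a factor \<open>exp 1\<close> below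
      the value guaranteed for the kernel at the origin at time \<open>\<tau>\<close>, so at least
      \<open>\<epsilon>\<close> survives its subtraction.\<close>
    define \<epsilon> where "\<epsilon> = exp (w z0 - 1 - (X + \<Lambda> * \<tau>))"
    define S where "S t z = exp (w z) - exp (W t z) + \<epsilon>" for t z
    have lnp: "ln ((t + \<sigma>) / \<sigma>) \<ge> 0" if "0 \<le> t" for t using that \<sigma> by simp
    have Wbig: "(norm z)\<^sup>2 \<le> 16 * Q + 32 * \<tau> * (X + \<Lambda> * \<tau>)"
      if t: "0 \<le> t" "t \<le> \<tau>" and W: "exp (W t z) > \<epsilon>" for t z
    proof -
      let ?s = "t + \<sigma>"
      have s: "0 < ?s" "?s \<le> 1" "?s \<le> 2 * \<tau>" using t \<sigma> \<tau> by auto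
      have "w z0 - 1 - (X + \<Lambda> * \<tau>) < W t z" using W by (simp add: \<epsilon>_def)
      also have "\<dots> \<le> w z0 - 1 + kolmogorov ?s (z - \<gamma> t)"
      proof -
        have "0 \<le> \<Lambda> * t" "0 \<le> 2 * n * ln (?s / \<sigma>)" using lnp[OF t(1)] n0 \<Lambda>0 t by simp_all
        then show ?thesis unfolding W_def by linarith
      qed
      also have "\<dots> \<le> w z0 - 1 - (norm (z - \<gamma> t))\<^sup>2 / (8 * ?s)"
        using kolmogorov_upper[OF s(1,2), of "z - \<gamma> t"] by simp
      finally have "(norm (z - \<gamma> t))\<^sup>2 / (8 * ?s) < X + \<Lambda> * \<tau>" by simp
      then have "(norm (z - \<gamma> t))\<^sup>2 < (X + \<Lambda> * \<tau>) * (8 * ?s)" using s by (simp add: divide_less_eq)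
      also have "\<dots> \<le> (X + \<Lambda> * \<tau>) * (16 * \<tau>)" using s X \<Lambda>0 \<tau> by (intro mult_left_mono) auto
      finally have 1: "(norm (z - \<gamma> t))\<^sup>2 \<le> 16 * \<tau> * (X + \<Lambda> * \<tau>)" by (simp add: mult.commute)
      have "norm z \<le> norm (\<gamma> t) + norm (z - \<gamma> t)" using norm_triangle_ineq[of "\<gamma> t" "z - \<gamma> t"] by simp
      then have "(norm z)\<^sup>2 \<le> (norm (\<gamma> t) + norm (z - \<gamma> t))\<^sup>2" by (intro power_mono) auto
      also have "\<dots> \<le> 2 * (norm (\<gamma> t))\<^sup>2 + 2 * (norm (z - \<gamma> t))\<^sup>2"
        using zero_le_power2[of "norm (\<gamma> t) - norm (z - \<gamma> t)"] unfolding power2_eq_square by (simp add: algebra_simps)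
      finally show ?thesis using 1 \<gamma>[of t] t \<tau> by simp
    qed
    define R where "R = 1 + (16 * Q + 32 * \<tau> * (X + \<Lambda> * \<tau>))"
    have B1: "16 * Q + 32 * \<tau> * (X + \<Lambda> * \<tau>) \<ge> 0" using Q X \<tau> \<Lambda>0 by simp
    have "S \<tau> 0 \<ge> 0"
    proof (rule maximum_principle[of 0 \<tau> R S 0])
      show "continuous_on ({0..\<tau>} \<times> cball 0 R) (\<lambda>(t, z). S t z)"
        unfolding S_def W_def \<gamma>_def split_beta using \<sigma>
        by (intro continuous_intros continuous_on_compose2[OF cw] continuous_on_kolmogorov) auto
    next
      fix z
      show "S 0 z \<ge> 0"
      proof (cases "norm (z - z1) \<le> r / 2")
        case True
        have "W 0 z \<le> w z0 - 1"
          using kolmogorov_upper[of \<sigma> "z - \<gamma> 0"] \<sigma> \<tau> by (simp add: W_def) (smt (verit) divide_nonneg_pos zero_le_power2)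
        also have "\<dots> \<le> w z" by (rule ball[OF True])
        finally show ?thesis by (simp add: S_def \<epsilon>_def add_nonneg_pos less_imp_le)
      next
        case False
        then have "(r / 2)\<^sup>2 \<le> (norm (z - z1))\<^sup>2" using r by (intro power_mono) auto
        then have "8 * \<sigma> * (X + \<Lambda> * \<tau>) \<le> (norm (z - z1))\<^sup>2" using small by (simp add: power_divide)
        then have "X + \<Lambda> * \<tau> \<le> (norm (z - z1))\<^sup>2 / (8 * \<sigma>)" using \<sigma> by (simp add: field_simps)
        moreover have "W 0 z \<le> w z0 - 1 - (norm (z - z1))\<^sup>2 / (8 * \<sigma>)"
          using kolmogorov_upper[of \<sigma> "z - \<gamma> 0"] \<sigma> \<tau> by (simp add: W_def \<gamma>_def)
        ultimately have "exp (W 0 z) \<le> \<epsilon>" by (simp add: \<epsilon>_def)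
        then show ?thesis unfolding S_def using exp_ge_zero[of "w z"] by linarith
      qed
    next
      fix t and z :: "real^('n + 'n)" assume t: "0 \<le> t" "t \<le> \<tau>" and z: "norm z = R"
      have "\<not> (norm z)\<^sup>2 \<le> 16 * Q + 32 * \<tau> * (X + \<Lambda> * \<tau>)"
      proof -
        have "R \<le> R\<^sup>2" using B1 by (simp add: R_def power2_eq_square)
        then show ?thesis using z by (simp add: R_def)
      qed
      then have "exp (W t z) \<le> \<epsilon>" using Wbig[OF t, of z] by linarith
      then show "S t z \<ge> 0" unfolding S_def using exp_ge_zero[of "w z"] by linarith
    next
      fix t and z :: "real^('n + 'n)" assume t: "0 < t" "t \<le> \<tau>" and neg: "S t z < 0"
      have t0: "0 \<le> t" using t by simp
      have W\<epsilon>: "exp (W t z) > \<epsilon> + exp (w z)" using neg by (simp add: S_def)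
      have nz: "(norm z)\<^sup>2 \<le> 16 * Q + 32 * \<tau> * (X + \<Lambda> * \<tau>)"
        by (rule Wbig[OF t0 t(2)]) (use W\<epsilon> exp_gt_zero[of "w z"] in linarith)
      have hL: "h z \<ge> - \<Lambda>"
      proof -
        have "C * (1 + (norm z)\<^sup>2) \<le> C * (Q + (16 * Q + 32 * \<tau> * (X + \<Lambda> * \<tau>)))"
          using C nz Q by (intro mult_left_mono) auto
        also have "\<dots> = C * (17 * Q + 32 * \<tau> * X) + (64 * C * \<tau>\<^sup>2) * \<Lambda> / 2"
          by (simp add: power2_eq_square algebra_simps)
        also have "\<dots> \<le> \<Lambda> / 2 + 1 * \<Lambda> / 2"
          using \<tau> \<Lambda>0 by (intro add_mono divide_right_mono mult_right_mono) (auto simp: \<Lambda>_def)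
        finally show ?thesis using low[of z] by simp
      qed
      define s where "s = t + \<sigma>"
      have s: "s > 0" using t \<sigma> by (simp add: s_def)
      define pk where "pk i = 3 * (z - \<gamma> t) $ Inl i / s\<^sup>2 - 2 * (z - \<gamma> t) $ Inr i / s" for i
      have jk: "has_jet (\<lambda>t z. kolmogorov (t + \<sigma>) (z - \<gamma> t)) t z (\<Sum>i\<in>UNIV. (pk i)\<^sup>2) pk (\<lambda>i. - 2 / s)"
      proof -
        note k = kolmogorov_jet[OF s, of "z - \<gamma> t", folded pk_def]
        have eq: "kolmogorov (t + h + \<sigma>) (z + h *\<^sub>R drift z - \<gamma> (t + h)) = kolmogorov (s + h) ((z - \<gamma> t) + h *\<^sub>R drift (z - \<gamma> t))" for h
        proof -
          have st: "t + h + \<sigma> = t + \<sigma> + h" by simp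
          have z': "z + h *\<^sub>R drift z - \<gamma> (t + h) = (z - \<gamma> t) + h *\<^sub>R drift (z - \<gamma> t)"
            by (simp add: \<gamma>_def drift_diff drift_add drift_scaleR drift_drift algebra_simps)
          show ?thesis unfolding s_def st z' ..
        qed
        show ?thesis unfolding has_jet_def eq
          using k has_d2_shift[of "kolmogorov s" z "- \<gamma> t"] unfolding has_jet_def by (simp add: s_def)
      qed
      have jc: "has_jet (\<lambda>t z. w z0 - 1 - \<Lambda> * t - 2 * n * ln ((t + \<sigma>) / \<sigma>)) t z (- \<Lambda> - 2 * n / s) (\<lambda>i. 0) (\<lambda>i. 0)"
        unfolding has_jet_def using s \<sigma>
        by (auto intro!: has_d2_const derivative_eq_intros simp: s_def field_simps)
      have jW: "has_jet W t z (- \<Lambda> - 2 * n / s + (\<Sum>i\<in>UNIV. (pk i)\<^sup>2)) pk (\<lambda>i. - 2 / s)"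
        using has_jet_add[OF jc jk] by (simp add: W_def[abs_def])
      note jS = has_jet_add[OF has_jet_diff[OF has_jet_exp[OF jet[of t z]] has_jet_exp[OF jW]] has_jet_const[of \<epsilon>]]
      have nn: "(\<Sum>i\<in>(UNIV::'n set). - 2 / s) = - 2 * n / s" by (simp add: n_def)
      have "(\<forall>i. exp (w z) * (q i z + (p i z)\<^sup>2) - exp (W t z) * (- 2 / s + (pk i)\<^sup>2) + 0 \<ge> 0) \<longrightarrow>
         exp (w z) * ((\<Sum>i\<in>UNIV. q i z + (p i z)\<^sup>2) + h z) - exp (W t z) * (- \<Lambda> - 2 * n / s + (\<Sum>i\<in>UNIV. (pk i)\<^sup>2)) + 0 > 0 * S t z"
      proof
        assume A: "\<forall>i. exp (w z) * (q i z + (p i z)\<^sup>2) - exp (W t z) * (- 2 / s + (pk i)\<^sup>2) + 0 \<ge> 0"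
        then have "0 \<le> (\<Sum>i\<in>UNIV. exp (w z) * (q i z + (p i z)\<^sup>2) - exp (W t z) * (- 2 / s + (pk i)\<^sup>2))"
          by (intro sum_nonneg) auto
        also have "\<dots> = exp (w z) * (\<Sum>i\<in>UNIV. q i z + (p i z)\<^sup>2) - exp (W t z) * (- 2 * n / s + (\<Sum>i\<in>UNIV. (pk i)\<^sup>2))"
          unfolding nn[symmetric] sum.distrib[symmetric] by (simp only: sum_subtractf sum_distrib_left)
        finally have 1: "0 \<le> \<dots>" .
        have "exp (w z) * h z \<ge> exp (w z) * (- \<Lambda>)" using hL by (intro mult_left_mono) auto
        moreover have "\<Lambda> * (exp (W t z) - exp (w z)) > 0"
        proof (rule mult_pos_pos[OF \<Lambda>0])
          have "\<epsilon> > 0" by (simp add: \<epsilon>_def)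
          then show "exp (W t z) - exp (w z) > 0" using W\<epsilon> by linarith
        qed
        ultimately show "exp (w z) * ((\<Sum>i\<in>UNIV. q i z + (p i z)\<^sup>2) + h z) - exp (W t z) * (- \<Lambda> - 2 * n / s + (\<Sum>i\<in>UNIV. (pk i)\<^sup>2)) + 0 > 0 * S t z"
          using 1 by (simp add: algebra_simps)
      qed
      then show "\<exists>y p q. has_jet S t z y p q \<and> ((\<forall>i. 0 \<le> q i) \<longrightarrow> 0 * S t z < y)"
        using jS unfolding S_def[abs_def, symmetric] by blast
    qed (use \<tau> B1 in \<open>auto simp: R_def\<close>)
    moreover have "exp (W \<tau> 0) \<ge> 2 * \<epsilon>"
    proof -
      let ?s = "\<tau> + \<sigma>"
      have s: "0 < ?s" "?s \<le> 1" using \<tau> \<sigma> by auto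
      have "ln (?s / \<sigma>) \<le> ln (1 / \<sigma>)" using s \<sigma> by (simp add: divide_right_mono)
      also have "\<dots> = a * Q" by (simp add: \<sigma>_def ln_div)
      finally have l: "2 * n * ln (?s / \<sigma>) \<le> 2 * n * (a * Q)" using n0 by (intro mult_left_mono) auto
      have "5 * (norm (\<gamma> \<tau>))\<^sup>2 / ?s ^ 3 \<le> 5 * (8 * Q) / \<tau> ^ 3"
        using \<gamma>[of \<tau>] \<tau> \<sigma> Q by (intro frac_le mult_left_mono power_mono) auto
      then have "kolmogorov ?s (0 - \<gamma> \<tau>) \<ge> - (40 * Q / \<tau> ^ 3)"
        using kolmogorov_lower[OF s, of "0 - \<gamma> \<tau>"] by simp
      then have "W \<tau> 0 \<ge> w z0 - 1 - (X + \<Lambda> * \<tau>) + 1"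
        using l unfolding W_def X_def by simp
      then have "exp (W \<tau> 0) \<ge> exp (w z0 - 1 - (X + \<Lambda> * \<tau>)) * exp 1"
        by (simp flip: exp_add)
      moreover have "exp 1 \<ge> (2::real)" using exp_ge_add_one_self[of 1] by simp
      then have *: "exp (w z0 - 1 - (X + \<Lambda> * \<tau>)) * exp 1 \<ge> exp (w z0 - 1 - (X + \<Lambda> * \<tau>)) * 2"
        by (intro mult_left_mono) auto
      ultimately show ?thesis using * unfolding \<epsilon>_def by linarith
    qed
    ultimately have "\<epsilon> \<le> exp (w 0)" by (simp add: S_def)
    then have "w z0 - 1 - (X + \<Lambda> * \<tau>) \<le> w 0" by (simp add: \<epsilon>_def)
    then show ?thesis using XL by (simp add: Q_def)
  qed
  define D where "D = c1 + 4 * n * a"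
  have D: "D \<ge> 0" using c1 n0 a by (simp add: D_def)
  show ?thesis
  proof (intro exI[of _ "\<bar>w 0\<bar> + 1 + D"] conjI allI)
    fix z :: "real^('n + 'n)"
    define A where "A = \<bar>w 0\<bar>"
    have A: "w 0 \<le> A" "A \<ge> 0" by (simp_all add: A_def)
    have m: "w z \<le> w 0 + 1 + D * (1 + (norm z)\<^sup>2)" using main[of z] by (simp only: D_def)
    define B where "B = D * (1 + (norm z)\<^sup>2)"
    have "(A + 1) * 1 \<le> (A + 1) * (1 + (norm z)\<^sup>2)" using A by (intro mult_left_mono) auto
    moreover have "w z \<le> A + 1 + B" using m A(1) unfolding B_def[symmetric] by linarith
    ultimately have "w z \<le> (A + 1) * (1 + (norm z)\<^sup>2) + B" by simp
    then show "w z \<le> (\<bar>w 0\<bar> + 1 + D) * (1 + (norm z)\<^sup>2)"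
      by (simp only: distrib_right A_def B_def)
  qed (use D in simp)
qed

section \<open>Comparison with the midpoint supersolution\<close>

definition embed_v :: "real^'n \<Rightarrow> real^('n::finite + 'n)" where
  "embed_v b = (\<Sum>i\<in>UNIV. b $ i *\<^sub>R axis (Inr i) 1)"

lemma embed_v_uminus: "embed_v (- b) = - embed_v b"
  by (simp add: embed_v_def sum_negf)

lemma drift_uminus: "drift (- z) = - drift z"
  using drift_scaleR[of "-1" z] by simp

text \<open>As \<open>drift\<close> is additive, the displaced point follows its own characteristic
  up to the velocity kick \<open>b\<close>, which adds \<open>b\<close> paired with the velocity
  gradient. Joint differentiability in time and space is what permits splitting the derivative along
  this curve.\<close>

lemma has_jet_moving_frame:
  fixes w :: "real \<Rightarrow> real^('n::finite + 'n) \<Rightarrow> real"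
  assumes j: "has_jet w (s + \<theta>) (z + \<eta> \<theta>) y p q"
    and d: "(\<lambda>(t, z). w t z) differentiable (at (s + \<theta>, z + \<eta> \<theta>))"
    and \<eta>: "(\<eta> has_vector_derivative (drift (\<eta> \<theta>) + embed_v b)) (at \<theta>)"
  shows "has_jet (\<lambda>\<theta> z. w (s + \<theta>) (z + \<eta> \<theta>)) \<theta> z (y + (\<Sum>i\<in>UNIV. b $ i * p i)) p q"
  unfolding has_jet_def
proof (intro conjI allI)
  let ?w = "\<lambda>(t, z). w t z" and ?x = "(s + \<theta>, z + \<eta> \<theta>)"
  obtain L where L: "(?w has_derivative L) (at ?x)" using d differentiable_def by blast
  have lin: "linear L" using L has_derivative_linear by blast
  have chain: "((\<lambda>h. w (c1 h) (c2 h)) has_real_derivative L (d1, d2)) (at 0)"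
    if "(c1 has_vector_derivative d1) (at 0)" "(c2 has_vector_derivative d2) (at 0)"
      "c1 0 = s + \<theta>" "c2 0 = z + \<eta> \<theta>" for c1 c2 d1 d2
  proof -
    have "((\<lambda>h. (c1 h, c2 h)) has_derivative (\<lambda>h. h *\<^sub>R (d1, d2))) (at 0)"
      using has_vector_derivative_Pair[OF that(1,2)] unfolding has_vector_derivative_def .
    from has_derivative_compose[OF this, of ?w L] L that(3,4)
    have "((\<lambda>h. w (c1 h) (c2 h)) has_derivative (\<lambda>h. L (h *\<^sub>R (d1, d2)))) (at 0)" by simp
    also have "(\<lambda>h. L (h *\<^sub>R (d1, d2))) = (*) (L (d1, d2))"
      by (rule ext) (simp only: linear_cmul[OF lin] real_scaleR_def mult.commute)
    finally show ?thesis by (simp add: has_field_derivative_def)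
  qed
  have v1: "((\<lambda>h. s + \<theta> + h) has_vector_derivative 1) (at 0)"
    by (auto intro!: derivative_eq_intros)
  have "((\<lambda>h. z + \<eta> \<theta> + h *\<^sub>R drift (z + \<eta> \<theta>)) has_vector_derivative drift (z + \<eta> \<theta>)) (at 0)"
    by (auto intro!: derivative_eq_intros)
  from chain[OF v1 this]
  have "((\<lambda>h. w (s + \<theta> + h) (z + \<eta> \<theta> + h *\<^sub>R drift (z + \<eta> \<theta>))) has_real_derivative L (1, drift (z + \<eta> \<theta>))) (at 0)"
    by simp
  moreover have "((\<lambda>h. w (s + \<theta> + h) (z + \<eta> \<theta> + h *\<^sub>R drift (z + \<eta> \<theta>))) has_real_derivative y) (at 0)"
    using j unfolding has_jet_def by blast
  ultimately have y: "L (1, drift (z + \<eta> \<theta>)) = y" by (rule DERIV_unique)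
  have p: "L (0, axis (Inr i) 1) = p i" for i
  proof -
    have "((\<lambda>h. z + \<eta> \<theta> + h *\<^sub>R axis (Inr i) 1) has_vector_derivative axis (Inr i) 1) (at 0)"
      by (auto intro!: derivative_eq_intros)
    from chain[OF has_vector_derivative_const this]
    have "((\<lambda>h. w (s + \<theta>) (z + \<eta> \<theta> + h *\<^sub>R axis (Inr i) 1)) has_real_derivative L (0, axis (Inr i) 1)) (at 0)"
      by simp
    moreover have "has_d2 (w (s + \<theta>)) (z + \<eta> \<theta>) (axis (Inr i) 1) (p i) (q i)" using j by (simp add: has_jet_def)
    from has_d2_D1[OF this]
    have "((\<lambda>h. w (s + \<theta>) (z + \<eta> \<theta> + h *\<^sub>R axis (Inr i) 1)) has_real_derivative p i) (at 0)" .
    ultimately show ?thesis by (rule DERIV_unique)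
  qed
  have \<eta>': "((\<lambda>h. \<eta> (\<theta> + h)) has_vector_derivative (drift (\<eta> \<theta>) + embed_v b)) (at 0)"
  proof -
    have "((\<lambda>h. \<theta> + h) has_vector_derivative 1) (at 0)"
      using has_vector_derivative_add[OF has_vector_derivative_const has_vector_derivative_id] by simp
    from vector_diff_chain_at[OF this, of \<eta>] \<eta> show ?thesis by (simp add: o_def)
  qed
  have "((\<lambda>h. z + h *\<^sub>R drift z + \<eta> (\<theta> + h)) has_vector_derivative (drift z + (drift (\<eta> \<theta>) + embed_v b))) (at 0)"
    by (auto intro!: derivative_eq_intros \<eta>')
  from chain[OF v1 this]
  have "((\<lambda>h. w (s + \<theta> + h) (z + h *\<^sub>R drift z + \<eta> (\<theta> + h))) has_real_derivative L (1, drift z + (drift (\<eta> \<theta>) + embed_v b))) (at 0)"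
    by simp
  moreover have "(1::real, drift z + (drift (\<eta> \<theta>) + embed_v b)) = (1, drift (z + \<eta> \<theta>)) + (\<Sum>i\<in>UNIV. b $ i *\<^sub>R (0, axis (Inr i) 1))"
    by (simp add: drift_add embed_v_def prod_eq_iff fst_sum snd_sum add.assoc)
  then have "L (1, drift z + (drift (\<eta> \<theta>) + embed_v b)) = y + (\<Sum>i\<in>UNIV. b $ i * p i)"
    by (simp only: linear_add[OF lin] linear_sum[OF lin] linear_cmul[OF lin] y p real_scaleR_def)
  ultimately show "((\<lambda>h. w (s + (\<theta> + h)) (z + h *\<^sub>R drift z + \<eta> (\<theta> + h))) has_real_derivative
      y + (\<Sum>i\<in>UNIV. b $ i * p i)) (at 0)"
    by (simp add: add.assoc)
next
  fix i
  show "has_d2 (\<lambda>z. w (s + \<theta>) (z + \<eta> \<theta>)) z (axis (Inr i) 1) (p i) (q i)"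
    using j by (intro has_d2_shift) (simp add: has_jet_def)
qed

lemma abs_drift_inner_le: "\<bar>z \<bullet> drift z\<bar> \<le> (norm z)\<^sup>2"
proof -
  have "\<bar>z \<bullet> drift z\<bar> \<le> norm z * norm (drift z)" by (rule Cauchy_Schwarz_ineq2)
  also have "\<dots> \<le> norm z * norm z" by (intro mult_left_mono norm_drift_le) simp
  finally show ?thesis by (simp add: power2_eq_square)
qed

lemma quadratic_jet:
  fixes z :: "real^('n::finite + 'n)"
  assumes "(B has_real_derivative c) (at t)"
  shows "has_jet (\<lambda>t z. B t * (1 + (norm z)\<^sup>2)) t z (c * (1 + (norm z)\<^sup>2) + 2 * B t * (z \<bullet> drift z))
    (\<lambda>i. 2 * B t * z $ Inr i) (\<lambda>i. 2 * B t)"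
  unfolding has_jet_def
proof (intro conjI allI)
  have e: "(norm (z + s *\<^sub>R e))\<^sup>2 = (norm z)\<^sup>2 + 2 * s * (z \<bullet> e) + s\<^sup>2 * (norm e)\<^sup>2" for s e
    unfolding power2_norm_eq_inner by (simp add: algebra_simps inner_commute power2_eq_square)
  have B: "((\<lambda>s. B (t + s)) has_real_derivative c) (at 0)"
    using assms DERIV_shift[of B c 0 t] by (simp add: add.commute)
  have "((\<lambda>s. 1 + ((norm z)\<^sup>2 + 2 * s * (z \<bullet> drift z) + s\<^sup>2 * (norm (drift z))\<^sup>2)) has_real_derivative 2 * (z \<bullet> drift z)) (at 0)"
    by (auto intro!: derivative_eq_intros)
  from DERIV_mult[OF B this]
  show "((\<lambda>s. B (t + s) * (1 + (norm (z + s *\<^sub>R drift z))\<^sup>2)) has_real_derivative c * (1 + (norm z)\<^sup>2) + 2 * B t * (z \<bullet> drift z)) (at 0)"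
    unfolding e by (simp add: algebra_simps)
  fix i
  show "has_d2 (\<lambda>z. B t * (1 + (norm z)\<^sup>2)) z (axis (Inr i) 1) (2 * B t * z $ Inr i) (2 * B t)"
    unfolding has_d2_def e
    by (rule exI[of _ "\<lambda>s. B t * (2 * z $ Inr i + 2 * s)"])
       (auto intro!: derivative_eq_intros simp: inner_axis algebra_simps)
qed

text \<open>\<open>jet\<close> is the equation of \<open>w = ln u\<close> along characteristics,
  with \<open>p\<close> and \<open>q\<close> the first and pure second velocity derivatives.
  \<open>h_mid\<close> is the integrated form of the Hessian bound on the potential.\<close>

locale log_solution =
  fixes w :: "real \<Rightarrow> real^('n::finite + 'n) \<Rightarrow> real" and h :: "real^('n + 'n) \<Rightarrow> real"
    and p q :: "'n \<Rightarrow> real \<Rightarrow> real^('n + 'n) \<Rightarrow> real"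
    and K :: "real^('n + 'n)^('n + 'n)" and C2 :: real
  assumes jet: "\<And>t z. t > 0 \<Longrightarrow> has_jet w t z ((\<Sum>i\<in>UNIV. q i t z + (p i t z)\<^sup>2) + h z) (\<lambda>i. p i t z) (\<lambda>i. q i t z)"
    and diff: "\<And>t z. t > 0 \<Longrightarrow> (\<lambda>(t, z). w t z) differentiable (at (t, z))"
    and h_upper: "\<And>z. h z \<le> C2 * (1 + (norm z)\<^sup>2)" and C2: "C2 \<ge> 0"
    and h_mid: "\<And>z y. 2 * h z \<le> h (z + y) + h (z - y) + y \<bullet> (K *v y)"
begin

text \<open>In each velocity coordinate, averaging the squared gradients \<open>p1\<close>,
  \<open>p2\<close> gains \<open>(p1 - p2)^2 / 4\<close> over the square of the average, and the
  opposite kicks add \<open>b (p1 - p2) / 2\<close>. With the action term \<open>b^2 / 4\<close>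
  this is the perfect square \<open>(p1 - p2 + b)^2 / 4\<close>. The remaining part of the action
  covers the midpoint defect of \<open>h\<close>.\<close>

lemma midpoint_supersolution_jet:
  assumes t: "s + \<theta> > 0"
    and \<eta>: "(\<eta> has_vector_derivative (drift (\<eta> \<theta>) + embed_v b)) (at \<theta>)"
    and A: "(A has_real_derivative a) (at \<theta>)" "a \<ge> (\<eta> \<theta> \<bullet> (K *v \<eta> \<theta>)) / 2 + (norm b)\<^sup>2 / 4"
  shows "\<exists>y P Q. has_jet (\<lambda>\<theta> z. (w (s + \<theta>) (z + \<eta> \<theta>) + w (s + \<theta>) (z - \<eta> \<theta>)) / 2 + A \<theta>) \<theta> z y P Q
     \<and> y \<ge> (\<Sum>i\<in>UNIV. Q i + (P i)\<^sup>2) + h z"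
proof -
  let ?z1 = "z + \<eta> \<theta>" and ?z2 = "z + - \<eta> \<theta>" and ?t = "s + \<theta>"
  let ?p1 = "\<lambda>i. p i ?t ?z1" and ?p2 = "\<lambda>i. p i ?t ?z2" and ?q1 = "\<lambda>i. q i ?t ?z1" and ?q2 = "\<lambda>i. q i ?t ?z2"
  let ?y1 = "(\<Sum>i\<in>UNIV. ?q1 i + (?p1 i)\<^sup>2) + h ?z1" and ?y2 = "(\<Sum>i\<in>UNIV. ?q2 i + (?p2 i)\<^sup>2) + h ?z2"
  have j1: "has_jet (\<lambda>\<theta> z. w (s + \<theta>) (z + \<eta> \<theta>)) \<theta> z (?y1 + (\<Sum>i\<in>UNIV. b $ i * ?p1 i)) ?p1 ?q1"
    by (rule has_jet_moving_frame[OF jet[OF t] diff[OF t] \<eta>])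
  have "((\<lambda>\<theta>. - \<eta> \<theta>) has_vector_derivative (drift (- \<eta> \<theta>) + embed_v (- b))) (at \<theta>)"
    using has_vector_derivative_minus[OF \<eta>] by (simp add: drift_uminus embed_v_uminus)
  from has_jet_moving_frame[where \<eta> = "\<lambda>\<theta>. - \<eta> \<theta>", OF jet[OF t] diff[OF t] this]
  have j2: "has_jet (\<lambda>\<theta> z. w (s + \<theta>) (z + - \<eta> \<theta>)) \<theta> z (?y2 + (\<Sum>i\<in>UNIV. (- b) $ i * ?p2 i)) ?p2 ?q2" .
  have jA: "has_jet (\<lambda>\<theta> z. A \<theta>) \<theta> z a (\<lambda>i. 0) (\<lambda>i. 0)"
    using A(1) DERIV_shift[of A a 0 \<theta>] unfolding has_jet_def by (auto intro!: has_d2_const simp: add.commute)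
  note j = has_jet_add[OF has_jet_cmult[OF has_jet_add[OF j1 j2], of "1/2"] jA]
  let ?y = "1 / 2 * (?y1 + (\<Sum>i\<in>UNIV. b $ i * ?p1 i) + (?y2 + (\<Sum>i\<in>UNIV. (- b) $ i * ?p2 i))) + a"
  let ?P = "\<lambda>i. 1 / 2 * (?p1 i + ?p2 i) + 0" and ?Q = "\<lambda>i. 1 / 2 * (?q1 i + ?q2 i) + 0"
  have "?y \<ge> (\<Sum>i\<in>UNIV. ?Q i + (?P i)\<^sup>2) + h z"
  proof -
    have "(\<Sum>i\<in>UNIV. ?Q i + (?P i)\<^sup>2) \<le> (\<Sum>i\<in>UNIV. 1 / 2 * (?q1 i + (?p1 i)\<^sup>2) + 1 / 2 * (?q2 i + (?p2 i)\<^sup>2)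
       + 1 / 2 * (b $ i * ?p1 i) + 1 / 2 * ((- b) $ i * ?p2 i) + (b $ i)\<^sup>2 / 4)"
    proof (rule sum_mono)
      fix i
      have "0 \<le> (?p1 i - ?p2 i + b $ i)\<^sup>2" by simp
      then show "?Q i + (?P i)\<^sup>2 \<le> 1 / 2 * (?q1 i + (?p1 i)\<^sup>2) + 1 / 2 * (?q2 i + (?p2 i)\<^sup>2)
         + 1 / 2 * (b $ i * ?p1 i) + 1 / 2 * ((- b) $ i * ?p2 i) + (b $ i)\<^sup>2 / 4"
        by (simp add: power2_eq_square field_simps)
    qed
    also have "\<dots> = 1 / 2 * (\<Sum>i\<in>UNIV. ?q1 i + (?p1 i)\<^sup>2) + 1 / 2 * (\<Sum>i\<in>UNIV. ?q2 i + (?p2 i)\<^sup>2)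
       + 1 / 2 * (\<Sum>i\<in>UNIV. b $ i * ?p1 i) + 1 / 2 * (\<Sum>i\<in>UNIV. (- b) $ i * ?p2 i) + (norm b)\<^sup>2 / 4"
    proof -
      have "(norm b)\<^sup>2 = (\<Sum>i\<in>UNIV. (b $ i)\<^sup>2)"
        unfolding power2_norm_eq_inner inner_vec_def by (simp add: power2_eq_square)
      then show ?thesis by (simp only: sum.distrib sum_distrib_left[symmetric] sum_divide_distrib[symmetric])
    qed
    finally show ?thesis using A(2) h_mid[of z "\<eta> \<theta>"] by (simp add: algebra_simps)
  qed
  moreover have "(\<lambda>\<theta> z. (w (s + \<theta>) (z + \<eta> \<theta>) + w (s + \<theta>) (z - \<eta> \<theta>)) / 2 + A \<theta>)
     = (\<lambda>\<theta> z. 1 / 2 * (w (s + \<theta>) (z + \<eta> \<theta>) + w (s + \<theta>) (z + - \<eta> \<theta>)) + A \<theta>)"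
    by (simp add: fun_eq_iff)
  ultimately show ?thesis using j by auto
qed

end

context log_solution
begin

lemma continuous_on_w: "continuous_on ({0<..} \<times> UNIV) (\<lambda>(t, z). w t z)"
proof (intro continuous_at_imp_continuous_on ballI)
  fix x :: "real \<times> (real^('n + 'n))" assume "x \<in> {0<..} \<times> UNIV"
  then show "isCont (\<lambda>(t, z). w t z) x"
    using diff[of "fst x" "snd x"] by (intro differentiable_imp_continuous_within) auto
qed

text \<open>A Gaussian barrier of bounded width only survives for a short time, but the admissible
  time step depends on the growth constant alone, so the comparison can be iterated.\<close>

lemma comparison_step:
  assumes s: "s > 0" and \<theta>0: "0 \<le> \<theta>0"
    and \<eta>: "\<And>\<theta>. (\<eta> has_vector_derivative (drift (\<eta> \<theta>) + embed_v (b \<theta>))) (at \<theta>)"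
    and A: "\<And>\<theta>. (A has_real_derivative a \<theta>) (at \<theta>)"
      "\<And>\<theta>. a \<theta> \<ge> (\<eta> \<theta> \<bullet> (K *v \<eta> \<theta>)) / 2 + (norm (b \<theta>))\<^sup>2 / 4"
    and C4: "C4 \<ge> 0" and growth: "\<And>\<theta> z. 0 \<le> \<theta> \<Longrightarrow> \<theta> \<le> T \<Longrightarrow> w (s + \<theta>) z \<le> C4 * (1 + (norm z)\<^sup>2)"
    and B0: "B0 = C4 + 1" and c: "c = 4 * B0 + 4 * B0 * CARD('n) + 16 * B0\<^sup>2 + C2 + 1"
    and start: "\<And>z. w (s + \<theta>0) z \<le> (w (s + \<theta>0) (z + \<eta> \<theta>0) + w (s + \<theta>0) (z - \<eta> \<theta>0)) / 2 + A \<theta>0"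
    and \<theta>: "\<theta>0 \<le> \<theta>" "\<theta> \<le> \<theta>0 + B0 / c" "\<theta> \<le> T"
  shows "w (s + \<theta>) z \<le> (w (s + \<theta>) (z + \<eta> \<theta>) + w (s + \<theta>) (z - \<eta> \<theta>)) / 2 + A \<theta>"
proof -
  define F where "F \<theta> z = (w (s + \<theta>) (z + \<eta> \<theta>) + w (s + \<theta>) (z - \<eta> \<theta>)) / 2 + A \<theta>" for \<theta> z
  \<comment> \<open>The admissible time \<open>B0 / c\<close> is the time in which \<open>B\<close>
    doubles. With \<open>B \<le> 2 * B0\<close>, the terms of \<open>c\<close> pay in order for the
    transport of the quadratic, its second derivatives, its squared gradient and \<open>h\<close>;
    the last 1 gives strictness.\<close>
  define B where "B \<theta> = B0 + c * (\<theta> - \<theta>0)" for \<theta>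
  have B1: "B0 \<ge> 1" using B0 C4 by simp
  have c0: "c > 0" using B1 C2 unfolding c by (intro add_nonneg_pos add_nonneg_nonneg) auto
  have B2: "B0 \<le> B t" "B t \<le> 2 * B0" if "\<theta>0 \<le> t" "t \<le> \<theta>" for t
  proof -
    show "B0 \<le> B t" using that c0 by (simp add: B_def)
    have "c * (t - \<theta>0) \<le> c * (B0 / c)" using that \<theta> c0 by (intro mult_left_mono) auto
    then show "B t \<le> 2 * B0" using c0 by (simp add: B_def)
  qed
  have c\<eta>: "continuous_on X \<eta>" for X
    using has_vector_derivative_continuous[OF \<eta>] by (auto intro: continuous_at_imp_continuous_on)
  have cA: "continuous_on X A" for X
    using DERIV_isCont[OF A(1)] by (auto intro: continuous_at_imp_continuous_on)
  have step: "exp (w (s + \<theta>) z) \<le> exp (F \<theta> z) + \<epsilon> * exp (B \<theta> * (1 + (norm z)\<^sup>2))" if \<epsilon>: "\<epsilon> > 0" for \<epsilon>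
  proof -
    define S where "S t z = exp (F t z) + \<epsilon> * exp (B t * (1 + (norm z)\<^sup>2)) - exp (w (s + t) z)" for t z
    \<comment> \<open>On this sphere the barrier wins: \<open>B t\<close> exceeds \<open>C4\<close>
      by at least 1, and \<open>R^2 \<ge> R \<ge> \<bar>ln \<epsilon>\<bar>\<close> makes up for the
      small factor \<open>\<epsilon>\<close>. The point of interest \<open>z\<close> stays
      inside.\<close>
    define R where "R = 1 + \<bar>ln \<epsilon>\<bar> + norm z"
    have R: "R \<ge> 1" "R \<ge> \<bar>ln \<epsilon>\<bar>" "norm z \<le> R" by (auto simp: R_def)
    have "S \<theta> z \<ge> 0"
    \<comment> \<open>The rate bounds \<open>h\<close> from above on the ball; where
      \<open>S\<close> is negative, it therefore lies below the zeroth-order term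
      \<open>h z * S t z\<close>.\<close>
    proof (rule maximum_principle[of \<theta>0 \<theta> R S "C2 * (1 + R\<^sup>2)"])
      have "continuous_on ({\<theta>0..\<theta>} \<times> cball 0 R) (\<lambda>x. w (s + fst x) (f x))"
        if "continuous_on ({\<theta>0..\<theta>} \<times> cball 0 R) f" for f
      proof -
        have "continuous_on ({\<theta>0..\<theta>} \<times> cball 0 R) (\<lambda>x. (\<lambda>(t, z). w t z) (s + fst x, f x))"
          by (rule continuous_on_compose2[OF continuous_on_w]) (use s \<theta>0 that in \<open>auto intro!: continuous_intros\<close>)
        then show ?thesis by simp
      qed
      note cw = this
      have c1: "continuous_on ({\<theta>0..\<theta>} \<times> cball (0 :: real^('n + 'n)) R) (\<lambda>x. \<eta> (fst x))"
        by (rule continuous_on_compose2[OF c\<eta>[of UNIV]]) (auto intro!: continuous_intros)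
      have c2: "continuous_on ({\<theta>0..\<theta>} \<times> cball (0 :: real^('n + 'n)) R) (\<lambda>x. A (fst x))"
        by (rule continuous_on_compose2[OF cA[of UNIV]]) (auto intro!: continuous_intros)
      show "continuous_on ({\<theta>0..\<theta>} \<times> cball 0 R) (\<lambda>(t, z). S t z)"
        unfolding S_def F_def B_def split_beta by (intro continuous_intros cw c1 c2) auto
    next
      fix z
      have "exp (w (s + \<theta>0) z) \<le> exp (F \<theta>0 z)" using start[of z] by (simp add: F_def)
      moreover have "0 \<le> \<epsilon> * exp (B \<theta>0 * (1 + (norm z)\<^sup>2))" using \<epsilon> by simp
      ultimately show "0 \<le> S \<theta>0 z" unfolding S_def by linarith
    next
      fix t and z :: "real^('n + 'n)" assume t: "\<theta>0 \<le> t" "t \<le> \<theta>" and z: "norm z = R"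
      have "w (s + t) z \<le> C4 * (1 + R\<^sup>2)" using growth[of t z] t \<theta> \<theta>0 z by simp
      also have "\<dots> = B0 * (1 + R\<^sup>2) - (1 + R\<^sup>2)" by (simp add: B0 algebra_simps)
      also have "\<dots> \<le> B t * (1 + R\<^sup>2) - (1 + R\<^sup>2)"
        using B2[OF t] by (intro diff_right_mono mult_right_mono) auto
      also have "\<dots> \<le> B t * (1 + R\<^sup>2) + ln \<epsilon>"
      proof -
        have "R \<le> R\<^sup>2" using R by (simp add: power2_eq_square)
        then show ?thesis using R(2) by linarith
      qed
      finally have "exp (w (s + t) z) \<le> exp (B t * (1 + (norm z)\<^sup>2) + ln \<epsilon>)" using z by simp
      also have "\<dots> = \<epsilon> * exp (B t * (1 + (norm z)\<^sup>2))" using \<epsilon> by (simp add: exp_add)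
      finally show "0 \<le> S t z" unfolding S_def using exp_ge_zero[of "F t z"] by linarith
    next
      fix t and z :: "real^('n + 'n)" assume t: "\<theta>0 < t" "t \<le> \<theta>" and z: "norm z < R" and neg: "S t z < 0"
      have st: "s + t > 0" using s \<theta>0 t by simp
      obtain yF PF QF where F: "has_jet F t z yF PF QF" "yF \<ge> (\<Sum>i\<in>UNIV. QF i + (PF i)\<^sup>2) + h z"
        using midpoint_supersolution_jet[OF st \<eta> A(1) A(2), of z] unfolding F_def[abs_def] by blast
      define N where "N = (norm z)\<^sup>2"
      have N: "N \<ge> 0" by (simp add: N_def)
      define yB where "yB = c * (1 + N) + 2 * B t * (z \<bullet> drift z)"
      have BD: "(B has_real_derivative c) (at t)" unfolding B_def[abs_def] by (auto intro!: derivative_eq_intros)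
      have jB: "has_jet (\<lambda>t z. B t * (1 + (norm z)\<^sup>2)) t z yB (\<lambda>i. 2 * B t * z $ Inr i) (\<lambda>i. 2 * B t)"
        unfolding yB_def N_def by (rule quadratic_jet[OF BD])
      have yB: "yB > (\<Sum>i\<in>UNIV. 2 * B t + (2 * B t * z $ Inr i)\<^sup>2) + h z"
      proof -
        have b: "B0 \<le> B t" "B t \<le> 2 * B0" "B t \<ge> 0" using B2[of t] B1 t by auto
        have "(\<Sum>i\<in>UNIV. (z $ Inr i)\<^sup>2) \<le> N"
          unfolding N_def norm_square_sum_type by (simp add: sum_nonneg)
        moreover have "(2 * B t)\<^sup>2 \<le> (4 * B0)\<^sup>2" by (rule power_mono) (use b in auto)
        ultimately have "(2 * B t)\<^sup>2 * (\<Sum>i\<in>UNIV. (z $ Inr i)\<^sup>2) \<le> (4 * B0)\<^sup>2 * N"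
          by (intro mult_mono) (auto intro: sum_nonneg)
        then have 1: "(\<Sum>i\<in>UNIV. (2 * B t * z $ Inr i)\<^sup>2) \<le> 16 * B0\<^sup>2 * N"
          by (simp add: power_mult_distrib sum_distrib_left)
        have "\<bar>2 * B t * (z \<bullet> drift z)\<bar> \<le> (4 * B0) * N"
        proof -
          have "\<bar>2 * B t\<bar> \<le> 4 * B0" using b by simp
          then have "\<bar>2 * B t\<bar> * \<bar>z \<bullet> drift z\<bar> \<le> (4 * B0) * N"
            using abs_drift_inner_le[of z] B1 by (intro mult_mono) (simp_all add: N_def)
          then show ?thesis by (simp only: abs_mult)
        qed
        then have 2: "2 * B t * (z \<bullet> drift z) \<ge> - (4 * B0 * N)" by linarith
        have 3: "(\<Sum>i\<in>(UNIV :: 'n set). 2 * B t) \<le> 4 * B0 * CARD('n)" using b by (simp add: mult.commute)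
        have "c * (1 + N) = 4 * B0 + 4 * B0 * CARD('n) + 16 * B0\<^sup>2 + 1
           + 4 * B0 * N + 4 * B0 * CARD('n) * N + 16 * B0\<^sup>2 * N + N + C2 * (1 + N)"
          by (simp add: c algebra_simps)
        moreover have "0 \<le> 4 * B0 * CARD('n) * N" "0 \<le> 4 * B0" "0 \<le> 16 * B0\<^sup>2" using B1 N by simp_all
        ultimately show ?thesis
          using 1 2 3 h_upper[of z] N unfolding yB_def sum.distrib N_def[symmetric] by linarith
      qed
      have jw: "has_jet (\<lambda>t. w (s + t)) t z ((\<Sum>i\<in>UNIV. q i (s + t) z + (p i (s + t) z)\<^sup>2) + h z)
         (\<lambda>i. p i (s + t) z) (\<lambda>i. q i (s + t) z)"
        using jet[OF st] unfolding has_jet_def by (simp add: add.assoc)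
      note jS = has_jet_diff[OF has_jet_add[OF has_jet_exp[OF F(1)] has_jet_cmult[OF has_jet_exp[OF jB], of \<epsilon>]] has_jet_exp[OF jw]]
      let ?F = "exp (F t z)" and ?B = "exp (B t * (1 + (norm z)\<^sup>2))" and ?w = "exp (w (s + t) z)"
      let ?Q = "\<lambda>i. ?F * (QF i + (PF i)\<^sup>2) + \<epsilon> * (?B * (2 * B t + (2 * B t * z $ Inr i)\<^sup>2)) - ?w * (q i (s + t) z + (p i (s + t) z)\<^sup>2)"
      let ?y = "?F * yF + \<epsilon> * (?B * yB) - ?w * ((\<Sum>i\<in>UNIV. q i (s + t) z + (p i (s + t) z)\<^sup>2) + h z)"
      have "(\<forall>i. ?Q i \<ge> 0) \<longrightarrow> ?y > C2 * (1 + R\<^sup>2) * S t z"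
      proof
        assume "\<forall>i. ?Q i \<ge> 0"
        then have "0 \<le> (\<Sum>i\<in>UNIV. ?Q i)" by (intro sum_nonneg) auto
        also have "\<dots> = ?F * (\<Sum>i\<in>UNIV. QF i + (PF i)\<^sup>2) + \<epsilon> * (?B * (\<Sum>i\<in>UNIV. 2 * B t + (2 * B t * z $ Inr i)\<^sup>2))
           - ?w * (\<Sum>i\<in>UNIV. q i (s + t) z + (p i (s + t) z)\<^sup>2)"
          unfolding sum_subtractf sum.distrib sum_distrib_left[symmetric] ..
        finally have 1: "0 \<le> \<dots>" .
        have 2: "?F * yF \<ge> ?F * ((\<Sum>i\<in>UNIV. QF i + (PF i)\<^sup>2) + h z)"
          using F(2) by (intro mult_left_mono) auto
        have 3: "\<epsilon> * (?B * yB) > \<epsilon> * (?B * ((\<Sum>i\<in>UNIV. 2 * B t + (2 * B t * z $ Inr i)\<^sup>2) + h z))"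
          using yB \<epsilon> by (intro mult_strict_left_mono) auto
        have "N \<le> R\<^sup>2" unfolding N_def using z by (intro power_mono) auto
        then have "C2 * (1 + N) \<le> C2 * (1 + R\<^sup>2)" using C2 by (intro mult_left_mono) auto
        then have "h z \<le> C2 * (1 + R\<^sup>2)" using h_upper[of z] by (simp add: N_def)
        then have "C2 * (1 + R\<^sup>2) * S t z \<le> h z * S t z" using neg by (intro mult_right_mono_neg) auto
        also have "\<dots> = ?F * h z + \<epsilon> * (?B * h z) - ?w * h z" by (simp add: S_def algebra_simps)
        also have "\<dots> < ?y"
          using 1 2 3 unfolding distrib_left by linarith
        finally show "?y > C2 * (1 + R\<^sup>2) * S t z" .
      qed
      then show "\<exists>y p q. has_jet S t z y p q \<and> ((\<forall>i. 0 \<le> q i) \<longrightarrow> C2 * (1 + R\<^sup>2) * S t z < y)"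
        using jS unfolding S_def[abs_def, symmetric] by blast
    qed (use \<theta> R in auto)
    then show ?thesis by (simp add: S_def)
  qed
  have "exp (w (s + \<theta>) z) \<le> exp (F \<theta> z)"
  proof (rule field_le_epsilon)
    fix e :: real assume e: "e > 0"
    let ?M = "exp (B \<theta> * (1 + (norm z)\<^sup>2))"
    show "exp (w (s + \<theta>) z) \<le> exp (F \<theta> z) + e" using step[of "e / ?M"] e by simp
  qed
  then show ?thesis by (simp add: F_def)
qed

text \<open>The step length \<open>B0 / c\<close> depends only on constants valid on the whole time
  interval, so an induction over its multiples reaches \<open>T\<close>. At time 0 the displacement
  and the action vanish and the inequality is an equality.\<close>

lemma midpoint_comparison:
  assumes s: "s > 0" and T: "T \<ge> 0"
    and \<eta>: "\<And>\<theta>. (\<eta> has_vector_derivative (drift (\<eta> \<theta>) + embed_v (b \<theta>))) (at \<theta>)"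
    and A: "\<And>\<theta>. (A has_real_derivative a \<theta>) (at \<theta>)"
      "\<And>\<theta>. a \<theta> \<ge> (\<eta> \<theta> \<bullet> (K *v \<eta> \<theta>)) / 2 + (norm (b \<theta>))\<^sup>2 / 4"
    and C4: "C4 \<ge> 0" and growth: "\<And>\<theta> z. 0 \<le> \<theta> \<Longrightarrow> \<theta> \<le> T \<Longrightarrow> w (s + \<theta>) z \<le> C4 * (1 + (norm z)\<^sup>2)"
    and zero: "\<eta> 0 = 0" "A 0 = 0"
  shows "w (s + T) z \<le> (w (s + T) (z + \<eta> T) + w (s + T) (z - \<eta> T)) / 2 + A T"
proof -
  define B0 where "B0 = C4 + 1"
  define c where "c = 4 * B0 + 4 * B0 * CARD('n) + 16 * B0\<^sup>2 + C2 + 1"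
  have B1: "B0 > 0" using C4 by (simp add: B0_def)
  have c0: "c > 0" using B1 C2 unfolding c_def by (intro add_nonneg_pos add_nonneg_nonneg) auto
  define \<tau> where "\<tau> = B0 / c"
  have \<tau>: "\<tau> > 0" using B1 c0 by (simp add: \<tau>_def)
  have "w (s + \<theta>) z \<le> (w (s + \<theta>) (z + \<eta> \<theta>) + w (s + \<theta>) (z - \<eta> \<theta>)) / 2 + A \<theta>"
    if "0 \<le> \<theta>" "\<theta> \<le> T" "\<theta> \<le> real k * \<tau>" for k \<theta> z
    using that
  proof (induction k arbitrary: \<theta> z)
    case 0
    then show ?case using zero by simp
  next
    case (Suc k)
    show ?case
    proof (cases "\<theta> \<le> real k * \<tau>")
      case True
      then show ?thesis using Suc by blast
    next
      case False
      show ?thesis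
      proof (rule comparison_step[where b = b and a = a and T = T and ?\<theta>0.0 = "real k * \<tau>"])
        show "w (s + real k * \<tau>) z \<le> (w (s + real k * \<tau>) (z + \<eta> (real k * \<tau>)) + w (s + real k * \<tau>) (z - \<eta> (real k * \<tau>))) / 2
            + A (real k * \<tau>)" for z
          using False Suc.prems \<tau> by (intro Suc.IH) auto
        show "0 \<le> real k * \<tau>" using \<tau> by simp
        show "real k * \<tau> \<le> \<theta>" using False by simp
        show "\<theta> \<le> real k * \<tau> + B0 / c" using Suc.prems by (simp add: \<tau>_def algebra_simps)
      qed (fact s \<eta> A C4 growth B0_def c_def Suc.prems)+
    qed
  qed
  moreover obtain k :: nat where "T / \<tau> \<le> real k" using real_arch_simple by blast
  then have "T \<le> real k * \<tau>" using \<tau> by (simp add: divide_le_eq)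
  ultimately show ?thesis using T by blast
qed

end

section \<open>Extremal paths and the Riccati equation\<close>

text \<open>The operator exponential applied to \<open>y0\<close>. Taking components turns it into
  scalar power series, which converge everywhere and may be differentiated termwise.\<close>

lemma linear_ode_solution_exists:
  fixes f :: "'a::euclidean_space \<Rightarrow> 'a"
  assumes f: "linear f"
  shows "\<exists>y. y 0 = y0 \<and> (\<forall>t. (y has_vector_derivative f (y t)) (at t))"
proof -
  have bf: "bounded_linear f" using f linear_conv_bounded_linear by blast
  obtain M where M: "M > 0" "\<And>x. norm (f x) \<le> norm x * M" using bounded_linear.pos_bounded[OF bf] by blast
  define a where "a n = (f ^^ n) y0 /\<^sub>R fact n" for n
  have na: "norm (a n) \<le> norm y0 * M ^ n / fact n" for n
  proof -
    have "norm ((f ^^ n) y0) \<le> norm y0 * M ^ n"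
    proof (induction n)
      case (Suc n)
      have "norm ((f ^^ Suc n) y0) \<le> norm ((f ^^ n) y0) * M" using M(2) by simp
      also have "\<dots> \<le> norm y0 * M ^ n * M" using Suc M(1) by (intro mult_right_mono) auto
      finally show ?case by (simp add: mult_ac)
    qed simp
    then show ?thesis by (simp add: a_def divide_right_mono field_simps)
  qed
  have sa: "summable (\<lambda>n. t ^ n *\<^sub>R a n)" for t :: real
  proof (rule summable_comparison_test'[of "\<lambda>n. norm y0 * ((\<bar>t\<bar> * M) ^ n /\<^sub>R fact n)" 0])
    show "summable (\<lambda>n. norm y0 * ((\<bar>t\<bar> * M) ^ n /\<^sub>R fact n))"
      by (intro summable_mult summable_exp_generic)
    show "norm (t ^ n *\<^sub>R a n) \<le> norm y0 * ((\<bar>t\<bar> * M) ^ n /\<^sub>R fact n)" for n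
      using mult_left_mono[OF na[of n], of "\<bar>t\<bar> ^ n"] by (simp add: power_abs power_mult_distrib field_simps)
  qed
  have fa: "f (a n) = real (Suc n) *\<^sub>R a (Suc n)" for n
    by (simp add: a_def linear_cmul[OF f] inverse_mult_distrib del: of_nat_Suc)
  define y where "y t = (\<Sum>n. t ^ n *\<^sub>R a n)" for t :: real
  have yb: "y t \<bullet> b = (\<Sum>n. (a n \<bullet> b) * t ^ n)" for t b
    using bounded_linear.suminf[OF bounded_linear_inner_left sa[of t], of b] by (simp add: y_def mult.commute)
  have sb: "summable (\<lambda>n. (a n \<bullet> b) * t ^ n)" for t b
    using bounded_linear.summable[OF bounded_linear_inner_left sa[of t], of b] by (simp add: mult.commute)
  have fy: "f (y t) \<bullet> b = (\<Sum>n. diffs (\<lambda>n. a n \<bullet> b) n * t ^ n)" for t b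
  proof -
    have "f (y t) = (\<Sum>n. f (t ^ n *\<^sub>R a n))" unfolding y_def by (rule bounded_linear.suminf[OF bf sa])
    then have "f (y t) \<bullet> b = (\<Sum>n. f (t ^ n *\<^sub>R a n) \<bullet> b)"
      using bounded_linear.suminf[OF bounded_linear_inner_left bounded_linear.summable[OF bf sa]] by simp
    then show ?thesis by (simp add: linear_cmul[OF f] fa diffs_def mult_ac)
  qed
  have "(y has_vector_derivative f (y t)) (at t)" for t
    unfolding has_vector_derivative_def
  proof (subst has_derivative_componentwise_within, intro ballI)
    fix b :: 'a assume "b \<in> Basis"
    have "((\<lambda>t. y t \<bullet> b) has_real_derivative f (y t) \<bullet> b) (at t)"
      unfolding yb fy by (rule termdiffs_strong_converges_everywhere[OF sb])
    moreover have "(\<lambda>x. x *\<^sub>R f (y t) \<bullet> b) = (*) (f (y t) \<bullet> b)"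
      by (rule ext) (simp add: mult.commute)
    ultimately show "((\<lambda>x. y x \<bullet> b) has_derivative (\<lambda>x. x *\<^sub>R f (y t) \<bullet> b)) (at t)"
      by (simp only: has_field_derivative_def)
  qed
  moreover have "y 0 = y0" using suminf_finite[of "{0}" "\<lambda>n. 0 ^ n *\<^sub>R a n"] by (simp add: y_def a_def)
  ultimately show ?thesis by blast
qed

lemma bounded_bilinear_matrix_vector_mult:
  "bounded_bilinear ((*v) :: real^'n::finite^'m::finite \<Rightarrow> real^'n \<Rightarrow> real^'m)"
proof -
  have "bilinear ((*v) :: real^'n^'m \<Rightarrow> real^'n \<Rightarrow> real^'m)"
    unfolding bilinear_def
  proof (intro conjI allI)
    show "linear (\<lambda>y. A *v y)" for A :: "real^'n^'m" by simp
    show "linear (\<lambda>A. A *v y)" for y :: "real^'n"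
      by (rule linearI) (auto simp: matrix_vector_mult_add_rdistrib scaleR_matrix_vector_assoc)
  qed
  then show ?thesis by (simp add: bilinear_conv_bounded_bilinear)
qed

text \<open>\<open>exp (2 L t) |q t|^2\<close> is nondecreasing and vanishes at the right
  end.\<close>

lemma backward_gronwall_zero:
  fixes q :: "real \<Rightarrow> 'a::euclidean_space"
  assumes q: "\<And>t. a \<le> t \<Longrightarrow> t \<le> b \<Longrightarrow> (q has_vector_derivative q' t) (at t)"
    and L: "\<And>t. a \<le> t \<Longrightarrow> t \<le> b \<Longrightarrow> norm (q' t) \<le> L * norm (q t)"
    and "q b = 0" "a \<le> b"
  shows "q a = 0"
proof -
  let ?g = "\<lambda>t. exp (2 * L * t) * (q t \<bullet> q t)"
  have "?g a \<le> ?g b"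
  proof (rule DERIV_nonneg_imp_nondecreasing[OF \<open>a \<le> b\<close>])
    fix t assume t: "a \<le> t" "t \<le> b"
    have "((\<lambda>t. q t \<bullet> q t) has_vector_derivative (q t \<bullet> q' t + q' t \<bullet> q t)) (at t)"
      using bounded_bilinear.has_vector_derivative[OF bounded_bilinear_inner q[OF t] q[OF t]] .
    then have d: "((\<lambda>t. q t \<bullet> q t) has_real_derivative 2 * (q t \<bullet> q' t)) (at t)"
      by (simp add: has_real_derivative_iff_has_vector_derivative inner_commute)
    have "(?g has_real_derivative exp (2 * L * t) * (2 * L * (q t \<bullet> q t) + 2 * (q t \<bullet> q' t))) (at t)"
      by (auto intro!: derivative_eq_intros d simp: algebra_simps)
    moreover have "0 \<le> exp (2 * L * t) * (2 * L * (q t \<bullet> q t) + 2 * (q t \<bullet> q' t))"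
    proof -
      have "\<bar>q t \<bullet> q' t\<bar> \<le> norm (q t) * (L * norm (q t))"
        using Cauchy_Schwarz_ineq2[of "q t" "q' t"] mult_left_mono[OF L[OF t], of "norm (q t)"] by simp
      then have "2 * L * (q t \<bullet> q t) + 2 * (q t \<bullet> q' t) \<ge> 0"
        by (simp add: dot_square_norm power2_eq_square mult_ac)
      then show ?thesis by simp
    qed
    ultimately show "\<exists>y. (?g has_real_derivative y) (at t) \<and> 0 \<le> y" by blast
  qed
  then have "q a \<bullet> q a \<le> 0" using \<open>q b = 0\<close> by (simp add: mult_le_0_iff)
  then show ?thesis by (metis inner_eq_zero_iff inner_ge_zero order_antisym)
qed

lemma matrix_inv_left:
  fixes A :: "real^'n::finite^'n"
  assumes "invertible A" shows "matrix_inv A ** A = mat 1"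
  using assms someI_ex[of "\<lambda>B. A ** B = mat 1 \<and> B ** A = mat 1"]
  unfolding invertible_def matrix_inv_def by blast

lemma Cmat_mult_vec: "Cmat *v z = - drift z"
  and Dmat_mult_vec: "Dmat *v z = embed_v (2 *\<^sub>R vpart z)"
proof -
  have "(Cmat *v z) $ a = (- drift z) $ a" for a
  proof (cases a)
    case (Inl i)
    have "(Cmat *v z) $ a = (\<Sum>j\<in>UNIV. if i = j then - (z $ Inr j) else 0)"
      unfolding Inl matrix_vector_mult_def Cmat_def by (simp add: sum_UNIV_sum_type if_distrib[of "\<lambda>x. x * _"] cong: if_cong)
    then show ?thesis using Inl by simp
  next
    case (Inr i)
    then show ?thesis unfolding matrix_vector_mult_def Cmat_def by (simp add: sum_UNIV_sum_type)
  qed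
  then show "Cmat *v z = - drift z" by (simp add: vec_eq_iff)
  have "(Dmat *v z) $ a = embed_v (2 *\<^sub>R vpart z) $ a" for a
  proof (cases a)
    case (Inl i)
    then show ?thesis
      unfolding matrix_vector_mult_def Dmat_def embed_v_def by (simp add: sum_UNIV_sum_type axis_def)
  next
    case (Inr i)
    have "(Dmat *v z) $ a = (\<Sum>j\<in>UNIV. if i = j then 2 * (z $ Inr j) else 0)"
      unfolding Inr matrix_vector_mult_def Dmat_def by (simp add: sum_UNIV_sum_type if_distrib[of "\<lambda>x. x * _"] cong: if_cong)
    moreover have "embed_v (2 *\<^sub>R vpart z) $ a = (\<Sum>j\<in>UNIV. if i = j then 2 * (z $ Inr j) else 0)"
      unfolding Inr embed_v_def by (simp add: axis_def vpart_def if_distrib[of "\<lambda>x. _ * x"] cong: if_cong)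
    ultimately show ?thesis by simp
  qed
  then show "Dmat *v z = embed_v (2 *\<^sub>R vpart z)" by (simp add: vec_eq_iff)
qed

lemma inner_embed_v: "z \<bullet> embed_v b = vpart z \<bullet> b"
proof -
  have "z \<bullet> embed_v b = (\<Sum>i\<in>UNIV. b $ i * z $ Inr i)"
    by (simp add: embed_v_def inner_sum_right inner_axis)
  then show ?thesis by (simp add: vpart_def inner_vec_def mult.commute)
qed

text \<open>Extremals of the action: the Riccati equation is the one satisfied by the ratio of
  momentum and position along the linear Hamiltonian system, and vanishing of the inverse
  at time 0 says that the extremals start at the origin.\<close>

lemma riccati_extremal:
  fixes N :: "real \<Rightarrow> real^('n::finite + 'n)^('n + 'n)"
  assumes N_inv: "\<And>t. t > 0 \<Longrightarrow> invertible (N t)"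
    and riccati: "\<And>t. t > 0 \<Longrightarrow>
       (N has_vector_derivative (N t ** Cmat + transpose Cmat ** N t + N t ** Dmat ** N t - K)) (at t)"
    and N_lim: "((\<lambda>t. matrix_inv (N t)) \<longlongrightarrow> 0) (at_right 0)"
    and T: "T > 0"
  obtains \<eta> b A a where
    "\<And>\<theta>. (\<eta> has_vector_derivative (drift (\<eta> \<theta>) + embed_v (b \<theta>))) (at \<theta>)"
    "\<And>\<theta>. (A has_real_derivative a \<theta>) (at \<theta>)"
    "\<And>\<theta>. a \<theta> = (\<eta> \<theta> \<bullet> (K *v \<eta> \<theta>)) / 2 + (norm (b \<theta>))\<^sup>2 / 4"
    "\<eta> 0 = 0" "A 0 = 0" "\<eta> T = \<eta>1" "A T = - (\<eta>1 \<bullet> (N T *v \<eta>1)) / 2"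
proof -
  \<comment> \<open>The Hamiltonian system has constant coefficients and is solved globally from its
    data at time \<open>T\<close>. The closed equation for the position, obtained by inserting
    momentum \<open>N t *v \<eta> t\<close>, would have a coefficient that becomes singular at time
    0.\<close>
  define f :: "(real^('n + 'n)) \<times> (real^('n + 'n)) \<Rightarrow> (real^('n + 'n)) \<times> (real^('n + 'n))"
    where "f y = (- (Cmat *v fst y) - Dmat *v snd y, transpose Cmat *v snd y - K *v fst y)" for y
  have "linear f"
    by (rule linearI) (auto simp: f_def matrix_vector_right_distrib matrix_vector_mult_scaleR algebra_simps)
  then obtain y where y: "y 0 = (\<eta>1, N T *v \<eta>1)" "\<And>t. (y has_vector_derivative f (y t)) (at t)"
    using linear_ode_solution_exists by blast
  define \<eta> where "\<eta> t = fst (y (t - T))" for t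
  define p where "p t = snd (y (t - T))" for t
  have ys: "((\<lambda>t. y (t - T)) has_vector_derivative f (y (t - T))) (at t)" for t
  proof -
    have "((\<lambda>t. t - T) has_vector_derivative 1) (at t)" by (auto intro!: derivative_eq_intros)
    from vector_diff_chain_at[OF this y(2)] show ?thesis by (simp add: o_def)
  qed
  have \<eta>: "(\<eta> has_vector_derivative (- (Cmat *v \<eta> t) - Dmat *v p t)) (at t)" for t
    using bounded_linear.has_vector_derivative[OF bounded_linear_fst ys[of t]] by (simp add: \<eta>_def[abs_def] p_def[abs_def] f_def)
  have p: "(p has_vector_derivative (transpose Cmat *v p t - K *v \<eta> t)) (at t)" for t
    using bounded_linear.has_vector_derivative[OF bounded_linear_snd ys[of t]] by (simp add: \<eta>_def[abs_def] p_def[abs_def] f_def)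
  have end_T: "\<eta> T = \<eta>1" "p T = N T *v \<eta>1" by (simp_all add: \<eta>_def p_def y)
  have pN: "p t = N t *v \<eta> t" if t: "0 < t" "t \<le> T" for t
  proof -
    \<comment> \<open>The defect of the Riccati relation obeys a homogeneous linear equation with
      coefficients bounded on \<open>{t..T}\<close>, and it vanishes at \<open>T\<close> by the
      choice of the data.\<close>
    define q where "q t = p t - N t *v \<eta> t" for t
    define q' where "q' t = transpose Cmat *v q t + N t *v (Dmat *v q t)" for t
    have q: "(q has_vector_derivative q' t) (at t)" if "t > 0" for t
    proof -
      have "((\<lambda>t. N t *v \<eta> t) has_vector_derivative
         (N t *v (- (Cmat *v \<eta> t) - Dmat *v p t) + (N t ** Cmat + transpose Cmat ** N t + N t ** Dmat ** N t - K) *v \<eta> t)) (at t)"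
        by (rule bounded_bilinear.has_vector_derivative[OF bounded_bilinear_matrix_vector_mult riccati[OF that] \<eta>])
      from has_vector_derivative_diff[OF p this]
      show ?thesis unfolding q_def[abs_def] q'_def
        by (simp add: matrix_vector_mult_add_rdistrib matrix_vector_mult_diff_rdistrib matrix_vector_mult_diff_distrib
            matrix_vector_right_distrib matrix_vector_mul_assoc[symmetric] vec.neg algebra_simps)
    qed
    have cN: "continuous_on {t..T} N"
      using has_vector_derivative_continuous[OF riccati] t by (auto intro!: continuous_at_imp_continuous_on)
    have "bounded (N ` {t..T})" by (intro compact_imp_bounded compact_continuous_image cN) simp
    then obtain BN where BN: "\<And>s. t \<le> s \<Longrightarrow> s \<le> T \<Longrightarrow> norm (N s) \<le> BN" unfolding bounded_iff by (metis atLeastAtMost_iff imageI)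
    obtain L where L: "L > 0" "\<And>(A :: real^('n + 'n)^('n + 'n)) x. norm (A *v x) \<le> norm A * norm x * L"
      using bounded_bilinear.pos_bounded[OF bounded_bilinear_matrix_vector_mult] by blast
    have BN0: "BN \<ge> 0" using BN[of T] t norm_ge_zero[of "N T"] by linarith
    have "q t = 0"
    proof (rule backward_gronwall_zero[of t T q q' "norm (transpose Cmat :: real^('n + 'n)^('n + 'n)) * L + BN * (norm (Dmat :: real^('n + 'n)^('n + 'n)) * L) * L"])
      fix s assume s: "t \<le> s" "s \<le> T"
      show "(q has_vector_derivative q' s) (at s)" using q s t by simp
      have "norm (q' s) \<le> norm (transpose Cmat *v q s) + norm (N s *v (Dmat *v q s))"
        unfolding q'_def by (rule norm_triangle_ineq)
      also have "norm (transpose Cmat *v q s) \<le> norm (transpose Cmat :: real^('n + 'n)^('n + 'n)) * norm (q s) * L" by (rule L)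
      also have "norm (N s *v (Dmat *v q s)) \<le> BN * (norm (Dmat :: real^('n + 'n)^('n + 'n)) * norm (q s) * L) * L"
      proof -
        have "norm (N s *v (Dmat *v q s)) \<le> norm (N s) * norm (Dmat *v q s) * L" by (rule L)
        also have "\<dots> \<le> BN * (norm (Dmat :: real^('n + 'n)^('n + 'n)) * norm (q s) * L) * L"
          using BN[OF s] L BN0 by (intro mult_mono) auto
        finally show ?thesis .
      qed
      finally show "norm (q' s) \<le> (norm (transpose Cmat :: real^('n + 'n)^('n + 'n)) * L + BN * (norm (Dmat :: real^('n + 'n)^('n + 'n)) * L) * L) * norm (q s)"
        by (simp add: algebra_simps)
    qed (use t end_T in \<open>auto simp: q_def\<close>)
    then show ?thesis by (simp add: q_def)
  qed
  have "\<eta> 0 = 0"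
  proof -
    have cp: "(p \<longlongrightarrow> p 0) (at_right 0)" "(\<eta> \<longlongrightarrow> \<eta> 0) (at_right 0)"
      using has_vector_derivative_continuous[OF p] has_vector_derivative_continuous[OF \<eta>]
      by (auto simp: isCont_def intro: tendsto_within_subset)
    have "((\<lambda>t. matrix_inv (N t) *v p t) \<longlongrightarrow> 0 *v p 0) (at_right 0)"
      by (rule bounded_bilinear.tendsto[OF bounded_bilinear_matrix_vector_mult N_lim cp(1)])
    moreover have "\<forall>\<^sub>F t in at_right 0. matrix_inv (N t) *v p t = \<eta> t"
      using eventually_at_right_real[OF T]
    proof eventually_elim
      case (elim t)
      then show ?case using pN[of t] N_inv[of t]
        by (simp add: matrix_vector_mul_assoc matrix_inv_left)
    qed
    ultimately have "(\<eta> \<longlongrightarrow> 0 *v p 0) (at_right 0)" using tendsto_cong by fast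
    from tendsto_unique[OF _ cp(2) this] show ?thesis by simp
  qed
  \<comment> \<open>Forced by \<open>- (Dmat *v p) = embed_v b\<close>. Then
    \<open>|b|^2 / 4\<close> is half of \<open>p\<close> paired with \<open>Dmat *v p\<close>, and
    the derivative of \<open>- (\<eta> \<bullet> p) / 2\<close> is the action density.\<close>
  define b where "b t = - 2 *\<^sub>R vpart (p t)" for t
  define A where "A t = - (\<eta> t \<bullet> p t) / 2" for t
  show thesis
  proof (rule that[of \<eta> b A "\<lambda>\<theta>. (\<eta> \<theta> \<bullet> (K *v \<eta> \<theta>)) / 2 + (norm (b \<theta>))\<^sup>2 / 4"])
    fix t
    show "(\<eta> has_vector_derivative (drift (\<eta> t) + embed_v (b t))) (at t)"
      using \<eta>[of t] by (simp add: Cmat_mult_vec Dmat_mult_vec b_def embed_v_uminus)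
    have "((\<lambda>t. \<eta> t \<bullet> p t) has_real_derivative (\<eta> t \<bullet> (transpose Cmat *v p t - K *v \<eta> t) + (- (Cmat *v \<eta> t) - Dmat *v p t) \<bullet> p t)) (at t)"
      using bounded_bilinear.has_vector_derivative[OF bounded_bilinear_inner \<eta>[of t] p[of t]]
      by (simp add: has_real_derivative_iff_has_vector_derivative)
    also have "\<eta> t \<bullet> (transpose Cmat *v p t - K *v \<eta> t) + (- (Cmat *v \<eta> t) - Dmat *v p t) \<bullet> p t
       = - 2 * ((\<eta> t \<bullet> (K *v \<eta> t)) / 2 + (norm (b t))\<^sup>2 / 4)"
    proof -
      have "\<eta> t \<bullet> (transpose Cmat *v p t) = (Cmat *v \<eta> t) \<bullet> p t"
        by (simp add: inner_commute[of _ "p t"] inner_commute[of "\<eta> t"] dot_lmul_matrix)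
      moreover have "(Dmat *v p t) \<bullet> p t = (norm (b t))\<^sup>2 / 2"
        by (simp add: Dmat_mult_vec inner_commute[of _ "p t"] inner_embed_v b_def power_mult_distrib power2_norm_eq_inner)
      ultimately show ?thesis by (simp add: inner_diff_right inner_diff_left)
    qed
    finally show "(A has_real_derivative (\<eta> t \<bullet> (K *v \<eta> t)) / 2 + (norm (b t))\<^sup>2 / 4) (at t)"
      unfolding A_def[abs_def] by (auto intro!: derivative_eq_intros simp: field_simps)
  qed (use \<open>\<eta> 0 = 0\<close> end_T in \<open>auto simp: A_def\<close>)
qed

section \<open>The logarithm of the density\<close>

text \<open>Smoothness is assumed jointly in time and space, while the equation is written with
  derivatives of slices; this links the two.\<close>

lemma slice_partial:
  fixes g :: "real \<times> 'a::euclidean_space \<Rightarrow> real"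
  assumes g: "g differentiable (at (t, z))"
  shows "(\<lambda>z. g (t, z)) differentiable (at z)"
    and "partial b (\<lambda>z. g (t, z)) z = partial (0, b) g (t, z)"
    and "deriv (\<lambda>s. g (s, z)) t = partial (1, 0) g (t, z)"
proof -
  note L = partial_works[OF g]
  have "((\<lambda>z. (t, z)) has_derivative (\<lambda>h. (0, h))) (at z)" by (auto intro!: derivative_eq_intros)
  from has_derivative_compose[OF this L]
  have d: "((\<lambda>z. g (t, z)) has_derivative (\<lambda>h. partial (0, h) g (t, z))) (at z)" .
  show "(\<lambda>z. g (t, z)) differentiable (at z)" using d by (rule differentiableI)
  show "partial b (\<lambda>z. g (t, z)) z = partial (0, b) g (t, z)" by (rule partial_eqI[OF d])
  have "((\<lambda>s. g ((0, z) + s *\<^sub>R (1, 0))) has_real_derivative partial (1, 0) g ((0, z) + t *\<^sub>R (1, 0))) (at t)"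
    by (rule partial_line) (use g in simp)
  then show "deriv (\<lambda>s. g (s, z)) t = partial (1, 0) g (t, z)" by (auto intro: DERIV_imp_deriv)
qed

lemma smooth_slice_twice_diff:
  fixes rho :: "real \<Rightarrow> real^'m::finite \<Rightarrow> real"
  assumes s: "smooth_on ({0<..} \<times> UNIV) (\<lambda>(t, z). rho t z)" and t: "t > 0"
  shows "twice_diff (rho t)"
proof -
  let ?f = "\<lambda>(t, z). rho t z"
  have mem: "(t, z) \<in> {0<..} \<times> UNIV" for z :: "real^'m" using t by simp
  have d: "?f differentiable (at (t, z))" for z by (rule smooth_on_differentiable[OF s mem])
  have "(0, axis i 1) \<in> (Basis :: (real \<times> (real^'m)) set)" for i
    unfolding Basis_prod_def using axis_in_Basis by blast
  note d2 = smooth_on_differentiable[OF smooth_on_partial[OF s this] mem]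
  have e: "rho t = (\<lambda>z. ?f (t, z))" by simp
  have e2: "partial (axis i 1) (rho t) = (\<lambda>z. partial (0, axis i 1) ?f (t, z))" for i
    by (subst e) (intro ext slice_partial(2)[OF d])
  show ?thesis
    unfolding twice_diff_def e2 using slice_partial(1)[OF d] slice_partial(1)[OF d2] by auto
qed

section \<open>Second derivatives of logarithms and the equation for the logarithm\<close>

lemma twice_diff_has_d2:
  assumes "twice_diff f"
  shows "has_d2 f z \<xi> (partial \<xi> f z) (\<xi> \<bullet> (hess f z *v \<xi>))"
  unfolding has_d2_def
  using assms twice_diff_line2[OF assms, of \<xi> z 0]
  by (intro exI[of _ "\<lambda>s. partial \<xi> f (z + s *\<^sub>R \<xi>)"]) (auto intro: partial_line simp: twice_diff_def)

lemma has_d2_ln: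
  assumes f: "has_d2 f z e p q" and pos: "\<And>z. f z > 0"
  shows "has_d2 (\<lambda>z. ln (f z)) z e (p / f z) (q / f z - (p / f z)\<^sup>2)"
proof -
  obtain f' where f': "\<And>s. ((\<lambda>s. f (z + s *\<^sub>R e)) has_real_derivative f' s) (at s)" "f' 0 = p"
      "(f' has_real_derivative q) (at 0)"
    using f unfolding has_d2_def by blast
  have nz: "f z \<noteq> 0" for z using pos[of z] by simp
  have "((\<lambda>s. ln (f (z + s *\<^sub>R e))) has_real_derivative f' s / f (z + s *\<^sub>R e)) (at s)" for s
    using DERIV_chain2[OF DERIV_ln_divide[OF pos] f'(1)[of s]] by simp
  moreover have "((\<lambda>s. f' s / f (z + s *\<^sub>R e)) has_real_derivative q / f z - (p / f z)\<^sup>2) (at 0)"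
    using DERIV_divide[OF f'(3) f'(1)[of 0]] nz[of z] f'(2) by (simp add: field_simps power2_eq_square)
  ultimately show ?thesis unfolding has_d2_def
    using f'(2) by (intro exI[of _ "\<lambda>s. f' s / f (z + s *\<^sub>R e)"]) auto
qed

text \<open>The symmetric sum minus \<open>s^2 c\<close> has a minimum at \<open>s = 0\<close>, and
  its second derivative there is \<open>2 q - 2 c\<close>.\<close>

lemma midpoint_second_derivative:
  assumes f: "has_d2 f z \<xi> p q" and m: "\<And>s. 2 * f z \<le> f (z + s *\<^sub>R \<xi>) + f (z - s *\<^sub>R \<xi>) - s\<^sup>2 * c"
  shows "c \<le> q"
proof -
  obtain f' where f': "\<And>s. ((\<lambda>s. f (z + s *\<^sub>R \<xi>)) has_real_derivative f' s) (at s)" "f' 0 = p"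
      "(f' has_real_derivative q) (at 0)"
    using f unfolding has_d2_def by blast
  let ?g = "\<lambda>s. f (z + s *\<^sub>R \<xi>) + f (z + (- s) *\<^sub>R \<xi>) - s\<^sup>2 * c"
  have "(?g has_real_derivative f' s - f' (- s) - 2 * s * c) (at s)" for s
    using f'(1)[of "- s", unfolded DERIV_mirror] f'(1)[of s]
    by (auto intro!: derivative_eq_intros)
  moreover have "((\<lambda>s. f' s - f' (- s) - 2 * s * c) has_real_derivative 2 * q - 2 * c) (at 0)"
    using DERIV_mirror[of f' q 0] f'(3)
    by (auto intro!: derivative_eq_intros)
  ultimately have "has_d2 ?g 0 1 0 (2 * q - 2 * c)"
    unfolding has_d2_def by (intro exI[of _ "\<lambda>s. f' s - f' (- s) - 2 * s * c"]) auto
  from has_d2_local_min(2)[OF this zero_less_one] m show ?thesis by simp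
qed

lemma hess_quadratic_form:
  "\<xi> \<bullet> (hess f z *v \<xi>) = (\<Sum>i\<in>UNIV. \<Sum>j\<in>UNIV. \<xi> $ i * \<xi> $ j * partial (axis i 1) (partial (axis j 1) f) z)"
  unfolding inner_vec_def matrix_vector_mult_def hess_def by (simp add: sum_distrib_left mult_ac)

text \<open>Positivity at the single point \<open>z\<close> suffices: it persists on a
  neighbourhood, on which the formula for the first partials holds and can be differentiated
  again.\<close>

lemma hess_ln_quadratic_form:
  fixes f :: "real^'m::finite \<Rightarrow> real"
  assumes f: "twice_diff f" and z: "f z > 0"
  shows "\<xi> \<bullet> (hess (\<lambda>z. ln (f z)) z *v \<xi>) = (\<xi> \<bullet> (hess f z *v \<xi>)) / f z - (partial \<xi> f z / f z)\<^sup>2"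
proof -
  have d: "f differentiable (at y)" "partial (axis i 1) f differentiable (at y)" for y i
    using f by (auto simp: twice_diff_def)
  have "continuous_on UNIV f"
    using d(1) by (auto intro!: continuous_at_imp_continuous_on differentiable_imp_continuous_within)
  then have o: "open {y. f y > 0}"
    using continuous_on_open_vimage[of UNIV f] by (auto simp: vimage_def open_Collect_less)
  have 1: "partial b (\<lambda>z. ln (f z)) y = partial b f y / f y" if y: "f y > 0" for b y
  proof -
    have "((\<lambda>z. ln (f z)) has_derivative (\<lambda>b. partial b f y / f y)) (at y)"
      using has_derivative_ln[OF y partial_works[OF d(1)]] by (simp add: divide_inverse mult.commute)
    then show ?thesis by (rule partial_eqI)
  qed
  have 2: "partial (axis i 1) (partial (axis j 1) (\<lambda>z. ln (f z))) z =
     partial (axis i 1) (partial (axis j 1) f) z / f z - partial (axis i 1) f z * partial (axis j 1) f z / (f z)\<^sup>2" for i j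
  proof -
    have "((\<lambda>y. partial (axis j 1) f y / f y) has_derivative
        (\<lambda>b. (partial b (partial (axis j 1) f) z * f z - partial (axis j 1) f z * partial b f z) / (f z * f z))) (at z)"
      by (rule has_derivative_divide'[OF partial_works[OF d(2)] partial_works[OF d(1)]]) (use z in simp)
    then have "((partial (axis j 1) (\<lambda>z. ln (f z))) has_derivative
        (\<lambda>b. (partial b (partial (axis j 1) f) z * f z - partial (axis j 1) f z * partial b f z) / (f z * f z))) (at z)"
      by (rule has_derivative_transform_within_open[OF _ o]) (use z 1 in auto)
    from partial_eqI[OF this] show ?thesis using z by (simp add: field_simps power2_eq_square)
  qed
  have "(\<Sum>i\<in>UNIV. \<Sum>j\<in>UNIV. \<xi> $ i * \<xi> $ j * (partial (axis i 1) f z * partial (axis j 1) f z / (f z)\<^sup>2))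
    = (partial \<xi> f z / f z)\<^sup>2"
    unfolding partial_decomp[OF d(1), of \<xi>] power2_eq_square times_divide_times_eq sum_product sum_divide_distrib
    by (intro sum.cong refl) (simp add: field_simps)
  then show ?thesis
    unfolding hess_quadratic_form 2 right_diff_distrib sum_subtractf by (simp add: sum_divide_distrib)
qed

text \<open>The price of factoring out \<open>exp (- U / 2)\<close>: the substitution removes the
  first-order term in the velocities and leaves multiplication by this function.\<close>

definition kfp_potential :: "(real^('n::finite + 'n) \<Rightarrow> real) \<Rightarrow> real^('n + 'n) \<Rightarrow> real" where
  "kfp_potential U = (\<lambda>w. - (1/2) * (vpart w \<bullet> grad_x U w) + (1/2) * lap_v U w - (1/4) * (norm (grad_v U w))\<^sup>2)"

lemma kfp_potential_sum:
  "kfp_potential U z = (\<Sum>i\<in>UNIV. (1/2) * partial (axis (Inr i) 1) (partial (axis (Inr i) 1) U) z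
      - (1/4) * (partial (axis (Inr i) 1) U z)\<^sup>2 - (1/2) * (z $ Inr i * partial (axis (Inl i) 1) U z))"
proof -
  have "(norm (grad_v U z))\<^sup>2 = (\<Sum>i\<in>UNIV. (partial (axis (Inr i) 1) U z)\<^sup>2)"
    unfolding power2_norm_eq_inner inner_vec_def by (simp add: grad_v_def grad_def power2_eq_square)
  then show ?thesis
    unfolding kfp_potential_def sum_subtractf sum_distrib_left[symmetric]
    by (simp add: inner_vec_def vpart_def grad_x_def grad_def lap_v_def hess_def)
qed

lemma kfp_potential_twice_diff:
  assumes U: "smooth_on UNIV U" shows "twice_diff (kfp_potential U)"
proof -
  note s = smooth_on_partial[OF U axis_in_Basis]
  have "twice_diff (\<lambda>z. \<Sum>i\<in>UNIV. (1/2) * partial (axis (Inr i) 1) (partial (axis (Inr i) 1) U) z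
      + ((-(1/4)) * (partial (axis (Inr i) 1) U z * partial (axis (Inr i) 1) U z) + (-(1/2)) * (z $ Inr i * partial (axis (Inl i) 1) U z)))"
    by (intro twice_diff_sum twice_diff_add twice_diff_mult twice_diff_const twice_diff_nth
        smooth_on_twice_diff s smooth_on_partial[OF s axis_in_Basis] finite)
  moreover have "kfp_potential U = (\<lambda>z. \<Sum>i\<in>UNIV. (1/2) * partial (axis (Inr i) 1) (partial (axis (Inr i) 1) U) z
      + ((-(1/4)) * (partial (axis (Inr i) 1) U z * partial (axis (Inr i) 1) U z) + (-(1/2)) * (z $ Inr i * partial (axis (Inl i) 1) U z)))"
    by (rule ext) (simp add: kfp_potential_sum power2_eq_square algebra_simps)
  ultimately show ?thesis by simp
qed

lemma vpart_inner_grad_x: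
  assumes "f differentiable (at z)"
  shows "partial (drift z) f z = vpart z \<bullet> grad_x f z"
  unfolding partial_decomp[OF assms, of "drift z"] sum_UNIV_sum_type
  by (simp add: inner_vec_def vpart_def grad_x_def grad_def)

lemma hess_axis: "axis i 1 \<bullet> (hess f z *v axis i 1) = partial (axis i 1) (partial (axis i 1) f) z"
  by (simp add: inner_axis' matrix_vector_mult_basis column_def hess_def)

lemma log_density_jet:
  fixes U :: "real^('n::finite + 'n) \<Rightarrow> real"
  assumes U: "twice_diff U"
    and rho: "twice_diff (rho t)" "(\<lambda>(t, z). rho t z) differentiable (at (t, z))"
    and pos: "\<And>t z. t > 0 \<Longrightarrow> rho t z \<ge> 0" and t: "t > 0" and \<delta>: "\<delta> > 0"
    and pde: "deriv (\<lambda>s. rho s z) t =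
         lap_v (rho t) z - grad_v U z \<bullet> grad_v (rho t) z - vpart z \<bullet> grad_x (rho t) z"
  defines "p \<equiv> \<lambda>i. partial (axis (Inr i) 1) (rho t) z / (rho t z + \<delta>) - partial (axis (Inr i) 1) U z / 2"
    and "q \<equiv> \<lambda>i. partial (axis (Inr i) 1) (partial (axis (Inr i) 1) (rho t)) z / (rho t z + \<delta>)
        - (partial (axis (Inr i) 1) (rho t) z / (rho t z + \<delta>))\<^sup>2
        - partial (axis (Inr i) 1) (partial (axis (Inr i) 1) U) z / 2"
  shows "has_jet (\<lambda>t z. ln (rho t z + \<delta>) - U z / 2) t z ((\<Sum>i\<in>UNIV. q i + (p i)\<^sup>2) + kfp_potential U z) p q"
    and "(\<lambda>(t, z). ln (rho t z + \<delta>) - U z / 2) differentiable (at (t, z))"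
proof -
  let ?f = "\<lambda>(t, z). rho t z"
  define r where "r = rho t z + \<delta>"
  have r: "r > 0" using pos[OF t, of z] \<delta> by (simp add: r_def)
  have dU: "U differentiable (at z)" using U by (simp add: twice_diff_def)
  have drho: "rho t differentiable (at z)" using rho(1) by (simp add: twice_diff_def)
  show "(\<lambda>(t, z). ln (rho t z + \<delta>) - U z / 2) differentiable (at (t, z))"
  proof -
    have "((\<lambda>x. rho (fst x) (snd x) + \<delta>) has_derivative (\<lambda>b. partial b ?f (t, z))) (at (t, z))"
      using has_derivative_add[OF partial_works[OF rho(2)] has_derivative_const[of \<delta>]] by (simp add: split_beta)
    from has_derivative_ln[OF _ this] r
    have 1: "(\<lambda>x. ln (rho (fst x) (snd x) + \<delta>)) differentiable (at (t, z))"
      by (simp add: r_def differentiableI)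
    have "((\<lambda>x. U (snd x)) has_derivative (\<lambda>b. partial (snd b) U z)) (at (t, z))"
      using has_derivative_compose[OF has_derivative_snd[OF has_derivative_ident], of U] partial_works[OF dU]
      by auto
    then have "(\<lambda>x. U (snd x)) differentiable (at (t, z))" by (rule differentiableI)
    then have "(\<lambda>x. ln (rho (fst x) (snd x) + \<delta>) - U (snd x) / 2) differentiable (at (t, z))"
      using 1 by (intro differentiable_diff differentiable_divide differentiable_const) auto
    then show ?thesis by (simp add: case_prod_unfold)
  qed
  have Yrho: "((\<lambda>s. rho (t + s) (z + s *\<^sub>R drift z)) has_real_derivative
       lap_v (rho t) z - grad_v U z \<bullet> grad_v (rho t) z) (at 0)"
  proof -
    have "((\<lambda>s. ?f ((t, z) + s *\<^sub>R (1, drift z))) has_real_derivative partial (1, drift z) ?f ((t, z) + 0 *\<^sub>R (1, drift z))) (at 0)"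
      by (rule partial_line) (use rho(2) in simp)
    moreover have "partial (1, drift z) ?f (t, z) = partial (1, 0) ?f (t, z) + partial (0, drift z) ?f (t, z)"
    proof -
      have "linear (\<lambda>b. partial b ?f (t, z))" using partial_works[OF rho(2)] has_derivative_linear by blast
      from linear_add[OF this, of "(1, 0)" "(0, drift z)"] show ?thesis by simp
    qed
    moreover have "partial (0, drift z) ?f (t, z) = vpart z \<bullet> grad_x (rho t) z"
      unfolding slice_partial(2)[OF rho(2), symmetric] vpart_inner_grad_x[OF drho, symmetric] by simp
    moreover have "partial (1, 0) ?f (t, z) = deriv (\<lambda>s. rho s z) t"
      unfolding slice_partial(3)[OF rho(2), symmetric] by simp
    ultimately show ?thesis by (simp add: pde)
  qed
  have YU: "((\<lambda>s. U (z + s *\<^sub>R drift z)) has_real_derivative vpart z \<bullet> grad_x U z) (at 0)"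
    using partial_line[of U z 0 "drift z"] dU vpart_inner_grad_x[OF dU] by simp
  have "((\<lambda>s. ln (rho (t + s) (z + s *\<^sub>R drift z) + \<delta>) - U (z + s *\<^sub>R drift z) / 2) has_real_derivative
     (lap_v (rho t) z - grad_v U z \<bullet> grad_v (rho t) z) / r - vpart z \<bullet> grad_x U z / 2) (at 0)"
  proof -
    have l: "((\<lambda>s. rho (t + s) (z + s *\<^sub>R drift z) + \<delta>) has_real_derivative lap_v (rho t) z - grad_v U z \<bullet> grad_v (rho t) z) (at 0)"
      using DERIV_add[OF Yrho DERIV_const[of \<delta>]] by simp
    have "0 < rho (t + 0) (z + 0 *\<^sub>R drift z) + \<delta>" using r by (simp add: r_def)
    from DERIV_diff[OF DERIV_chain2[OF DERIV_ln_divide[OF this] l] DERIV_cdivide[OF YU, of 2]]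
    show ?thesis by (simp add: r_def)
  qed
  also have "(lap_v (rho t) z - grad_v U z \<bullet> grad_v (rho t) z) / r - vpart z \<bullet> grad_x U z / 2
     = (\<Sum>i\<in>UNIV. q i + (p i)\<^sup>2) + kfp_potential U z"
  proof -
    \<comment> \<open>One velocity coordinate: the cross term in the square of
      \<open>a / r - u / 2\<close> reproduces the drift of the density equation, and the terms
      without \<open>r\<close> on the right add up to \<open>- vx / 2\<close>. The last bracket is
      the summand of \<open>kfp_potential\<close>.\<close>
    have alg: "(a2 - u * a) / r - vx / 2 = (a2 / r - (a / r)\<^sup>2 - u2 / 2 + (a / r - u / 2)\<^sup>2) + (1/2 * u2 - 1/4 * u\<^sup>2 - 1/2 * vx)"
      for a a2 u u2 vx :: real
      using r by (simp add: power2_eq_square field_simps)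
    have pq: "p i = partial (axis (Inr i) 1) (rho t) z / r - partial (axis (Inr i) 1) U z / 2"
      "q i = partial (axis (Inr i) 1) (partial (axis (Inr i) 1) (rho t)) z / r
        - (partial (axis (Inr i) 1) (rho t) z / r)\<^sup>2 - partial (axis (Inr i) 1) (partial (axis (Inr i) 1) U) z / 2" for i
      by (simp_all add: p_def q_def r_def)
    have "(lap_v (rho t) z - grad_v U z \<bullet> grad_v (rho t) z) / r - vpart z \<bullet> grad_x U z / 2
      = (\<Sum>i\<in>UNIV. (partial (axis (Inr i) 1) (partial (axis (Inr i) 1) (rho t)) z
           - partial (axis (Inr i) 1) U z * partial (axis (Inr i) 1) (rho t) z) / r - z $ Inr i * partial (axis (Inl i) 1) U z / 2)"
      unfolding sum_subtractf sum_divide_distrib[symmetric]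
      by (simp add: lap_v_def inner_vec_def hess_def grad_v_def grad_x_def grad_def vpart_def)
    also have "\<dots> = (\<Sum>i\<in>UNIV. q i + (p i)\<^sup>2) + kfp_potential U z"
      unfolding kfp_potential_sum sum.distrib[symmetric] pq by (intro sum.cong refl) (rule alg)
    finally show ?thesis .
  qed
  finally have y: "((\<lambda>s. ln (rho (t + s) (z + s *\<^sub>R drift z) + \<delta>) - U (z + s *\<^sub>R drift z) / 2) has_real_derivative
     (\<Sum>i\<in>UNIV. q i + (p i)\<^sup>2) + kfp_potential U z) (at 0)" .
  have d2: "has_d2 (\<lambda>z. ln (rho t z + \<delta>) - U z / 2) z (axis (Inr i) 1) (p i) (q i)" for i
  proof -
    have "has_d2 (\<lambda>z. rho t z + \<delta>) z (axis (Inr i) 1) (partial (axis (Inr i) 1) (rho t) z)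
       (partial (axis (Inr i) 1) (partial (axis (Inr i) 1) (rho t)) z)"
      using has_d2_add[OF twice_diff_has_d2[OF rho(1), of z "axis (Inr i) 1"] has_d2_const[of \<delta>]] by (simp add: hess_axis)
    then have "has_d2 (\<lambda>z. ln (rho t z + \<delta>)) z (axis (Inr i) 1) (partial (axis (Inr i) 1) (rho t) z / (rho t z + \<delta>))
       (partial (axis (Inr i) 1) (partial (axis (Inr i) 1) (rho t)) z / (rho t z + \<delta>) - (partial (axis (Inr i) 1) (rho t) z / (rho t z + \<delta>))\<^sup>2)"
      by (rule has_d2_ln) (use pos[OF t] \<delta> in \<open>simp add: add_nonneg_pos\<close>)
    from has_d2_diff[OF this has_d2_cmult[OF twice_diff_has_d2[OF U, of z "axis (Inr i) 1"], of "1/2"]]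
    show ?thesis by (simp add: hess_axis p_def q_def)
  qed
  show "has_jet (\<lambda>t z. ln (rho t z + \<delta>) - U z / 2) t z ((\<Sum>i\<in>UNIV. q i + (p i)\<^sup>2) + kfp_potential U z) p q"
    unfolding has_jet_def using y d2 by simp
qed

section \<open>Semiconvexity, growth bounds and conclusion\<close>

lemma matrix_vector_uminus: "(- A) *v x = - (A *v (x :: real^'m))"
  by (simp add: matrix_vector_mult_def vec_eq_iff sum_negf)

lemma semiconvex_taylor:
  assumes f: "twice_diff f" and h: "\<And>z. mat_le (- K) (hess f z)"
  shows "f (z + y) \<ge> f z + partial y f z - (y \<bullet> (K *v y)) / 2"
  using twice_diff_taylor_lower[OF f, of "- (y \<bullet> (K *v y))" y z] h[unfolded mat_le_def, rule_format, of y]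
  by (simp add: matrix_vector_uminus)

lemma semiconvex_midpoint:
  assumes f: "twice_diff f" and h: "\<And>z. mat_le (- K) (hess f z)"
  shows "2 * f z \<le> f (z + y) + f (z - y) + y \<bullet> (K *v y)"
proof -
  have d: "f differentiable (at z)" using f by (simp add: twice_diff_def)
  have "K *v (- y) = - (K *v y)" by (simp add: matrix_vector_mult_def vec_eq_iff sum_negf)
  then show ?thesis
    using semiconvex_taylor[OF f h, of z y] semiconvex_taylor[OF f h, of z "- y"] partial_uminus[OF d, of y] by simp
qed

lemma quadratic_form_le:
  fixes K :: "real^'m::finite^'m"
  obtains k where "k \<ge> 0" "\<And>y. y \<bullet> (K *v y) \<le> 2 * k * (norm y)\<^sup>2"
proof -
  obtain L where L: "L > 0" "\<And>x. norm (K *v x) \<le> norm x * L"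
    using bounded_linear.pos_bounded[OF matrix_vector_mul_bounded_linear[of K]] by blast
  have "y \<bullet> (K *v y) \<le> 2 * (L / 2) * (norm y)\<^sup>2" for y
  proof -
    have "y \<bullet> (K *v y) \<le> norm y * norm (K *v y)" by (rule norm_cauchy_schwarz)
    also have "\<dots> \<le> norm y * (norm y * L)" by (intro mult_left_mono L) simp
    finally show ?thesis by (simp add: power2_eq_square mult_ac)
  qed
  then show thesis using that[of "L / 2"] L by simp
qed

lemma semiconvex_quadratic_lower:
  fixes f :: "real^'m::finite \<Rightarrow> real"
  assumes f: "twice_diff f" and h: "\<And>z. mat_le (- K) (hess f z)"
  obtains C where "C > 0" "\<And>z. f z \<ge> - C * (1 + (norm z)\<^sup>2)"
proof -
  have d: "f differentiable (at 0)" using f by (simp add: twice_diff_def)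
  obtain M where M: "M > 0" "\<And>b. norm (partial b f 0) \<le> norm b * M"
    using bounded_linear.pos_bounded[OF has_derivative_bounded_linear[OF partial_works[OF d]]] by blast
  obtain k where k: "k \<ge> 0" "\<And>y. y \<bullet> (K *v y) \<le> 2 * k * (norm y)\<^sup>2" using quadratic_form_le by blast
  define C where "C = \<bar>f 0\<bar> + M + k"
  have "f z \<ge> - C * (1 + (norm z)\<^sup>2)" for z
  proof -
    have "2 * norm z \<le> 1 + (norm z)\<^sup>2"
      using zero_le_power2[of "norm z - 1"] unfolding power2_eq_square by (simp add: algebra_simps)
    then have "norm z \<le> 1 + (norm z)\<^sup>2" using norm_ge_zero[of z] by linarith
    then have "norm z * M \<le> (1 + (norm z)\<^sup>2) * M" using M(1) by (intro mult_right_mono) auto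
    then have "partial z f 0 \<ge> - (M * (1 + (norm z)\<^sup>2))" using M(2)[of z] by (simp add: mult.commute)
    moreover have "\<bar>f 0\<bar> * 1 \<le> \<bar>f 0\<bar> * (1 + (norm z)\<^sup>2)" by (intro mult_left_mono) auto
    then have "f 0 \<ge> - (\<bar>f 0\<bar> * (1 + (norm z)\<^sup>2))" by linarith
    moreover have "(z \<bullet> (K *v z)) / 2 \<le> k * (1 + (norm z)\<^sup>2)" using k(2)[of z] k(1) by (simp add: algebra_simps)
    ultimately show ?thesis using semiconvex_taylor[OF f h, of 0 z] by (simp add: C_def algebra_simps)
  qed
  then show thesis using that[of C] M(1) k(1) by (simp add: C_def add_nonneg_pos add_pos_nonneg)
qed

lemma smooth_on_continuous_on:
  assumes "smooth_on UNIV f" shows "continuous_on UNIV f"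
  using smooth_on_differentiable[OF assms]
  by (auto intro!: continuous_at_imp_continuous_on differentiable_imp_continuous_within)

lemma partial_eq_inner_grad:
  assumes "f differentiable (at z)" shows "partial u f z = grad f z \<bullet> u"
  unfolding partial_decomp[OF assms, of u] by (simp add: inner_vec_def grad_def mult.commute)

lemma norm_phase: "(norm (xpart z))\<^sup>2 + (norm (vpart z))\<^sup>2 = (norm z)\<^sup>2"
  unfolding norm_square_sum_type power2_norm_eq_inner
  by (simp add: inner_vec_def xpart_def vpart_def power2_eq_square)

lemma norm_xpart_vpart_le: "norm (xpart z) + norm (vpart z) \<le> 2 * norm z"
proof -
  have "(norm (xpart z))\<^sup>2 \<le> (norm z)\<^sup>2" "(norm (vpart z))\<^sup>2 \<le> (norm z)\<^sup>2"
    using norm_phase[of z] zero_le_power2[of "norm (xpart z)"] zero_le_power2[of "norm (vpart z)"] by linarith+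
  then have "norm (xpart z) \<le> norm z" "norm (vpart z) \<le> norm z"
    using power2_le_imp_le norm_ge_zero by blast+
  then show ?thesis by simp
qed

text \<open>Both general estimates are applied to \<open>- U / 2\<close>, the logarithmic weight of
  a constant density; its stationary equation \<open>eq\<close> is an identity between derivatives
  of \<open>U\<close>.\<close>

lemma potential_and_weight_bounds:
  fixes U :: "real^('n::finite + 'n) \<Rightarrow> real"
  assumes U: "smooth_on UNIV U" and k0: "k0 \<ge> 0" and \<kappa>: "\<kappa> \<ge> 0"
    and hess_U_bound: "\<And>z. mat_le (hess U z)
              ((k0 * exp (\<kappa> * ((norm (xpart z))\<^sup>2 + (norm (vpart z))\<^sup>2))) *\<^sub>R mat 1)"
    and hess_h: "\<And>z. mat_le (- K) (hess (kfp_potential U) z)"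
  shows "\<exists>C\<ge>0. \<forall>z. kfp_potential U z \<le> C * (1 + (norm z)\<^sup>2)"
    and "\<exists>C\<ge>0. \<forall>z. - U z / 2 \<le> C * (1 + (norm z)\<^sup>2)"
proof -
  note tU = smooth_on_twice_diff[OF U] and th = kfp_potential_twice_diff[OF U]
  have dU: "U differentiable (at z)" "partial (axis a 1) U differentiable (at z)" for z a
    using tU by (auto simp: twice_diff_def)
  obtain C where C: "C > 0" "\<And>z. kfp_potential U z \<ge> - C * (1 + (norm z)\<^sup>2)"
    using semiconvex_quadratic_lower[OF th hess_h] by blast
  obtain k where k: "k \<ge> 0" "\<And>y. y \<bullet> (K *v y) \<le> 2 * k * (norm y)\<^sup>2" using quadratic_form_le by blast
  define w where "w z = - (1/2) * U z" for z
  define wv where "wv i z = - (1/2) * partial (axis (Inr i) 1) U z" for i :: 'n and z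
  define wvv where "wvv i z = - (1/2) * partial (axis (Inr i) 1) (partial (axis (Inr i) 1) U) z" for i :: 'n and z
  define wx where "wx i z = - (1/2) * partial (axis (Inl i) 1) U z" for i :: 'n and z
  have l: "((\<lambda>s. g (z + s *\<^sub>R e)) has_real_derivative partial e g z) (at 0)"
    if "g differentiable (at z)" for g :: "real^('n + 'n) \<Rightarrow> real" and z e
    using partial_line[of g z 0 e] that by simp
  note s1 = smooth_on_partial[OF U axis_in_Basis]
  note s2 = smooth_on_partial[OF s1 axis_in_Basis]
  have cw: "continuous_on UNIV w" "continuous_on UNIV (wv i)" "continuous_on UNIV (wvv i)" "continuous_on UNIV (wx i)" for i
    unfolding w_def wv_def wvv_def wx_def by (intro continuous_intros smooth_on_continuous_on U s1 s2)+
  have eq: "(\<Sum>i\<in>UNIV. wvv i z + (wv i z)\<^sup>2) - (\<Sum>i\<in>UNIV. z $ Inr i * wx i z) + kfp_potential U z = 0" for z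
    unfolding kfp_potential_sum sum_subtractf[symmetric] sum.distrib[symmetric]
    by (rule sum.neutral) (simp add: wv_def wvv_def wx_def power2_eq_square field_simps)
  show "\<exists>C\<ge>0. \<forall>z. kfp_potential U z \<le> C * (1 + (norm z)\<^sup>2)"
  proof (rule semiconvex_potential_quadratic_upper[where w = w and wv = wv and wvv = wvv and wx = wx and C = C and k = k])
    show "((\<lambda>s. w (z + s *\<^sub>R axis (Inr i) 1)) has_real_derivative wv i z) (at 0)" for i z
      unfolding w_def wv_def by (intro DERIV_cmult l dU)
    show "((\<lambda>s. wv i (z + s *\<^sub>R axis (Inr i) 1)) has_real_derivative wvv i z) (at 0)" for i z
      unfolding wv_def wvv_def by (intro DERIV_cmult l dU)
    show "((\<lambda>s. w (z + s *\<^sub>R axis (Inl i) 1)) has_real_derivative wx i z) (at 0)" for i z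
      unfolding w_def wx_def by (intro DERIV_cmult l dU)
    show "2 * kfp_potential U z \<le> kfp_potential U (z + y) + kfp_potential U (z - y) + 2 * k * (norm y)\<^sup>2" for z y
      using semiconvex_midpoint[OF th hess_h, of z y] k(2)[of y] by linarith
  qed (use cw eq C k in auto)
  have "\<exists>C\<ge>0. \<forall>z. w z \<le> C * (1 + (norm z)\<^sup>2)"
  \<comment> \<open>The rate is doubled because \<open>|z + s u|^2 \<le> 2 (1 + |z|^2)\<close> for
    \<open>|u| \<le> 1\<close> and \<open>0 \<le> s \<le> 1\<close>; \<open>k0 + 1\<close> makes the
    constant strictly positive.\<close>
  proof (rule stationary_solution_upper[where h = "kfp_potential U" and p = wv and q = wvv
        and G = "\<lambda>z. - (1/2) *\<^sub>R grad U z" and k = "k0 + 1" and \<kappa> = "2 * \<kappa>", OF _ cw(1) C(2,1)])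
    fix t :: real and z
    have "((\<lambda>s. w (z + s *\<^sub>R drift z)) has_real_derivative - (1/2) * partial (drift z) U z) (at 0)"
      unfolding w_def by (intro DERIV_cmult l dU)
    moreover have "- (1/2) * partial (drift z) U z = (\<Sum>i\<in>UNIV. wvv i z + (wv i z)\<^sup>2) + kfp_potential U z"
    proof -
      have "- (1/2) * partial (drift z) U z = (\<Sum>i\<in>UNIV. z $ Inr i * wx i z)"
        unfolding vpart_inner_grad_x[OF dU(1)] inner_vec_def sum_distrib_left
        by (simp add: vpart_def grad_x_def grad_def wx_def)
      then show ?thesis using eq[of z] by linarith
    qed
    moreover have "has_d2 w z (axis (Inr i) 1) (wv i z) (wvv i z)" for i
      using has_d2_cmult[OF twice_diff_has_d2[OF tU, of z "axis (Inr i) 1"], of "- (1/2)"]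
      by (simp add: w_def[abs_def] wv_def wvv_def hess_axis)
    ultimately show "has_jet (\<lambda>t. w) t z ((\<Sum>i\<in>UNIV. wvv i z + (wv i z)\<^sup>2) + kfp_potential U z) (\<lambda>i. wv i z) (\<lambda>i. wvv i z)"
      unfolding has_jet_def by simp
  next
    fix z u :: "real^('n + 'n)" assume u: "norm u \<le> 1"
    define E where "E = (k0 + 1) * exp (2 * \<kappa> * (1 + (norm z)\<^sup>2)) * (norm u)\<^sup>2"
    have "w (z + 1 *\<^sub>R u) \<ge> w (z + 0 *\<^sub>R u) + - (1/2) * partial u U (z + 0 *\<^sub>R u) + (- 2 * E) / 2"
    proof (rule taylor2_lower)
      fix s :: real assume s: "0 \<le> s" "s \<le> 1"
      show "((\<lambda>s. w (z + s *\<^sub>R u)) has_real_derivative - (1/2) * partial u U (z + s *\<^sub>R u)) (at s)"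
        unfolding w_def by (intro DERIV_cmult partial_line dU)
      show "((\<lambda>s. - (1/2) * partial u U (z + s *\<^sub>R u)) has_real_derivative - (1/2) * (u \<bullet> (hess U (z + s *\<^sub>R u) *v u))) (at s)"
        by (intro DERIV_cmult twice_diff_line2 tU)
      let ?z = "z + s *\<^sub>R u"
      have "norm ?z \<le> norm z + 1"
        using norm_triangle_ineq[of z "s *\<^sub>R u"] s u mult_mono[of s 1 "norm u" 1] by simp
      then have "(norm ?z)\<^sup>2 \<le> (norm z + 1)\<^sup>2" by (intro power_mono) auto
      also have "\<dots> \<le> 2 * (1 + (norm z)\<^sup>2)"
        using zero_le_power2[of "norm z - 1"] unfolding power2_eq_square by (simp add: algebra_simps)
      finally have "\<kappa> * (norm ?z)\<^sup>2 \<le> \<kappa> * (2 * (1 + (norm z)\<^sup>2))" using \<kappa> by (rule mult_left_mono)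
      then have ex: "exp (\<kappa> * (norm ?z)\<^sup>2) \<le> exp (2 * \<kappa> * (1 + (norm z)\<^sup>2))" by (simp add: mult_ac)
      have "u \<bullet> (hess U ?z *v u) \<le> u \<bullet> (((k0 * exp (\<kappa> * (norm ?z)\<^sup>2)) *\<^sub>R mat 1) *v u)"
        using hess_U_bound[of ?z] unfolding mat_le_def norm_phase by blast
      also have "\<dots> = k0 * exp (\<kappa> * (norm ?z)\<^sup>2) * (norm u)\<^sup>2"
        by (simp add: scaleR_matrix_vector_assoc[symmetric] power2_norm_eq_inner)
      also have "\<dots> \<le> E"
        unfolding E_def using ex k0 by (intro mult_right_mono mult_mono) auto
      finally have "u \<bullet> (hess U ?z *v u) \<le> E" .
      moreover have "E \<ge> 0" unfolding E_def using k0 by simp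
      ultimately show "- 2 * E \<le> - (1/2) * (u \<bullet> (hess U ?z *v u))" by simp
    qed
    moreover have "- (1/2) * partial u U z = (- (1/2) *\<^sub>R grad U z) \<bullet> u"
      by (simp add: partial_eq_inner_grad[OF dU(1)])
    ultimately show "w z + (- (1/2) *\<^sub>R grad U z) \<bullet> u - (k0 + 1) * exp (2 * \<kappa> * (1 + (norm z)\<^sup>2)) * (norm u)\<^sup>2 \<le> w (z + u)"
      by (simp add: E_def)
  qed (use k0 \<kappa> in auto)
  then show "\<exists>C\<ge>0. \<forall>z. - U z / 2 \<le> C * (1 + (norm z)\<^sup>2)" by (simp add: w_def)
qed

text \<open>The gradient bound is used along the segment from the origin, where \<open>rho\<close>
  is bounded by compactness of the time interval; norms on the segment do not exceed
  \<open>|z|\<close>. One \<open>C\<close> in the result comes from the weight inside the gradient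
  bound, the other from the weight \<open>- U z / 2\<close> itself.\<close>

lemma log_density_growth:
  fixes U :: "real^('n::finite + 'n) \<Rightarrow> real" and rho :: "real \<Rightarrow> real^('n + 'n) \<Rightarrow> real"
  assumes rho: "smooth_on ({0<..} \<times> UNIV) (\<lambda>(t, z). rho t z)"
    and nonneg: "\<And>t z. t > 0 \<Longrightarrow> rho t z \<ge> 0"
    and c0: "c0 \<ge> 0"
    and grad_bound: "\<And>t z. t > 0 \<Longrightarrow>
       norm (grad (rho t) z) \<le> c0 * exp (- U z / 2) * (norm (xpart z) + norm (vpart z))"
    and C: "C \<ge> 0" "\<And>z. - U z / 2 \<le> C * (1 + (norm z)\<^sup>2)"
    and s: "s > 0" and T: "T \<ge> 0" and \<delta>: "\<delta> > 0"
  shows "\<exists>C'\<ge>0. \<forall>\<theta> z. 0 \<le> \<theta> \<longrightarrow> \<theta> \<le> T \<longrightarrow> ln (rho (s + \<theta>) z + \<delta>) - U z / 2 \<le> C' * (1 + (norm z)\<^sup>2)"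
proof -
  let ?f = "\<lambda>(t, z). rho t z"
  have d: "?f differentiable (at (t, z))" if "t > 0" for t z
    using smooth_on_differentiable[OF rho] that by simp
  have td: "twice_diff (rho t)" if "t > 0" for t by (rule smooth_slice_twice_diff[OF rho that])
  have "continuous_on {s..s + T} (\<lambda>t. rho t 0)"
  proof (intro continuous_at_imp_continuous_on ballI)
    fix t assume "t \<in> {s..s + T}"
    then have "isCont ?f (t, 0)" using d[of t 0] s by (intro differentiable_imp_continuous_within) auto
    moreover have "isCont (\<lambda>t. (t, 0 :: real^('n + 'n))) t" by (intro continuous_intros)
    ultimately show "isCont (\<lambda>t. rho t 0) t" using isCont_o2[where f = "\<lambda>t. (t, 0)" and g = ?f and a = t] by simp
  qed
  then have "bounded ((\<lambda>t. rho t 0) ` {s..s + T})"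
    by (intro compact_imp_bounded compact_continuous_image) auto
  then obtain M0 where M0: "\<And>t. s \<le> t \<Longrightarrow> t \<le> s + T \<Longrightarrow> norm (rho t 0) \<le> M0"
    unfolding bounded_iff by (metis atLeastAtMost_iff imageI)
  have M00: "M0 \<ge> 0" using M0[of s] T norm_ge_zero[of "rho s 0"] by linarith
  define M where "M = M0 + 2 * c0 + 1 + \<delta>"
  have M: "M \<ge> 1" using M00 c0 \<delta> by (simp add: M_def)
  have main: "ln (rho t z + \<delta>) - U z / 2 \<le> (ln M + 1 + 2 * C) * (1 + (norm z)\<^sup>2)" if t: "s \<le> t" "t \<le> s + T" for t z
  proof -
    have t0: "t > 0" using t s by simp
    define Q where "Q = 1 + (norm z)\<^sup>2"
    have Q: "Q \<ge> 1" by (simp add: Q_def)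
    have df: "rho t differentiable (at y)" for y using td[OF t0] by (simp add: twice_diff_def)
    have "\<exists>x. 0 < x \<and> x < 1 \<and> rho t (0 + 1 *\<^sub>R z) - rho t (0 + 0 *\<^sub>R z) = (1 - 0) * partial z (rho t) (0 + x *\<^sub>R z)"
      by (rule MVT2[of 0 1 "\<lambda>s. rho t (0 + s *\<^sub>R z)" "\<lambda>s. partial z (rho t) (0 + s *\<^sub>R z)", OF zero_less_one partial_line[OF df]])
    then obtain x where x: "0 < x" "x < 1" "rho t z - rho t 0 = partial z (rho t) (x *\<^sub>R z)" by auto
    have nx: "norm (x *\<^sub>R z) \<le> norm z" using x by (simp add: mult_left_le_one_le)
    have "partial z (rho t) (x *\<^sub>R z) \<le> norm (grad (rho t) (x *\<^sub>R z)) * norm z"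
      unfolding partial_eq_inner_grad[OF df] by (rule norm_cauchy_schwarz)
    also have "\<dots> \<le> (c0 * exp (C * Q) * (2 * norm z)) * norm z"
    proof (rule mult_right_mono)
      have "norm (grad (rho t) (x *\<^sub>R z)) \<le> c0 * exp (- U (x *\<^sub>R z) / 2) * (norm (xpart (x *\<^sub>R z)) + norm (vpart (x *\<^sub>R z)))"
        by (rule grad_bound[OF t0])
      also have "\<dots> \<le> c0 * exp (C * Q) * (2 * norm z)"
      proof (intro mult_mono mult_left_mono)
        have "C * (1 + (norm (x *\<^sub>R z))\<^sup>2) \<le> C * Q"
          unfolding Q_def using nx C(1) by (intro mult_left_mono add_mono power_mono) auto
        then show "exp (- U (x *\<^sub>R z) / 2) \<le> exp (C * Q)" using C(2)[of "x *\<^sub>R z"] by simp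
        show "norm (xpart (x *\<^sub>R z)) + norm (vpart (x *\<^sub>R z)) \<le> 2 * norm z"
          using norm_xpart_vpart_le[of "x *\<^sub>R z"] nx by linarith
      qed (use c0 in auto)
      finally show "norm (grad (rho t) (x *\<^sub>R z)) \<le> c0 * exp (C * Q) * (2 * norm z)" .
    qed simp
    also have "\<dots> = 2 * c0 * exp (C * Q) * (norm z)\<^sup>2" by (simp add: power2_eq_square)
    also have "\<dots> \<le> 2 * c0 * exp (C * Q) * exp Q"
      using exp_ge_add_one_self[of Q] c0 by (intro mult_left_mono) (auto simp: Q_def)
    also have "\<dots> = 2 * c0 * exp ((C + 1) * Q)" by (simp add: distrib_right exp_add)
    finally have "rho t z + \<delta> \<le> (M0 + \<delta> + 1) * 1 + 2 * c0 * exp ((C + 1) * Q)"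
      using x(3) M0[OF t] by simp
    also have "\<dots> \<le> (M0 + \<delta> + 1) * exp ((C + 1) * Q) + 2 * c0 * exp ((C + 1) * Q)"
      using M00 \<delta> C(1) Q by (intro add_right_mono mult_left_mono) auto
    also have "\<dots> = M * exp ((C + 1) * Q)" by (simp add: M_def algebra_simps)
    finally have "ln (rho t z + \<delta>) \<le> ln (M * exp ((C + 1) * Q))"
      using nonneg[OF t0, of z] \<delta> by (subst ln_le_cancel_iff) (auto intro: add_nonneg_pos order_less_le_trans)
    also have "\<dots> = ln M * 1 + (C + 1) * Q" using M by (simp add: ln_mult)
    also have "\<dots> \<le> ln M * Q + (C + 1) * Q" using M Q by (intro add_right_mono mult_left_mono) auto
    finally show ?thesis using C(2)[of z] by (simp add: Q_def[symmetric] algebra_simps)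
  qed
  show ?thesis using main M C(1) by (intro exI[of _ "ln M + 1 + 2 * C"]) auto
qed

text \<open>The extremal has duration \<open>T\<close> and ends at displacement \<open>y\<close> at
  time \<open>t\<close>. Because \<open>T < t\<close>, it runs in the compact time interval from
  \<open>t - T\<close> to \<open>t\<close> inside the positive times, where one growth constant
  serves throughout.\<close>

lemma density_midpoint_convexity:
  fixes U :: "real^('n::finite + 'n) \<Rightarrow> real" and rho :: "real \<Rightarrow> real^('n + 'n) \<Rightarrow> real"
  assumes U: "smooth_on UNIV U" and rho: "smooth_on ({0<..} \<times> UNIV) (\<lambda>(t, z). rho t z)"
    and nonneg: "\<And>t z. t > 0 \<Longrightarrow> rho t z \<ge> 0"
    and pde: "\<And>t z. t > 0 \<Longrightarrow>
       deriv (\<lambda>s. rho s z) t =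
         lap_v (rho t) z - grad_v U z \<bullet> grad_v (rho t) z - vpart z \<bullet> grad_x (rho t) z"
    and nonneg_const: "c0 \<ge> 0" "k0 \<ge> 0" "\<kappa> \<ge> 0"
    and grad_bound: "\<And>t z. t > 0 \<Longrightarrow>
       norm (grad (rho t) z) \<le> c0 * exp (- U z / 2) * (norm (xpart z) + norm (vpart z))"
    and hess_U: "\<And>z. mat_le (hess U z)
              ((k0 * exp (\<kappa> * ((norm (xpart z))\<^sup>2 + (norm (vpart z))\<^sup>2))) *\<^sub>R mat 1)"
    and hess_h: "\<And>z. mat_le (- K) (hess (kfp_potential U) z)"
    and N_inv: "\<And>t. t > 0 \<Longrightarrow> invertible (N t)"
    and riccati: "\<And>t. t > 0 \<Longrightarrow>
       (N has_vector_derivative (N t ** Cmat + transpose Cmat ** N t + N t ** Dmat ** N t - K)) (at t)"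
    and N_lim: "((\<lambda>t. matrix_inv (N t)) \<longlongrightarrow> 0) (at_right 0)"
    and \<delta>: "\<delta> > 0" and T: "0 < T" "T < t"
  shows "2 * (ln (rho t z + \<delta>) - U z / 2) \<le> (ln (rho t (z + y) + \<delta>) - U (z + y) / 2)
     + (ln (rho t (z - y) + \<delta>) - U (z - y) / 2) - y \<bullet> (N T *v y)"
proof -
  let ?w = "\<lambda>t z. ln (rho t z + \<delta>) - U z / 2"
  obtain C2 where C2: "C2 \<ge> 0" "\<And>z. kfp_potential U z \<le> C2 * (1 + (norm z)\<^sup>2)"
    using potential_and_weight_bounds(1)[OF U nonneg_const(2,3) hess_U hess_h] by blast
  obtain C3 where C3: "C3 \<ge> 0" "\<And>z. - U z / 2 \<le> C3 * (1 + (norm z)\<^sup>2)"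
    using potential_and_weight_bounds(2)[OF U nonneg_const(2,3) hess_U hess_h] by blast
  have s: "t - T > 0" using T by simp
  obtain C4 where C4: "C4 \<ge> 0"
    "\<And>\<theta> z. 0 \<le> \<theta> \<Longrightarrow> \<theta> \<le> T \<Longrightarrow> ?w (t - T + \<theta>) z \<le> C4 * (1 + (norm z)\<^sup>2)"
    using log_density_growth[OF rho nonneg nonneg_const(1) grad_bound C3 s _ \<delta>, of T] T by (metis less_imp_le)
  note jet = log_density_jet[OF smooth_on_twice_diff[OF U] smooth_slice_twice_diff[OF rho] _ nonneg _ \<delta> pde]
  have d: "(\<lambda>(t, z). rho t z) differentiable (at (t, z))" if "t > 0" for t z
    using smooth_on_differentiable[OF rho] that by simp
  interpret log_solution ?w "kfp_potential U"
    "\<lambda>i t z. partial (axis (Inr i) 1) (rho t) z / (rho t z + \<delta>) - partial (axis (Inr i) 1) U z / 2"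
    "\<lambda>i t z. partial (axis (Inr i) 1) (partial (axis (Inr i) 1) (rho t)) z / (rho t z + \<delta>)
        - (partial (axis (Inr i) 1) (rho t) z / (rho t z + \<delta>))\<^sup>2
        - partial (axis (Inr i) 1) (partial (axis (Inr i) 1) U) z / 2"
    K C2
    by unfold_locales
      (use jet d C2 semiconvex_midpoint[OF kfp_potential_twice_diff[OF U] hess_h] in \<open>auto simp only:\<close>)
  obtain \<eta> b A a where ext:
    "\<And>\<theta>. (\<eta> has_vector_derivative (drift (\<eta> \<theta>) + embed_v (b \<theta>))) (at \<theta>)"
    "\<And>\<theta>. (A has_real_derivative a \<theta>) (at \<theta>)"
    "\<And>\<theta>. a \<theta> = (\<eta> \<theta> \<bullet> (K *v \<eta> \<theta>)) / 2 + (norm (b \<theta>))\<^sup>2 / 4"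
    "\<eta> 0 = 0" "A 0 = 0" "\<eta> T = y" "A T = - (y \<bullet> (N T *v y)) / 2"
    using riccati_extremal[OF N_inv riccati N_lim T(1), of y] by blast
  have "?w (t - T + T) z \<le> (?w (t - T + T) (z + \<eta> T) + ?w (t - T + T) (z - \<eta> T)) / 2 + A T"
    by (rule midpoint_comparison[OF s _ ext(1,2) _ C4 ext(4,5)]) (use T ext(3) in auto)
  then show ?thesis by (simp add: ext(6,7) field_simps)
qed

theorem theorem4p1:
  fixes U :: "real^('n::finite + 'n) \<Rightarrow> real"
    and rho :: "real \<Rightarrow> real^('n + 'n) \<Rightarrow> real"
    and c0 k0 \<kappa> :: real
    and K :: "real^('n + 'n)^('n + 'n)"
    and N :: "real \<Rightarrow> real^('n + 'n)^('n + 'n)"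
  assumes U_smooth: "smooth_on UNIV U"
    and rho_smooth: "smooth_on ({0<..} \<times> UNIV) (\<lambda>(t, z). rho t z)"
    and rho_nonneg: "\<And>t z. t > 0 \<Longrightarrow> rho t z \<ge> 0"
    and pde: "\<And>t z. t > 0 \<Longrightarrow>
       deriv (\<lambda>s. rho s z) t =
         lap_v (rho t) z - grad_v U z \<bullet> grad_v (rho t) z - vpart z \<bullet> grad_x (rho t) z"
    and nonneg_consts: "c0 \<ge> 0" "k0 \<ge> 0" "\<kappa> \<ge> 0"
    and grad_bound: "\<And>t z. t > 0 \<Longrightarrow>
       norm (grad (rho t) z) \<le> c0 * exp (- U z / 2) * (norm (xpart z) + norm (vpart z))"
    and hess_rho_bound: "\<And>t z. t > 0 \<Longrightarrow>
       mat_le (- (k0 * exp (\<kappa> * ((norm (xpart z))\<^sup>2 + (norm (vpart z))\<^sup>2))) *\<^sub>R mat 1)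
              (hess (rho t) z)"
    and hess_U_bound: "\<And>z.
       mat_le (hess U z)
              ((k0 * exp (\<kappa> * ((norm (xpart z))\<^sup>2 + (norm (vpart z))\<^sup>2))) *\<^sub>R mat 1)"
    and K_sym: "transpose K = K"
    and K_nonneg: "\<And>\<xi>. 0 \<le> \<xi> \<bullet> (K *v \<xi>)"
    and hess_h: "\<And>z. mat_le (- K)
       (hess (\<lambda>w. - (1/2) * (vpart w \<bullet> grad_x U w) + (1/2) * lap_v U w
                    - (1/4) * (norm (grad_v U w))\<^sup>2) z)"
    and N_inv: "\<And>t. t > 0 \<Longrightarrow> invertible (N t)"
    and riccati: "\<And>t. t > 0 \<Longrightarrow>
       (N has_vector_derivative
          (N t ** Cmat + transpose Cmat ** N t + N t ** Dmat ** N t - K)) (at t)"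
    and N_lim: "((\<lambda>t. matrix_inv (N t)) \<longlongrightarrow> 0) (at_right 0)"
  shows "\<forall>t>0. \<forall>z. rho t z > 0 \<longrightarrow>
           mat_le (N t) (hess (\<lambda>w. ln (rho t w)) z - (1/2) *\<^sub>R hess U z)"
proof (intro allI impI)
  fix t :: real and z :: "real^('n + 'n)"
  assume t: "t > 0" and pos: "rho t z > 0"
  have hess_kfp: "mat_le (- K) (hess (kfp_potential U) z)" for z
    using hess_h[of z] by (simp only: kfp_potential_def)
  note tU = smooth_on_twice_diff[OF U_smooth] and tr = smooth_slice_twice_diff[OF rho_smooth]
  have "(\<xi> \<bullet> (N t *v \<xi>)) \<le> \<xi> \<bullet> ((hess (\<lambda>w. ln (rho t w)) z - (1/2) *\<^sub>R hess U z) *v \<xi>)" for \<xi>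
  proof -
    define a1 where "a1 = partial \<xi> (rho t) z"
    define a2 where "a2 = \<xi> \<bullet> (hess (rho t) z *v \<xi>)"
    define u2 where "u2 = \<xi> \<bullet> (hess U z *v \<xi>)"
    have le: "\<xi> \<bullet> (N t *v \<xi>) \<le> a2 / (rho t z + \<delta>) - (a1 / (rho t z + \<delta>))\<^sup>2 - u2 / 2" if \<delta>: "\<delta> > 0" for \<delta>
    proof -
      have p: "rho t y + \<delta> > 0" for y using rho_nonneg[OF t, of y] \<delta> by simp
      have "has_d2 (\<lambda>y. rho t y + \<delta>) z \<xi> a1 a2"
        using has_d2_add[OF twice_diff_has_d2[OF tr[OF t], of z \<xi>] has_d2_const[of \<delta>]] by (simp add: a1_def a2_def)
      from has_d2_diff[OF has_d2_ln[OF this p] has_d2_cmult[OF twice_diff_has_d2[OF tU, of z \<xi>], of "1/2"]]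
      have d2: "has_d2 (\<lambda>y. ln (rho t y + \<delta>) - U y / 2) z \<xi> (a1 / (rho t z + \<delta>) - partial \<xi> U z / 2)
         (a2 / (rho t z + \<delta>) - (a1 / (rho t z + \<delta>))\<^sup>2 - u2 / 2)"
        by (simp add: u2_def)
      show ?thesis
      proof (rule midpoint_second_derivative[OF d2])
        fix s
        let ?w = "\<lambda>y. ln (rho t y + \<delta>) - U y / 2" and ?y = "s *\<^sub>R \<xi>"
        have T: "2 * ?w z \<le> ?w (z + ?y) + ?w (z - ?y) - ?y \<bullet> (N T *v ?y)" if "0 < T" "T < t" for T
          by (rule density_midpoint_convexity[OF U_smooth rho_smooth rho_nonneg pde nonneg_consts grad_bound hess_U_bound
                hess_kfp N_inv riccati N_lim \<delta> that])
        \<comment> \<open>The midpoint inequality is available for \<open>T < t\<close> only;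
          \<open>N\<close> is differentiable, hence continuous, at \<open>t\<close>, so the defect
          passes to the limit from the left.\<close>
        have "((\<lambda>T. N T *v ?y) \<longlongrightarrow> N t *v ?y) (at_left t)"
        proof (rule bounded_bilinear.tendsto[OF bounded_bilinear_matrix_vector_mult _ tendsto_const])
          show "(N \<longlongrightarrow> N t) (at_left t)"
            using has_vector_derivative_continuous[OF riccati[OF t]] unfolding isCont_def
            by (rule tendsto_within_subset) simp
        qed
        then have "((\<lambda>T. ?w (z + ?y) + ?w (z - ?y) - ?y \<bullet> (N T *v ?y)) \<longlongrightarrow> ?w (z + ?y) + ?w (z - ?y) - ?y \<bullet> (N t *v ?y)) (at_left t)"
          by (intro tendsto_intros)
        moreover have "\<forall>\<^sub>F T in at_left t. 2 * ?w z \<le> ?w (z + ?y) + ?w (z - ?y) - ?y \<bullet> (N T *v ?y)"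
          using eventually_at_left_real[OF t] by eventually_elim (rule T, auto)
        ultimately have "2 * ?w z \<le> ?w (z + ?y) + ?w (z - ?y) - ?y \<bullet> (N t *v ?y)"
          by (rule tendsto_lowerbound) simp
        then show "2 * ?w z \<le> ?w (z + ?y) + ?w (z - ?y) - s\<^sup>2 * (\<xi> \<bullet> (N t *v \<xi>))"
          by (simp add: matrix_vector_mult_scaleR power2_eq_square mult.assoc)
      qed
    qed
    \<comment> \<open>The lower bound does not depend on \<open>\<delta>\<close>, and
      \<open>pos\<close> keeps the denominators away from zero as \<open>\<delta>\<close> tends to
      0.\<close>
    have "((\<lambda>\<delta>. a2 / (rho t z + \<delta>) - (a1 / (rho t z + \<delta>))\<^sup>2 - u2 / 2) \<longlongrightarrow> a2 / (rho t z + 0) - (a1 / (rho t z + 0))\<^sup>2 - u2 / 2) (at_right 0)"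
      by (intro tendsto_intros) (use pos in auto)
    moreover have "\<forall>\<^sub>F \<delta> in at_right 0. \<xi> \<bullet> (N t *v \<xi>) \<le> a2 / (rho t z + \<delta>) - (a1 / (rho t z + \<delta>))\<^sup>2 - u2 / 2"
      using eventually_at_right_less[of 0] by eventually_elim (rule le)
    ultimately have "\<xi> \<bullet> (N t *v \<xi>) \<le> a2 / (rho t z + 0) - (a1 / (rho t z + 0))\<^sup>2 - u2 / 2"
      by (rule tendsto_lowerbound) simp
    also have "\<dots> = \<xi> \<bullet> (hess (\<lambda>w. ln (rho t w)) z *v \<xi>) - u2 / 2"
      unfolding hess_ln_quadratic_form[where f = "rho t", OF tr[OF t] pos] by (simp add: a1_def a2_def)
    also have "\<dots> = \<xi> \<bullet> ((hess (\<lambda>w. ln (rho t w)) z - (1/2) *\<^sub>R hess U z) *v \<xi>)"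
      by (simp add: matrix_vector_mult_diff_rdistrib inner_diff_right u2_def scaleR_matrix_vector_assoc[symmetric])
    finally show ?thesis .
  qed
  then show "mat_le (N t) (hess (\<lambda>w. ln (rho t w)) z - (1/2) *\<^sub>R hess U z)"
    unfolding mat_le_def by blast
qed

end
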